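(* Consider the wirelessly-powered network and the EECW control policy with parameter $V>0$ described in the context, together with the dual function $g$, its maximizer $[\bm{\eta}^\star,\bm{\beta}^\star]$, and the derived quantities $\nu^\star_{n,s}$, $\varepsilon^\star_n$ defined in the context. Suppose that, for some $\mathcal{K}>0$, the dual function satisfies $$g([\bm{\eta}^\star,\bm{\beta}^\star])-g([\bm{\eta},\bm{\beta}])\ge\mathcal{K}\,\big\|[\bm{\eta}^\star,\bm{\beta}^\star]-[\bm{\eta},\bm{\beta}]\big\|\qquad\text{for all }\bm{\eta},\bm{\beta}\ge0 .$$ Then, under EECW, there exist constants $D$, $c^\star$ and $b^\star$, independent of $V$, such that for every $m\ge0$ $$\limsup_{T\to\infty}\frac1T\sum_{t=0}^{T-1}\Pr\{\exists (n,s):|U_{n,s}(t)-\nu^\star_{n,s}|>D+m\}\le c^\star e^{-b^\star m},$$ $$\limsup_{T\to\infty}\frac1T\sum_{t=0}^{T-1}\Pr\Big\{\exists n:|B_n(t)-\varepsilon^\star_n|>\frac{(S+1)D+m}{\mathcal{C}}\Big\}\le 2c^\star e^{-b^\star\frac{m}{S+1}}.$$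
   Context: **Network model.** There are one energy access point (E-AP) with $M$ antennas, $N$ single-antenna wireless nodes, $S$ data streams between distinct endpoints, and $L$ directed data links; link $l$ goes from its head node $N_h(l)$ (transmitter) to its tail node $N_t(l)$ (receiver). $\mathcal{O}_n$ and $\mathcal{I}_n$ are the sets of outgoing and incoming links of node $n$. Time is slotted, $t=0,1,2,\dots$. Each slot has useful length $\tau_f$, split as $\tau_e(t)+\tau_d(t)=\tau_f$ (nonnegative energy and data transmission durations). Channel gains $\bm{g}(t)=(g_1(t),\dots,g_L(t))$ (data links) and $\bm{h}_n(t)=(h_n^1(t),\dots,h_n^M(t))$ (row vector, energy link to node $n$) are constant in a slot and random, independent and identically distributed across slots. Vectors are row vectors; $^T$, $^H$, $^\ast$ are transpose, conjugate transpose, entrywise conjugate; $[x]^+=\max\{x,0\}$. *Data links.* The power vector $\bm{p}(t)=(p_1(t),\dots,p_L(t))$ lies in a finite set $\Pi$ of feasible nonnegative vectors; setting any entry of an element of $\Pi$ to zero gives an element of $\Pi$; the total transmit power of each node is at most $P_{\mathrm{WN}}^{\max}$. The rate-power functions $R_l(\bm{p},\bm{g})\ge 0$ satisfy, with a constant $\delta>0$: whenever $\bm{p},\tilde{\bm{p}}\in\Pi$ differ only in entry $l'$ with $\tilde p_{l'}<p_{l'}$, (i) if $\tilde p_{l'}=0$ then $R_{l'}(\tilde{\bm{p}},\bm{g})=0$; (ii) $R_{l'}(\bm{p},\bm{g})-R_{l'}(\tilde{\bm{p}},\bm{g})\le\delta(p_{l'}-\tilde p_{l'})$; (iii) $R_l(\bm{p},\bm{g})\le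 R_l(\tilde{\bm{p}},\bm{g})$ for all $l\ne l'$. The rate $R_{l,s}(t)\ge0$ given to stream $s$ on link $l$ satisfies $\sum_s R_{l,s}(t)\le R_l(\bm{p}(t),\bm{g}(t))$. *Energy links.* With beamforming vector $\bm{w}(t)\in\mathbb{C}^M$, $\|\bm{w}(t)\|=1$, and E-AP power $P_{\mathrm{AP}}(t)\in[0,P_{\mathrm{AP}}^{\max}]$, the E-AP energy is $E_{\mathrm{AP}}(t)=\tau_e(t)P_{\mathrm{AP}}(t)$ and node $n$ receives $E_n(t)=|\bm{w}(t)\bm{h}_n^T(t)|^2E_{\mathrm{AP}}(t)$. *Queues and batteries.* $U_{n,s}(t+1)=[U_{n,s}(t)-\mu^{\mathrm{out}}_{n,s}(t)]^++\mu^{\mathrm{in}}_{n,s}(t)$, where $\mu^{\mathrm{out}}_{n,s}(t)=\tau_d(t)\sum_{l\in\mathcal{O}_n}R_{l,s}(t)$ and $\mu^{\mathrm{in}}_{n,s}(t)=\tau_d(t)\sum_{l\in\mathcal{I}_n}R_{l,s}(t)+A_{n,s}(t)$. Arrivals $A_{n,s}(t)\in[0,A_{\mathrm m}]$ are i.i.d. over slots with mean $\lambda_{n,s}$, where $\lambda_{n,s}=\lambda_s$ if $n$ is the source of stream $s$ and $0$ otherwise; $\bm{\lambda}=[\lambda_1,\dots,\lambda_S]$. Battery: $B_n(t+1)=B_n(t)-\phi^{\mathrm{out}}_n(t)+\phi^{\mathrm{in}}_n(t)$, where $\phi^{\mathrm{out}}_n(t)=\tau_d(t)\sum_{l\in\mathcal{O}_n}p_l(t)$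 and the stored energy satisfies $0\le\phi^{\mathrm{in}}_n(t)\le E_n(t)$. It is assumed that $\mu^{\mathrm{in}}_{n,s}(t),\mu^{\mathrm{out}}_{n,s}(t)\le\mu_{\max}$ and $\phi^{\mathrm{out}}_n(t),E_n(t)\le\phi_{\max}$ always. **EECW policy.** Fix $\alpha>1$, $V>0$; $\mathcal{C}=\frac{2\delta}{1-1/\alpha}$; $Z_n(t)=\sum_sU_{n,s}(t)-\mathcal{C}B_n(t)$. - Initialization: $U_{n,s}(0)=U_0:=\max\{\phi_{\max}(\mathcal{C}+\alpha\delta),\mu_{\max}\}$ (dummy data), $B_n(0)=0$. - Routing: $W_{l,s}(t)=Z_{N_h(l)}(t)-Z_{N_t(l)}(t)+U_{N_h(l),s}(t)-U_{N_t(l),s}(t)$; $s_l(t)=\arg\max_sW_{l,s}(t)$; $W_l(t)=\max\{\max_sW_{l,s}(t),0\}$; $R_{l,s_l(t)}(t)=R_l(\bm{p}(t),\bm{g}(t))$ and $R_{l,s}(t)=0$ for $s\ne s_l(t)$. - Data power: $\bm{p}(t)\in\arg\min_{\tilde{\bm{p}}\in\Pi}\sum_{l=1}^L[\mathcal{C}Z_{N_h(l)}(t)\tilde p_l-W_l(t)R_l(\tilde{\bm{p}},\bm{g}(t))]$. - Energy: $\bm{w}(t)=\bm{v}_{max}^\ast(t)$ with $\bm{v}_{max}(t)$ the (unit) principal eigenvector of $\bm{H}(t)=\mathcal{C}\sum_nZ_n(t)\bm{h}_n^T(t)\bm{h}_n^\ast(t)$; $P_{\mathrm{AP}}(t)=P_{\mathrm{AP}}^{\max}$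 if $V<\mathcal{C}\sum_n|\bm{w}(t)\bm{h}_n^T(t)|^2Z_n(t)$ and $0$ otherwise. - Time sharing: with $F_d^\star(t)=\sum_l[\mathcal{C}Z_{N_h(l)}(t)p_l(t)-W_l(t)R_l(\bm{p}(t),\bm{g}(t))]$ and $F_e^\star(t)=P_{\mathrm{AP}}(t)(V-\mathcal{C}\sum_n|\bm{w}(t)\bm{h}_n^T(t)|^2Z_n(t))$: $(\tau_e,\tau_d)=(\tau_f,0)$ if $F_e^\star(t)\le F_d^\star(t)$ and $(0,\tau_f)$ otherwise. - Storage: $\phi^{\mathrm{in}}_n(t)=\min\{E_n(t),(Z_n(t)-\mu_{\max})/\mathcal{C}\}$. **Dual problem.** Consider the deterministic (single-slot, stationary) problem of minimizing $V\mathbb{E}\{E_{\mathrm{AP}}(t)\}$ over stationary policies, i.e. choices of $\bm{p}(t),\bm{w}(t),R_{l,s}(t),P_{\mathrm{AP}}(t),\tau_e(t),\tau_d(t)$ (and of the stored energies $\phi_n^{\mathrm{in}}(t)$) as functions of the instantaneous channel state only, satisfying $\bm{p}(t)\in\Pi$, $\sum_sR_{l,s}(t)\le R_l(\bm{p}(t),\bm{g}(t))$, $P_{\mathrm{AP}}(t)\in[0,P_{\mathrm{AP}}^{\max}]$, $\|\bm{w}(t)\|=1$, $\tau_e(t)+\tau_d(t)=\tau_f$, subject to $\mathbb{E}\{\mu^{\mathrm{in}}_{n,s}(t)\}\le\mathbb{E}\{\mu^{\mathrm{out}}_{n,s}(t)\}$ for all $n,s$ and $\mathbb{E}\{\phi^{\mathrm{out}}_n(t)\}\le\mathbb{E}\{\phi^{\mathrm{in}}_n(t)\}$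 for all $n$. Its dual function, for $[\bm{\eta},\bm{\beta}]=[\eta_{n,s}\ge0\ \forall (n,s),\ \beta_n\ge0\ \forall n]$, is $$g([\bm{\eta},\bm{\beta}])=\inf\Big[\mathbb{E}\{VE_{\mathrm{AP}}(t)\}+\mathbb{E}\Big\{\sum_{n,s}\eta_{n,s}(\mu^{\mathrm{in}}_{n,s}(t)-\mu^{\mathrm{out}}_{n,s}(t))+\sum_n\beta_n(\phi^{\mathrm{out}}_n(t)-\phi^{\mathrm{in}}_n(t))\Big\}\Big],$$ the infimum being over those policies (without the two expectation constraints). $[\bm{\eta}^\star,\bm{\beta}^\star]$ is the maximizer of $g$ over $\bm{\eta},\bm{\beta}\ge0$. Define $$\nu^\star_{n,s}=\eta^\star_{n,s}-\frac{\beta^\star_n}{\mathcal{C}},\qquad \zeta^\star_n=\frac{\beta^\star_n}{\mathcal{C}},\qquad \varepsilon^\star_n=\frac{\sum_s\nu^\star_{n,s}-\zeta^\star_n}{\mathcal{C}}.$$ *)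

theory Defs
  imports "HOL-Probability.Probability"
begin

section \<open>Network parameters\<close>

text \<open>
  The index types of nodes, streams, links and E-AP antennas are \<open>'n\<close>, \<open>'s\<close>, \<open>'l\<close>, \<open>'m\<close>.
  Following the terminology of the model, \<open>head l\<close> is the \<^emph>\<open>transmitter\<close> and \<open>tail l\<close> the
  \<^emph>\<open>receiver\<close> of link \<open>l\<close>.

  \<open>sinks\<close> is the set of pairs \<open>(n, s)\<close> such that data of stream \<open>s\<close> leave the network on
  reaching \<open>n\<close>; it may only contain the pairs \<open>(dst s, s)\<close>. If it contains all of them, delivered
  data are removed, the usual convention of multi-hop queueing networks. If it is empty, every
  pair \<open>(n, s)\<close> is an ordinary queue; then the network has no way to lose data, and the dual
  function is unbounded above as soon as some arrival rate is positive.
\<close>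

record ('n, 's, 'l) wpn =
  head :: "'l \<Rightarrow> 'n"
  tail :: "'l \<Rightarrow> 'n"
  src :: "'s \<Rightarrow> 'n"
  dst :: "'s \<Rightarrow> 'n"
  sinks :: "('n \<times> 's) set"
  powers :: "(real ^ 'l) set"
  rate_fun :: "'l \<Rightarrow> real ^ 'l \<Rightarrow> complex ^ 'l \<Rightarrow> real"
  delta :: real
  tau_f :: real
  P_WN :: real
  P_AP_max :: real
  arr_rate :: "'s \<Rightarrow> real"
  A_max :: real
  mu_max :: real
  phi_max :: real

definition out_links :: "('n, 's, 'l::finite) wpn \<Rightarrow> 'n \<Rightarrow> 'l set"
  where "out_links N n = {l. head N l = n}"

definition in_links :: "('n, 's, 'l::finite) wpn \<Rightarrow> 'n \<Rightarrow> 'l set"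
  where "in_links N n = {l. tail N l = n}"

definition lambda :: "('n, 's, 'l::finite) wpn \<Rightarrow> 'n \<Rightarrow> 's \<Rightarrow> real"
  where "lambda N n s = (if n = src N s then arr_rate N s else 0)"

text \<open>
  Zero power giving zero rate is required of all feasible vectors, so that it also covers a link
  that no feasible vector powers.
\<close>

definition wpn_network :: "('n::finite, 's::finite, 'l::finite) wpn \<Rightarrow> bool"
  where "wpn_network N \<longleftrightarrow>
    (\<forall>s. src N s \<noteq> dst N s) \<and>
    sinks N \<subseteq> range (\<lambda>s. (dst N s, s)) \<and>
    finite (powers N) \<and> powers N \<noteq> {} \<and>
    (\<forall>p\<in>powers N. \<forall>l. 0 \<le> p $ l) \<and>
    (\<forall>p\<in>powers N. \<forall>l. (\<chi> k. if k = l then 0 else p $ k) \<in> powers N) \<and>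
    (\<forall>p\<in>powers N. \<forall>n. (\<Sum>l\<in>out_links N n. p $ l) \<le> P_WN N) \<and>
    (\<forall>p\<in>powers N. \<forall>l. rate_fun N l p \<in> borel_measurable borel) \<and>
    (\<forall>p\<in>powers N. \<forall>l g. 0 \<le> rate_fun N l p g) \<and>
    (\<forall>p\<in>powers N. \<forall>l g. p $ l = 0 \<longrightarrow> rate_fun N l p g = 0) \<and>
    (\<forall>p\<in>powers N. \<forall>q\<in>powers N. \<forall>l g.
       (\<forall>k. k \<noteq> l \<longrightarrow> q $ k = p $ k) \<and> q $ l < p $ l \<longrightarrow>
         rate_fun N l p g - rate_fun N l q g \<le> delta N * (p $ l - q $ l) \<and>
         (\<forall>k. k \<noteq> l \<longrightarrow> rate_fun N k p g \<le> rate_fun N k q g)) \<and>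
    0 < delta N \<and> 0 < tau_f N \<and> 0 \<le> P_AP_max N"


section \<open>Control actions of one slot\<close>

record ('n, 's, 'l, 'm) action =
  pow :: "real ^ 'l"
  bf :: "complex ^ 'm"
  rate :: "real ^ 's ^ 'l"
  P_AP :: real
  tau_e :: real
  tau_d :: real
  stored :: "real ^ 'n"

definition mu_out ::
    "('n, 's, 'l) wpn \<Rightarrow> ('n::finite, 's::finite, 'l::finite, 'm::finite) action \<Rightarrow> 'n \<Rightarrow> 's \<Rightarrow> real"
  where "mu_out N a n s = tau_d a * (\<Sum>l\<in>out_links N n. rate a $ l $ s)"

definition mu_in ::
    "('n, 's, 'l) wpn \<Rightarrow> real ^ 's ^ 'n \<Rightarrow> ('n::finite, 's::finite, 'l::finite, 'm::finite) action
      \<Rightarrow> 'n \<Rightarrow> 's \<Rightarrow> real"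
  where "mu_in N A a n s = tau_d a * (\<Sum>l\<in>in_links N n. rate a $ l $ s) + A $ n $ s"

definition phi_out ::
    "('n, 's, 'l) wpn \<Rightarrow> ('n::finite, 's::finite, 'l::finite, 'm::finite) action \<Rightarrow> 'n \<Rightarrow> real"
  where "phi_out N a n = tau_d a * (\<Sum>l\<in>out_links N n. pow a $ l)"

definition E_AP :: "('n::finite, 's::finite, 'l::finite, 'm::finite) action \<Rightarrow> real"
  where "E_AP a = tau_e a * P_AP a"

text \<open>The power gain \<open>|w h\<^sup>T|\<^sup>2\<close>; there is no conjugation in the product.\<close>

definition bf_gain :: "complex ^ 'm::finite \<Rightarrow> complex ^ 'm \<Rightarrow> real"
  where "bf_gain w h = (cmod (\<Sum>i\<in>UNIV. w $ i * h $ i))\<^sup>2"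

definition E_rx ::
    "complex ^ 'm ^ 'n \<Rightarrow> ('n::finite, 's::finite, 'l::finite, 'm::finite) action \<Rightarrow> 'n \<Rightarrow> real"
  where "E_rx h a n = bf_gain (bf a) (h $ n) * E_AP a"

definition feasible ::
    "('n, 's, 'l) wpn \<Rightarrow> complex ^ 'l \<Rightarrow> complex ^ 'm ^ 'n
      \<Rightarrow> ('n::finite, 's::finite, 'l::finite, 'm::finite) action \<Rightarrow> bool"
  where "feasible N g h a \<longleftrightarrow>
    pow a \<in> powers N \<and>
    (\<forall>l s. 0 \<le> rate a $ l $ s) \<and>
    (\<forall>l. (\<Sum>s\<in>UNIV. rate a $ l $ s) \<le> rate_fun N l (pow a) g) \<and>
    norm (bf a) = 1 \<and>
    0 \<le> P_AP a \<and> P_AP a \<le> P_AP_max N \<and>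
    0 \<le> tau_e a \<and> 0 \<le> tau_d a \<and> tau_e a + tau_d a = tau_f N \<and>
    (\<forall>n. 0 \<le> stored a $ n \<and> stored a $ n \<le> E_rx h a n)"

definition action_measurable ::
    "'b measure \<Rightarrow> ('b \<Rightarrow> ('n::finite, 's::finite, 'l::finite, 'm::finite) action) \<Rightarrow> bool"
  where "action_measurable F f \<longleftrightarrow>
    (\<lambda>x. pow (f x)) \<in> borel_measurable F \<and>
    (\<lambda>x. bf (f x)) \<in> borel_measurable F \<and>
    (\<lambda>x. rate (f x)) \<in> borel_measurable F \<and>
    (\<lambda>x. P_AP (f x)) \<in> borel_measurable F \<and>
    (\<lambda>x. tau_e (f x)) \<in> borel_measurable F \<and>
    (\<lambda>x. tau_d (f x)) \<in> borel_measurable F \<and>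
    (\<lambda>x. stored (f x)) \<in> borel_measurable F"


section \<open>Channels and arrivals\<close>

text \<open>
  \<open>G t\<close>, \<open>H t\<close>, \<open>A t\<close> are the data-link gains, energy-link gains and arrivals of slot \<open>t\<close>. The
  joint vectors are i.i.d. over the slots; dependence inside a slot is allowed. The bounds
  \<open>mu_max\<close> and \<open>phi_max\<close> hold for whatever feasible action is taken in the slot.
\<close>

definition slot_process ::
    "('n::finite, 's::finite, 'l::finite) wpn \<Rightarrow> 'w measure \<Rightarrow> (nat \<Rightarrow> 'w \<Rightarrow> complex ^ 'l)
      \<Rightarrow> (nat \<Rightarrow> 'w \<Rightarrow> complex ^ 'm::finite ^ 'n) \<Rightarrow> (nat \<Rightarrow> 'w \<Rightarrow> real ^ 's ^ 'n) \<Rightarrow> bool"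
  where "slot_process N M G H A \<longleftrightarrow>
    prob_space M \<and>
    prob_space.indep_vars M (\<lambda>_. borel) (\<lambda>t \<omega>. (G t \<omega>, H t \<omega>, A t \<omega>)) UNIV \<and>
    (\<forall>t. distr M borel (\<lambda>\<omega>. (G t \<omega>, H t \<omega>, A t \<omega>)) = distr M borel (\<lambda>\<omega>. (G 0 \<omega>, H 0 \<omega>, A 0 \<omega>))) \<and>
    (\<forall>t. \<forall>\<omega>\<in>space M. \<forall>n s. 0 \<le> A t \<omega> $ n $ s \<and> A t \<omega> $ n $ s \<le> A_max N) \<and>
    (\<forall>t n s. (\<integral>\<omega>. A t \<omega> $ n $ s \<partial>M) = lambda N n s) \<and>
    (\<forall>t. \<forall>\<omega>\<in>space M. \<forall>a. feasible N (G t \<omega>) (H t \<omega>) a \<longrightarrow>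
       (\<forall>n s. mu_in N (A t \<omega>) a n s \<le> mu_max N \<and> mu_out N a n s \<le> mu_max N) \<and>
       (\<forall>n. phi_out N a n \<le> phi_max N \<and> E_rx (H t \<omega>) a n \<le> phi_max N))"


section \<open>The dual function\<close>

definition stationary_policy ::
    "('n, 's, 'l) wpn \<Rightarrow> ((complex ^ 'l) \<times> (complex ^ 'm ^ 'n)
      \<Rightarrow> ('n::finite, 's::finite, 'l::finite, 'm::finite) action) \<Rightarrow> bool"
  where "stationary_policy N \<pi> \<longleftrightarrow>
    action_measurable borel \<pi> \<and> (\<forall>g h. feasible N g h (\<pi> (g, h)))"

text \<open>
  By stationarity the expectations may be taken in slot 0. For feasible measurable policies all
  integrands are bounded, so the integrals and the infimum are genuine.
\<close>

definition lagrangian ::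
    "('n, 's, 'l) wpn \<Rightarrow> 'w measure \<Rightarrow> (nat \<Rightarrow> 'w \<Rightarrow> complex ^ 'l) \<Rightarrow> (nat \<Rightarrow> 'w \<Rightarrow> complex ^ 'm ^ 'n)
      \<Rightarrow> (nat \<Rightarrow> 'w \<Rightarrow> real ^ 's ^ 'n) \<Rightarrow> real
      \<Rightarrow> ((complex ^ 'l) \<times> (complex ^ 'm ^ 'n)
          \<Rightarrow> ('n::finite, 's::finite, 'l::finite, 'm::finite) action)
      \<Rightarrow> real ^ 's ^ 'n \<Rightarrow> real ^ 'n \<Rightarrow> real"
  where "lagrangian N M G H A V \<pi> \<eta> \<beta> =
    (\<integral>\<omega>. V * E_AP (\<pi> (G 0 \<omega>, H 0 \<omega>)) \<partial>M) +
    (\<integral>\<omega>. (let a = \<pi> (G 0 \<omega>, H 0 \<omega>) in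
       (\<Sum>n\<in>UNIV. \<Sum>s\<in>UNIV. \<eta> $ n $ s * (mu_in N (A 0 \<omega>) a n s - mu_out N a n s)) +
       (\<Sum>n\<in>UNIV. \<beta> $ n * (phi_out N a n - stored a $ n))) \<partial>M)"

definition dual_fun ::
    "('n, 's, 'l) wpn \<Rightarrow> 'w measure \<Rightarrow> (nat \<Rightarrow> 'w \<Rightarrow> complex ^ 'l) \<Rightarrow> (nat \<Rightarrow> 'w \<Rightarrow> complex ^ 'm ^ 'n)
      \<Rightarrow> (nat \<Rightarrow> 'w \<Rightarrow> real ^ 's ^ 'n) \<Rightarrow> real
      \<Rightarrow> (real ^ 's::finite ^ 'n::finite) \<times> (real ^ 'n) \<Rightarrow> real"
  where "dual_fun N M G H A V y =
    Inf {lagrangian N M G H A V (\<pi> :: (complex ^ 'l::finite) \<times> (complex ^ 'm::finite ^ 'n)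
            \<Rightarrow> ('n, 's, 'l, 'm) action) (fst y) (snd y) | \<pi>. stationary_policy N \<pi>}"

text \<open>Pairs in \<open>sinks\<close> carry no constraint, so their multiplier is fixed to 0.\<close>

definition dual_domain :: "('n::finite, 's::finite, 'l::finite) wpn \<Rightarrow> ((real ^ 's ^ 'n) \<times> (real ^ 'n)) set"
  where "dual_domain N = {(\<eta>, \<beta>).
    (\<forall>n s. 0 \<le> \<eta> $ n $ s) \<and> (\<forall>n. 0 \<le> \<beta> $ n) \<and> (\<forall>(n, s)\<in>sinks N. \<eta> $ n $ s = 0)}"

definition dual_maximizer ::
    "('n::finite, 's::finite, 'l::finite) wpn \<Rightarrow> 'w measure \<Rightarrow> (nat \<Rightarrow> 'w \<Rightarrow> complex ^ 'l)
      \<Rightarrow> (nat \<Rightarrow> 'w \<Rightarrow> complex ^ 'm::finite ^ 'n) \<Rightarrow> (nat \<Rightarrow> 'w \<Rightarrow> real ^ 's ^ 'n) \<Rightarrow> real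
      \<Rightarrow> (real ^ 's ^ 'n) \<times> (real ^ 'n) \<Rightarrow> bool"
  where "dual_maximizer N M G H A V y \<longleftrightarrow>
    is_arg_max (dual_fun N M G H A V) (\<lambda>y. y \<in> dual_domain N) y"


section \<open>The EECW policy\<close>

definition CC :: "('n, 's, 'l::finite) wpn \<Rightarrow> real \<Rightarrow> real"
  where "CC N \<alpha> = 2 * delta N / (1 - 1 / \<alpha>)"

definition U_init :: "('n, 's, 'l::finite) wpn \<Rightarrow> real \<Rightarrow> real"
  where "U_init N \<alpha> = max (phi_max N * (CC N \<alpha> + \<alpha> * delta N)) (mu_max N)"

definition ZZ ::
    "('n::finite, 's::finite, 'l::finite) wpn \<Rightarrow> real \<Rightarrow> real ^ 's ^ 'n \<Rightarrow> real ^ 'n \<Rightarrow> 'n \<Rightarrow> real"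
  where "ZZ N \<alpha> U B n = (\<Sum>s\<in>UNIV. U $ n $ s) - CC N \<alpha> * B $ n"

text \<open>
  \<open>price\<close> is the weight \<open>Z\<^sub>n + U\<^sub>n\<^sub>,\<^sub>s\<close> of one unit of stream-\<open>s\<close> data at node \<open>n\<close>; data that have
  left the network weigh 0. Outside \<open>sinks\<close>, \<open>link_weight\<close> is
  \<open>Z\<^sub>h - Z\<^sub>t + U\<^sub>h\<^sub>,\<^sub>s - U\<^sub>t\<^sub>,\<^sub>s\<close>.
\<close>

definition price ::
    "('n::finite, 's::finite, 'l::finite) wpn \<Rightarrow> real \<Rightarrow> real ^ 's ^ 'n \<Rightarrow> real ^ 'n \<Rightarrow> 'n \<Rightarrow> 's \<Rightarrow> real"
  where "price N \<alpha> U B n s = (if (n, s) \<in> sinks N then 0 else ZZ N \<alpha> U B n + U $ n $ s)"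

definition link_weight ::
    "('n::finite, 's::finite, 'l::finite) wpn \<Rightarrow> real \<Rightarrow> real ^ 's ^ 'n \<Rightarrow> real ^ 'n \<Rightarrow> 'l \<Rightarrow> 's \<Rightarrow> real"
  where "link_weight N \<alpha> U B l s = price N \<alpha> U B (head N l) s - price N \<alpha> U B (tail N l) s"

definition max_weight ::
    "('n::finite, 's::finite, 'l::finite) wpn \<Rightarrow> real \<Rightarrow> real ^ 's ^ 'n \<Rightarrow> real ^ 'n \<Rightarrow> 'l \<Rightarrow> real"
  where "max_weight N \<alpha> U B l = max (Max (range (link_weight N \<alpha> U B l))) 0"

definition data_cost ::
    "('n::finite, 's::finite, 'l::finite) wpn \<Rightarrow> real \<Rightarrow> real ^ 's ^ 'n \<Rightarrow> real ^ 'n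
      \<Rightarrow> complex ^ 'l \<Rightarrow> real ^ 'l \<Rightarrow> real"
  where "data_cost N \<alpha> U B g p =
    (\<Sum>l\<in>UNIV. CC N \<alpha> * ZZ N \<alpha> U B (head N l) * p $ l - max_weight N \<alpha> U B l * rate_fun N l p g)"

definition energy_matrix ::
    "('n::finite, 's::finite, 'l::finite) wpn \<Rightarrow> real \<Rightarrow> real ^ 's ^ 'n \<Rightarrow> real ^ 'n
      \<Rightarrow> complex ^ 'm::finite ^ 'n \<Rightarrow> complex ^ 'm ^ 'm"
  where "energy_matrix N \<alpha> U B h =
    (\<chi> i j. of_real (CC N \<alpha>) * (\<Sum>n\<in>UNIV. of_real (ZZ N \<alpha> U B n) * (h $ n $ i * cnj (h $ n $ j))))"

text \<open>Meant for Hermitian matrices, whose eigenvalues are real.\<close>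

definition principal_eigenvector :: "complex ^ 'm::finite ^ 'm \<Rightarrow> complex ^ 'm \<Rightarrow> bool"
  where "principal_eigenvector Q v \<longleftrightarrow> v \<noteq> 0 \<and>
    (\<exists>k::real. Q *v v = of_real k *s v \<and> (\<forall>\<kappa> u. u \<noteq> 0 \<and> Q *v u = \<kappa> *s u \<longrightarrow> Re \<kappa> \<le> k))"

definition weighted_gain ::
    "('n::finite, 's::finite, 'l::finite) wpn \<Rightarrow> real \<Rightarrow> real ^ 's ^ 'n \<Rightarrow> real ^ 'n
      \<Rightarrow> complex ^ 'm::finite ^ 'n \<Rightarrow> complex ^ 'm \<Rightarrow> real"
  where "weighted_gain N \<alpha> U B h w =
    CC N \<alpha> * (\<Sum>n\<in>UNIV. bf_gain w (h $ n) * ZZ N \<alpha> U B n)"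

text \<open>
  Ties in the arg max, the arg min and the choice of the principal eigenvector may be broken
  arbitrarily, hence a relation instead of a function.
\<close>

definition eecw_action ::
    "('n, 's, 'l) wpn \<Rightarrow> real \<Rightarrow> real \<Rightarrow> real ^ 's ^ 'n \<Rightarrow> real ^ 'n
      \<Rightarrow> complex ^ 'l \<Rightarrow> complex ^ 'm ^ 'n
      \<Rightarrow> ('n::finite, 's::finite, 'l::finite, 'm::finite) action \<Rightarrow> bool"
  where "eecw_action N \<alpha> V U B g h a \<longleftrightarrow>
    (\<exists>sel. \<forall>l. is_arg_max (link_weight N \<alpha> U B l) (\<lambda>_. True) (sel l) \<and>
       (\<forall>s. rate a $ l $ s = (if s = sel l then rate_fun N l (pow a) g else 0))) \<and>
    is_arg_min (data_cost N \<alpha> U B g) (\<lambda>p. p \<in> powers N) (pow a) \<and>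
    (\<exists>v. principal_eigenvector (energy_matrix N \<alpha> U B h) v \<and> norm v = 1 \<and>
       bf a = (\<chi> i. cnj (v $ i))) \<and>
    P_AP a = (if V < weighted_gain N \<alpha> U B h (bf a) then P_AP_max N else 0) \<and>
    (tau_e a, tau_d a) =
      (if P_AP a * (V - weighted_gain N \<alpha> U B h (bf a)) \<le> data_cost N \<alpha> U B g (pow a)
       then (tau_f N, 0) else (0, tau_f N)) \<and>
    (\<forall>n. stored a $ n = min (E_rx h a n) ((ZZ N \<alpha> U B n - mu_max N) / CC N \<alpha>))"

text \<open>
  The decisions of slot \<open>t\<close> are causal: the information available before slot \<open>t\<close> is a
  sigma-algebra \<open>F t\<close> that is independent of the slot-\<open>t\<close> channels and arrivals, and the action of
  slot \<open>t\<close> depends only on \<open>F (Suc t)\<close>. This only restricts how ties are broken.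
\<close>

definition causal ::
    "'w measure \<Rightarrow> (nat \<Rightarrow> 'w \<Rightarrow> complex ^ 'l) \<Rightarrow> (nat \<Rightarrow> 'w \<Rightarrow> complex ^ 'm ^ 'n)
      \<Rightarrow> (nat \<Rightarrow> 'w \<Rightarrow> real ^ 's ^ 'n)
      \<Rightarrow> (nat \<Rightarrow> 'w \<Rightarrow> ('n::finite, 's::finite, 'l::finite, 'm::finite) action) \<Rightarrow> bool"
  where "causal M G H A act \<longleftrightarrow> (\<exists>F :: nat \<Rightarrow> 'w measure.
    filtration (space M) F \<and>
    (\<forall>t. subalgebra M (F t) \<and>
       (\<lambda>\<omega>. (G t \<omega>, H t \<omega>, A t \<omega>)) \<in> borel_measurable (F (Suc t)) \<and>
       prob_space.indep_set M (sets (F t))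
         (sets (vimage_algebra (space M) (\<lambda>\<omega>. (G t \<omega>, H t \<omega>, A t \<omega>)) borel)) \<and>
       action_measurable (F (Suc t)) (act t)))"

text \<open>
  At pairs in \<open>sinks\<close> only the initial dummy data are kept. That the stored energy is nonnegative
  and the battery covers its consumption are consequences of the policy, not part of its definition.
\<close>

definition eecw_run ::
    "('n, 's, 'l) wpn \<Rightarrow> 'w measure \<Rightarrow> (nat \<Rightarrow> 'w \<Rightarrow> complex ^ 'l) \<Rightarrow> (nat \<Rightarrow> 'w \<Rightarrow> complex ^ 'm ^ 'n)
      \<Rightarrow> (nat \<Rightarrow> 'w \<Rightarrow> real ^ 's ^ 'n) \<Rightarrow> real \<Rightarrow> real
      \<Rightarrow> (nat \<Rightarrow> 'w \<Rightarrow> ('n::finite, 's::finite, 'l::finite, 'm::finite) action)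
      \<Rightarrow> (nat \<Rightarrow> 'w \<Rightarrow> real ^ 's ^ 'n) \<Rightarrow> (nat \<Rightarrow> 'w \<Rightarrow> real ^ 'n) \<Rightarrow> bool"
  where "eecw_run N M G H A \<alpha> V act U B \<longleftrightarrow>
    causal M G H A act \<and>
    (\<forall>\<omega>\<in>space M.
       (\<forall>n s. U 0 \<omega> $ n $ s = U_init N \<alpha>) \<and>
       (\<forall>n. B 0 \<omega> $ n = 0) \<and>
       (\<forall>t. eecw_action N \<alpha> V (U t \<omega>) (B t \<omega>) (G t \<omega>) (H t \<omega>) (act t \<omega>)) \<and>
       (\<forall>t n s. U (Suc t) \<omega> $ n $ s =
          (if (n, s) \<in> sinks N then U t \<omega> $ n $ s
           else max (U t \<omega> $ n $ s - mu_out N (act t \<omega>) n s) 0 + mu_in N (A t \<omega>) (act t \<omega>) n s)) \<and>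
       (\<forall>t n. B (Suc t) \<omega> $ n =
          B t \<omega> $ n - phi_out N (act t \<omega>) n + stored (act t \<omega>) $ n))"


section \<open>The attraction point\<close>

text \<open>At pairs in \<open>sinks\<close>, which have no multiplier, \<open>nu_star\<close> is the constant dummy backlog.\<close>

definition nu_star ::
    "('n::finite, 's::finite, 'l::finite) wpn \<Rightarrow> real \<Rightarrow> (real ^ 's ^ 'n) \<times> (real ^ 'n) \<Rightarrow> 'n \<Rightarrow> 's \<Rightarrow> real"
  where "nu_star N \<alpha> y n s =
    (if (n, s) \<in> sinks N then U_init N \<alpha> else fst y $ n $ s - snd y $ n / CC N \<alpha>)"

definition zeta_star ::
    "('n::finite, 's::finite, 'l::finite) wpn \<Rightarrow> real \<Rightarrow> (real ^ 's ^ 'n) \<times> (real ^ 'n) \<Rightarrow> 'n \<Rightarrow> real"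
  where "zeta_star N \<alpha> y n = snd y $ n / CC N \<alpha>"

definition eps_star ::
    "('n::finite, 's::finite, 'l::finite) wpn \<Rightarrow> real \<Rightarrow> (real ^ 's ^ 'n) \<times> (real ^ 'n) \<Rightarrow> 'n \<Rightarrow> real"
  where "eps_star N \<alpha> y n = ((\<Sum>s\<in>UNIV. nu_star N \<alpha> y n s) - zeta_star N \<alpha> y n) / CC N \<alpha>"

end

theory Submission
  imports Defs
begin

text \<open>
  Take the backlogs \<open>U\<close> and the quantities \<open>Z\<close> as coordinates. The prices \<open>(Z + U, C Z)\<close> are dual
  variables, and the squared Euclidean distance of \<open>(U, Z)\<close> to the point \<open>(\<nu>, \<zeta>)\<close> given by the
  dual maximizer changes in one slot, up to a constant, by twice the difference of the Lagrangian
  costs of the chosen action at the current prices and at the maximizer. Up to a constant, the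
  policy minimizes the first cost pointwise, whereas the second is at least its minimum, so the
  conditional expectation of this difference is at most the difference of the values of the dual
  function. By the polyhedral growth of the dual function the distance therefore has a uniformly negative
  drift far from \<open>(\<nu>, \<zeta>)\<close>. Its increments are bounded, so a small exponential moment contracts
  up to a constant, and Markov's inequality yields the exponential tail. No constant involves \<open>V\<close>,
  which enters only through the initial distance and disappears in the limit.
\<close>

section \<open>Beamforming gains and the principal eigenvector\<close>

text \<open>Why \<open>(U, Z)\<close>: in the inner product of the displacement from
  \<open>(\<nu>, \<zeta>)\<close> with its increment, a backlog change has coefficient
  \<open>Z + U - \<nu> - \<zeta>\<close> and a battery drain has \<open>C Z - C \<zeta>\<close>.
  Since \<open>\<nu> + \<zeta> = \<eta>\<close> and \<open>C \<zeta> = \<beta>\<close>, these are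
  the differences between the current prices and the maximizer.

  Two effects spoil the exact minimization, each multiplied by a price that is unbounded over the
  state space. The truncation at an empty queue adds to the backlog at price \<open>Z + U\<close>;
  but a link in use forces \<open>C Z \<le> \<delta> (Z + U)\<close> at its transmitter, and
  \<open>C \<ge> 2 \<delta>\<close> then keeps this price small whenever truncation occurs. The
  storage rule gives up energy at price \<open>C Z\<close>, but only while \<open>Z\<close> is
  small. Both losses are therefore constants free of \<open>V\<close>.

  No conditional expectation is formed. The state is independent of the slot's channels and
  arrivals, so weights depending on the state are integrated by Fubini. This requires the minimal
  cost to be jointly measurable in prices and channels, which is why it is taken over a countable
  family of actions.\<close>

lemma sum_fibres:
  fixes f :: "'n::finite \<Rightarrow> 'l::finite \<Rightarrow> real"
  shows "(\<Sum>n\<in>UNIV. \<Sum>l\<in>{l. h l = n}. f n l) = (\<Sum>l\<in>UNIV. f (h l) l)"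
proof -
  have "(\<Sum>n\<in>UNIV. \<Sum>l\<in>{l. h l = n}. f n l) = (\<Sum>n\<in>UNIV. \<Sum>l\<in>{l\<in>UNIV. h l = n}. f (h l) l)"
    by (intro sum.cong) auto
  also have "\<dots> = (\<Sum>l\<in>UNIV. f (h l) l)"
    by (rule sum.group) auto
  finally show ?thesis .
qed

lemma sq_norm_vec: "(norm (u :: complex ^ 'm::finite))\<^sup>2 = (\<Sum>i\<in>UNIV. (cmod (u $ i))\<^sup>2)"
  by (simp add: norm_vec_def L2_set_def real_sqrt_pow2 sum_nonneg)

lemma bf_gain_nonneg: "0 \<le> bf_gain w h"
  by (simp add: bf_gain_def)

text \<open>The Hermitian form of the matrix with entries \<open>\<Sum>n\<in>UNIV. \<beta> $ n * (h
  $ n $ i * cnj (h $ n $ j))\<close>, taken at the conjugate of \<open>w\<close>. As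
  \<open>bf_gain\<close> multiplies without conjugation, good beams are conjugates of
  eigenvectors.\<close>

definition energy_gain :: "real ^ 'n \<Rightarrow> complex ^ 'm ^ 'n \<Rightarrow> complex ^ 'm::finite \<Rightarrow> real"
  where "energy_gain \<beta> h w = (\<Sum>n\<in>UNIV. \<beta> $ n * bf_gain w (h $ n))"

lemma quadratic_nonneg_linear_zero:
  fixes a b :: real
  assumes "\<And>t. 0 \<le> t * a + t\<^sup>2 * b"
  shows "a = 0"
proof (rule ccontr)
  assume "a \<noteq> 0"
  \<comment> \<open>\<open>B\<close> is positive and exceeds \<open>b\<close>, so at
    \<open>t = - a / B\<close> the negative linear term outweighs the quadratic one.\<close>
  define B where "B = \<bar>b\<bar> + 1"
  have B: "B > 0" "b < B" by (auto simp: B_def)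
  have "0 \<le> (- a / B) * a + (- a / B)\<^sup>2 * b" by (rule assms)
  also have "\<dots> = (a\<^sup>2 / B\<^sup>2) * (b - B)" using B by (simp add: field_simps power2_eq_square)
  also have "\<dots> < 0" using B \<open>a \<noteq> 0\<close> by (intro mult_pos_neg) auto
  finally show False by simp
qed

lemma cmod_sq_line:
  "(cmod (a + of_real t * b))\<^sup>2 = (cmod a)\<^sup>2 + t * (2 * Re (cnj a * b)) + t\<^sup>2 * (cmod b)\<^sup>2"
  unfolding cmod_power2 by (simp add: power2_eq_square) algebra

text \<open>A real parameter suffices for the variational argument below, because the direction
  \<open>e\<close> is an arbitrary complex vector.\<close>

lemma bf_gain_line:
  fixes u e :: "complex ^ 'm::finite"
  shows "bf_gain (u + of_real t *s e) h =
    bf_gain u h + t * (2 * Re (cnj (\<Sum>i\<in>UNIV. u $ i * h $ i) * (\<Sum>i\<in>UNIV. e $ i * h $ i)))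
    + t\<^sup>2 * bf_gain e h"
proof -
  define a where "a = (\<Sum>i\<in>UNIV. u $ i * h $ i)"
  define b where "b = (\<Sum>i\<in>UNIV. e $ i * h $ i)"
  have "(\<Sum>i\<in>UNIV. (u + of_real t *s e) $ i * h $ i) = a + of_real t * b"
    by (simp add: a_def b_def algebra_simps sum.distrib sum_distrib_left)
  then show ?thesis
    unfolding bf_gain_def a_def[symmetric] b_def[symmetric] by (simp only: cmod_sq_line)
qed

lemma sq_norm_line:
  fixes u e :: "complex ^ 'm::finite"
  shows "(norm (u + of_real t *s e))\<^sup>2 = (norm u)\<^sup>2 + t * (2 * Re (\<Sum>i\<in>UNIV. cnj (u $ i) * e $ i))
    + t\<^sup>2 * (norm e)\<^sup>2"
  unfolding sq_norm_vec Re_sum sum_distrib_left sum.distrib[symmetric]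
  by (intro sum.cong refl) (simp only: cmod_sq_line vector_add_component vector_smult_component)

lemma bf_gain_scale: "bf_gain (of_real t *s u) h = t\<^sup>2 * bf_gain u (h :: complex ^ 'm::finite)"
  using bf_gain_line[of 0 t u h] by (simp add: bf_gain_def)

lemma energy_gain_scale: "energy_gain \<beta> h (of_real t *s u) = t\<^sup>2 * energy_gain \<beta> h u"
  by (simp add: energy_gain_def bf_gain_scale sum_distrib_left algebra_simps)

lemma bf_gain_continuous: "continuous_on S (\<lambda>w. bf_gain w h)"
  unfolding bf_gain_def by (intro continuous_intros)

lemma energy_gain_continuous: "continuous_on S (energy_gain \<beta> h)"
  unfolding energy_gain_def by (intro continuous_intros bf_gain_continuous)

lemma norm_scale: "norm (of_real t *s (u :: complex ^ 'm::finite)) = \<bar>t\<bar> * norm u"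
proof -
  have "(norm (of_real t *s u))\<^sup>2 = (\<bar>t\<bar> * norm u)\<^sup>2"
    unfolding power_mult_distrib sq_norm_vec by (simp add: norm_mult power_mult_distrib sum_distrib_left)
  then show ?thesis by (simp add: power2_eq_iff_nonneg)
qed

text \<open>A maximizer of the form on the unit sphere is a critical point of the Rayleigh quotient, hence
  an eigenvector; this bounds the form by the largest eigenvalue.\<close>

lemma energy_gain_max_eigenvector:
  fixes h :: "complex ^ 'm::finite ^ 'n::finite"
  obtains x :: "complex ^ 'm" and k :: real where "x \<noteq> 0"
    "(\<chi> i j. \<Sum>n\<in>UNIV. of_real (\<beta> $ n) * (h $ n $ i * cnj (h $ n $ j))) *v x = of_real k *s x"
    "\<And>u. norm u = 1 \<Longrightarrow> energy_gain \<beta> h u \<le> k"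
proof -
  let ?S = "sphere (0 :: complex ^ 'm) 1"
  let ?Q = "(\<chi> i j. \<Sum>n\<in>UNIV. of_real (\<beta> $ n) * (h $ n $ i * cnj (h $ n $ j))) :: complex ^ 'm ^ 'm"
  have ne: "?S \<noteq> {}" by simp
  obtain u0 where u0: "norm u0 = 1" "\<And>u. norm u = 1 \<Longrightarrow> energy_gain \<beta> h u \<le> energy_gain \<beta> h u0"
    using continuous_attains_sup[OF compact_sphere ne energy_gain_continuous[of _ \<beta> h]] by auto
  define k where "k = energy_gain \<beta> h u0"
  \<comment> \<open>The form is homogeneous of degree two, so its maximum \<open>k\<close> on the
    sphere yields an inequality on the whole space, where a perturbation need not be
    normalized.\<close>
  have pos: "0 \<le> k * (norm u)\<^sup>2 - energy_gain \<beta> h u" for u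
  proof (cases "u = 0")
    case True
    then show ?thesis by (simp add: energy_gain_def bf_gain_def)
  next
    case False
    define w where "w = of_real (1 / norm u) *s u"
    have "norm w = 1" unfolding w_def norm_scale using False by simp
    then have "energy_gain \<beta> h w \<le> k" using u0 k_def by auto
    then show ?thesis unfolding w_def energy_gain_scale using False
      by (simp add: field_simps)
  qed
  define x where "x = (\<chi> i. cnj (u0 $ i))"
  define r where "r = of_real k *s x - ?Q *v x"
  \<comment> \<open>Perturbing \<open>u0\<close> along the conjugate of the residual
    \<open>r\<close> of the eigenvalue equation makes the linear coefficient twice the squared norm
    of \<open>r\<close>, which must therefore vanish.\<close>
  define e where "e = (\<chi> i. cnj (r $ i))"
  define c where "c n = (\<Sum>i\<in>UNIV. u0 $ i * h $ n $ i)" for n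
  define d where "d n = (\<Sum>i\<in>UNIV. e $ i * h $ n $ i)" for n
  define lin where "lin = 2 * (k * Re (\<Sum>i\<in>UNIV. cnj (u0 $ i) * e $ i)) - (\<Sum>n\<in>UNIV. \<beta> $ n * (2 * Re (cnj (c n) * d n)))"
  have "0 \<le> t * lin + t\<^sup>2 * (k * (norm e)\<^sup>2 - energy_gain \<beta> h e)" for t
  proof -
    have "0 \<le> k * (norm (u0 + of_real t *s e))\<^sup>2 - energy_gain \<beta> h (u0 + of_real t *s e)"
      by (rule pos)
    also have "energy_gain \<beta> h (u0 + of_real t *s e) =
       energy_gain \<beta> h u0 + t * (\<Sum>n\<in>UNIV. \<beta> $ n * (2 * Re (cnj (c n) * d n))) + t\<^sup>2 * energy_gain \<beta> h e"
      unfolding energy_gain_def bf_gain_line c_def[symmetric] d_def[symmetric]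
      unfolding sum_distrib_left sum.distrib[symmetric] by (intro sum.cong refl) (simp add: algebra_simps)
    also have "k * (norm (u0 + of_real t *s e))\<^sup>2 - \<dots> = t * lin + t\<^sup>2 * (k * (norm e)\<^sup>2 - energy_gain \<beta> h e)"
      unfolding sq_norm_line u0(1) lin_def k_def[symmetric] by (simp add: algebra_simps)
    finally show ?thesis .
  qed
  then have lin0: "lin = 0" by (rule quadratic_nonneg_linear_zero)
  have r: "r $ i = of_real k * cnj (u0 $ i) - (\<Sum>n\<in>UNIV. of_real (\<beta> $ n) * cnj (c n) * h $ n $ i)" for i
  proof -
    have "(?Q *v x) $ i = (\<Sum>j\<in>UNIV. \<Sum>n\<in>UNIV. of_real (\<beta> $ n) * (h $ n $ i * cnj (h $ n $ j)) * cnj (u0 $ j))"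
      by (simp add: matrix_vector_mult_def x_def sum_distrib_right)
    also have "\<dots> = (\<Sum>n\<in>UNIV. \<Sum>j\<in>UNIV. of_real (\<beta> $ n) * (h $ n $ i * cnj (h $ n $ j)) * cnj (u0 $ j))"
      by (rule sum.swap)
    also have "\<dots> = (\<Sum>n\<in>UNIV. of_real (\<beta> $ n) * cnj (c n) * h $ n $ i)"
      by (simp add: c_def sum_distrib_left sum_distrib_right algebra_simps)
    finally show ?thesis by (simp add: r_def x_def)
  qed
  have "lin = 2 * Re (\<Sum>i\<in>UNIV. r $ i * e $ i)"
  proof -
    have "(\<Sum>i\<in>UNIV. r $ i * e $ i) = of_real k * (\<Sum>i\<in>UNIV. cnj (u0 $ i) * e $ i)
       - (\<Sum>i\<in>UNIV. \<Sum>n\<in>UNIV. of_real (\<beta> $ n) * cnj (c n) * h $ n $ i * e $ i)"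
      unfolding r by (simp add: algebra_simps sum_subtractf sum_distrib_left)
    also have "(\<Sum>i\<in>UNIV. \<Sum>n\<in>UNIV. of_real (\<beta> $ n) * cnj (c n) * h $ n $ i * e $ i)
      = (\<Sum>n\<in>UNIV. \<Sum>i\<in>UNIV. of_real (\<beta> $ n) * cnj (c n) * h $ n $ i * e $ i)" by (rule sum.swap)
    also have "\<dots> = (\<Sum>n\<in>UNIV. of_real (\<beta> $ n) * (cnj (c n) * d n))"
      by (simp add: d_def sum_distrib_left algebra_simps)
    finally have "Re (\<Sum>i\<in>UNIV. r $ i * e $ i) = k * Re (\<Sum>i\<in>UNIV. cnj (u0 $ i) * e $ i)
       - (\<Sum>n\<in>UNIV. \<beta> $ n * Re (cnj (c n) * d n))"
      by simp
    then show ?thesis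
      unfolding lin_def by (simp add: sum_distrib_left mult.left_commute[of 2] right_diff_distrib del: times_complex.simps Re_sum)
  qed
  also have "(\<Sum>i\<in>UNIV. r $ i * e $ i) = of_real ((norm r)\<^sup>2)"
    unfolding sq_norm_vec of_real_sum complex_norm_square by (simp add: e_def)
  finally have "r = 0" using lin0 by simp
  then have "?Q *v x = of_real k *s x" by (simp add: r_def)
  moreover have "x \<noteq> 0"
  proof
    assume "x = 0"
    then have "\<forall>i. cnj (u0 $ i) = 0" by (simp add: x_def vec_eq_iff)
    then have "u0 = 0" by (simp add: vec_eq_iff)
    then show False using u0 by simp
  qed
  ultimately show ?thesis using that[of x k] u0(2) by (simp add: k_def)
qed

text \<open>The maximum of the form over the sphere is itself an eigenvalue, hence at most the
  largest one. The form at the conjugate of a unit eigenvector equals its eigenvalue, so this beam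
  attains the bound.\<close>

lemma principal_eigenvector_energy_gain:
  fixes h :: "complex ^ 'm::finite ^ 'n::finite"
  assumes "principal_eigenvector (\<chi> i j. \<Sum>n\<in>UNIV. of_real (\<beta> $ n) * (h $ n $ i * cnj (h $ n $ j))) v"
    and v1: "norm v = 1" and u: "norm u = 1"
  shows "energy_gain \<beta> h u \<le> energy_gain \<beta> h (\<chi> i. cnj (v $ i))"
proof -
  let ?Q = "(\<chi> i j. \<Sum>n\<in>UNIV. of_real (\<beta> $ n) * (h $ n $ i * cnj (h $ n $ j))) :: complex ^ 'm ^ 'm"
  obtain k where k: "?Q *v v = of_real k *s v"
    and top: "\<And>\<kappa> u. u \<noteq> 0 \<Longrightarrow> ?Q *v u = \<kappa> *s u \<Longrightarrow> Re \<kappa> \<le> k"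
    using assms(1) unfolding principal_eigenvector_def by blast
  obtain x k' where x: "x \<noteq> 0" "?Q *v x = of_real k' *s x"
    and le: "\<And>u. norm u = 1 \<Longrightarrow> energy_gain \<beta> h u \<le> k'"
    using energy_gain_max_eigenvector[of \<beta> h] by blast
  have "energy_gain \<beta> h u \<le> k'" using le u by blast
  also have "k' \<le> k" using top[OF x] by simp
  also have "k = energy_gain \<beta> h (\<chi> i. cnj (v $ i))"
  proof -
    define c where "c n = (\<Sum>i\<in>UNIV. cnj (v $ i) * h $ n $ i)" for n
    have cc: "cnj (c n) = (\<Sum>i\<in>UNIV. v $ i * cnj (h $ n $ i))" for n by (simp add: c_def)
    have "of_real k = (\<Sum>i\<in>UNIV. cnj (v $ i) * (of_real k *s v) $ i)"
    proof -
      have "(\<Sum>i\<in>UNIV. cnj (v $ i) * (of_real k *s v) $ i) = of_real k * of_real ((norm v)\<^sup>2)"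
        unfolding sq_norm_vec of_real_sum complex_norm_square sum_distrib_left
        by (intro sum.cong refl) simp
      then show ?thesis using v1 by simp
    qed
    also have "\<dots> = (\<Sum>i\<in>UNIV. cnj (v $ i) * (?Q *v v) $ i)" by (simp add: k)
    also have "\<dots> = (\<Sum>i\<in>UNIV. \<Sum>j\<in>UNIV. \<Sum>n\<in>UNIV. cnj (v $ i) * (of_real (\<beta> $ n) * (h $ n $ i * cnj (h $ n $ j))) * v $ j)"
      by (simp add: matrix_vector_mult_def sum_distrib_left sum_distrib_right algebra_simps)
    also have "\<dots> = (\<Sum>i\<in>UNIV. \<Sum>n\<in>UNIV. \<Sum>j\<in>UNIV. cnj (v $ i) * (of_real (\<beta> $ n) * (h $ n $ i * cnj (h $ n $ j))) * v $ j)"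
      by (intro sum.cong refl sum.swap)
    also have "\<dots> = (\<Sum>n\<in>UNIV. \<Sum>i\<in>UNIV. \<Sum>j\<in>UNIV. cnj (v $ i) * (of_real (\<beta> $ n) * (h $ n $ i * cnj (h $ n $ j))) * v $ j)"
      by (rule sum.swap)
    also have "\<dots> = (\<Sum>n\<in>UNIV. of_real (\<beta> $ n) * (c n * cnj (c n)))"
      unfolding cc unfolding c_def sum_product unfolding sum_distrib_left
      by (intro sum.cong refl) (simp add: algebra_simps)
    also have "\<dots> = of_real (energy_gain \<beta> h (\<chi> i. cnj (v $ i)))"
      by (simp add: energy_gain_def bf_gain_def c_def[symmetric] complex_norm_square del: of_real_power)
    finally show ?thesis unfolding of_real_eq_iff .
  qed
  finally show ?thesis .
qed

section \<open>The Lagrangian cost of an action\<close>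

text \<open>Arrivals are set to 0: the action does not influence them, so they enter the dual
  function and the drift as a separate term.\<close>

definition cost ::
    "('n, 's, 'l) wpn \<Rightarrow> real \<Rightarrow> (real ^ 's ^ 'n) \<times> (real ^ 'n)
      \<Rightarrow> ('n::finite, 's::finite, 'l::finite, 'm::finite) action \<Rightarrow> real"
  where "cost N V y a = V * E_AP a
    + (\<Sum>n\<in>UNIV. \<Sum>s\<in>UNIV. fst y $ n $ s * (mu_in N 0 a n s - mu_out N a n s))
    + (\<Sum>n\<in>UNIV. snd y $ n * (phi_out N a n - stored a $ n))"

definition stream_weight :: "('n, 's, 'l) wpn \<Rightarrow> real ^ 's::finite ^ 'n::finite \<Rightarrow> 'l::finite \<Rightarrow> 's \<Rightarrow> real"
  where "stream_weight N \<eta> l s = \<eta> $ head N l $ s - \<eta> $ tail N l $ s"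

definition top_weight :: "('n, 's, 'l) wpn \<Rightarrow> real ^ 's::finite ^ 'n::finite \<Rightarrow> 'l::finite \<Rightarrow> real"
  where "top_weight N \<eta> l = max (Max (range (stream_weight N \<eta> l))) 0"

text \<open>Smallest data cost per unit of transmission time at power \<open>p\<close>: each link
  gives its whole rate to a stream of largest weight, or to none if no weight is positive. It is
  \<open>data_cost\<close> for general multipliers.\<close>

definition data_term ::
    "('n, 's, 'l) wpn \<Rightarrow> (real ^ 's::finite ^ 'n::finite) \<times> (real ^ 'n) \<Rightarrow> complex ^ 'l::finite \<Rightarrow> real ^ 'l \<Rightarrow> real"
  where "data_term N y g p =
    (\<Sum>l\<in>UNIV. snd y $ head N l * p $ l - top_weight N (fst y) l * rate_fun N l p g)"

lemma mu_in_split: "mu_in N A a n s = mu_in N 0 a n s + A $ n $ s"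
  by (simp add: mu_in_def)

lemma stream_weight_le_top: "stream_weight N \<eta> l s \<le> top_weight N \<eta> l"
  unfolding top_weight_def by (intro max.coboundedI1 Max_ge) auto

lemma top_weight_nonneg: "0 \<le> top_weight N \<eta> l"
  by (simp add: top_weight_def)

text \<open>Every link leaves one node and enters one node, so the sum over nodes regroups into link
  terms carrying the difference of the multipliers at the two ends.\<close>

lemma sum_flow:
  "(\<Sum>n\<in>UNIV. \<Sum>s\<in>UNIV. \<eta> $ n $ s * (mu_in N 0 a n s - mu_out N a n s))
    = - tau_d a * (\<Sum>l\<in>UNIV. \<Sum>s\<in>UNIV. rate a $ l $ s * stream_weight N \<eta> l s)"
proof -
  have "(\<Sum>n\<in>UNIV. \<eta> $ n $ s * (mu_in N 0 a n s - mu_out N a n s))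
    = - tau_d a * (\<Sum>l\<in>UNIV. rate a $ l $ s * stream_weight N \<eta> l s)" for s
  proof -
    have "(\<Sum>n\<in>UNIV. \<eta> $ n $ s * (mu_in N 0 a n s - mu_out N a n s))
      = tau_d a * ((\<Sum>n\<in>UNIV. \<Sum>l\<in>{l. tail N l = n}. \<eta> $ n $ s * rate a $ l $ s)
        - (\<Sum>n\<in>UNIV. \<Sum>l\<in>{l. head N l = n}. \<eta> $ n $ s * rate a $ l $ s))"
      unfolding sum_subtractf[symmetric] sum_distrib_left
      by (intro sum.cong refl)
        (simp add: mu_in_def mu_out_def in_links_def out_links_def sum_distrib_left right_diff_distrib algebra_simps)
    also have "\<dots> = - tau_d a * (\<Sum>l\<in>UNIV. rate a $ l $ s * stream_weight N \<eta> l s)"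
      unfolding sum_fibres sum_subtractf[symmetric] stream_weight_def
      by (simp add: algebra_simps sum_subtractf)
    finally show ?thesis .
  qed
  moreover have "(\<Sum>n\<in>UNIV. \<Sum>s\<in>UNIV. \<eta> $ n $ s * (mu_in N 0 a n s - mu_out N a n s))
    = (\<Sum>s\<in>UNIV. \<Sum>n\<in>UNIV. \<eta> $ n $ s * (mu_in N 0 a n s - mu_out N a n s))"
    by (rule sum.swap)
  moreover have "(\<Sum>l\<in>UNIV. \<Sum>s\<in>UNIV. rate a $ l $ s * stream_weight N \<eta> l s)
    = (\<Sum>s\<in>UNIV. \<Sum>l\<in>UNIV. rate a $ l $ s * stream_weight N \<eta> l s)"
    by (rule sum.swap)
  ultimately show ?thesis by (simp add: sum_distrib_left)
qed

lemma sum_phi_out: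
  "(\<Sum>n\<in>UNIV. \<beta> $ n * phi_out N a n) = tau_d a * (\<Sum>l\<in>UNIV. \<beta> $ head N l * pow a $ l)"
proof -
  have "(\<Sum>n\<in>UNIV. \<beta> $ n * phi_out N a n) = (\<Sum>n\<in>UNIV. \<Sum>l\<in>{l. head N l = n}. tau_d a * (\<beta> $ n * pow a $ l))"
    by (simp add: phi_out_def out_links_def sum_distrib_left algebra_simps)
  then show ?thesis unfolding sum_fibres by (simp add: sum_distrib_left)
qed

lemma cost_eq:
  "cost N V y a = V * E_AP a - (\<Sum>n\<in>UNIV. snd y $ n * stored a $ n)
    + tau_d a * (\<Sum>l\<in>UNIV. snd y $ head N l * pow a $ l
        - (\<Sum>s\<in>UNIV. rate a $ l $ s * stream_weight N (fst y) l s))"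
  unfolding cost_def sum_flow
  by (simp add: right_diff_distrib sum_subtractf sum_phi_out)

lemma sum_E_rx: "(\<Sum>n\<in>UNIV. \<beta> $ n * E_rx h a n) = E_AP a * energy_gain \<beta> h (bf a)"
  by (simp add: E_rx_def energy_gain_def sum_distrib_left algebra_simps)

text \<open>Nonnegative \<beta> make it best to store everything received, and giving a rate to the
  stream of top weight is best on each link. What remains is affine in the time split, which is why
  an all-or-nothing split is optimal.\<close>

lemma cost_ge:
  assumes "\<And>n. 0 \<le> snd y $ n" "\<And>n. stored a $ n \<le> E_rx h a n" "0 \<le> tau_d a"
    and "\<And>l s. 0 \<le> rate a $ l $ s" "\<And>l. (\<Sum>s\<in>UNIV. rate a $ l $ s) \<le> rate_fun N l (pow a) g"
  shows "tau_e a * (P_AP a * (V - energy_gain (snd y) h (bf a))) + tau_d a * data_term N y g (pow a)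
    \<le> cost N V y a"
proof -
  have "(\<Sum>n\<in>UNIV. snd y $ n * stored a $ n) \<le> (\<Sum>n\<in>UNIV. snd y $ n * E_rx h a n)"
    using assms by (intro sum_mono mult_left_mono) auto
  also have "\<dots> = E_AP a * energy_gain (snd y) h (bf a)" by (rule sum_E_rx)
  finally have 1: "tau_e a * (P_AP a * (V - energy_gain (snd y) h (bf a)))
      \<le> V * E_AP a - (\<Sum>n\<in>UNIV. snd y $ n * stored a $ n)"
    by (simp add: E_AP_def algebra_simps)
  have "(\<Sum>s\<in>UNIV. rate a $ l $ s * stream_weight N (fst y) l s)
      \<le> top_weight N (fst y) l * rate_fun N l (pow a) g" for l
  proof -
    have "(\<Sum>s\<in>UNIV. rate a $ l $ s * stream_weight N (fst y) l s)
      \<le> (\<Sum>s\<in>UNIV. rate a $ l $ s * top_weight N (fst y) l)"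
      using assms by (intro sum_mono mult_left_mono stream_weight_le_top) auto
    also have "\<dots> = top_weight N (fst y) l * (\<Sum>s\<in>UNIV. rate a $ l $ s)"
      by (simp add: sum_distrib_left mult.commute)
    also have "\<dots> \<le> top_weight N (fst y) l * rate_fun N l (pow a) g"
      using assms by (intro mult_left_mono top_weight_nonneg) auto
    finally show ?thesis .
  qed
  then have "data_term N y g (pow a) \<le> (\<Sum>l\<in>UNIV. snd y $ head N l * pow a $ l
        - (\<Sum>s\<in>UNIV. rate a $ l $ s * stream_weight N (fst y) l s))"
    unfolding data_term_def by (intro sum_mono diff_left_mono)
  with 1 show ?thesis unfolding cost_eq
    using mult_left_mono[OF _ assms(3)] by (simp add: add_mono)
qed

section \<open>Simple actions that nearly attain the minimal cost\<close>

type_synonym ('s, 'l, 'm) simple_index = "(real ^ 'l) \<times> (complex ^ 'm) \<times> bool \<times> bool \<times> ('l \<Rightarrow> 's option)"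

text \<open>The flag \<open>e\<close> switches the E-AP to full power, \<open>d\<close> gives the
  whole slot to data, and \<open>sel\<close> names the stream served on each link, with
  \<open>None\<close> for an idle link whose weights are all nonpositive. All received energy is
  stored.\<close>

definition simple_action ::
    "('n, 's, 'l) wpn \<Rightarrow> ('s, 'l, 'm) simple_index
      \<Rightarrow> (complex ^ 'l) \<times> (complex ^ 'm ^ 'n) \<Rightarrow> ('n::finite, 's::finite, 'l::finite, 'm::finite) action"
  where "simple_action N i x = (case i of (p, w, e, d, sel) \<Rightarrow>
    \<lparr>pow = p, bf = w,
      rate = (\<chi> l s. if sel l = Some s then rate_fun N l p (fst x) else 0),
      P_AP = (if e then P_AP_max N else 0),
      tau_e = (if d then 0 else tau_f N), tau_d = (if d then tau_f N else 0),
      stored = (\<chi> n. bf_gain w (snd x $ n) * ((if d then 0 else tau_f N) * (if e then P_AP_max N else 0)))\<rparr>)"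

lemma simple_action_feasible:
  assumes "wpn_network N" "p \<in> powers N" "norm w = 1"
  shows "feasible N g h (simple_action N (p, w, e, d, sel) (g, h))"
proof -
  have R: "0 \<le> rate_fun N l p g" for l using assms by (auto simp: wpn_network_def)
  have "(\<Sum>s\<in>UNIV. if sel l = Some s then rate_fun N l p g else 0) \<le> rate_fun N l p g" for l
    using R by (cases "sel l") (auto simp: eq_commute[of _ "_::'b"])
  with R assms show ?thesis
    by (auto simp: feasible_def simple_action_def E_rx_def E_AP_def wpn_network_def bf_gain_nonneg cong: if_cong)
qed

text \<open>The weights depend on the multipliers alone, so one selection of streams is optimal for
  all powers and channels at once.\<close>

lemma cost_simple_data:
  assumes "wpn_network N"
  obtains sel where "\<And>p w e g h. cost N V y (simple_action N (p, w, e, True, sel) (g, h)) = tau_f N * data_term N y g p"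
proof -
  have "\<exists>o'. top_weight N (fst y) l = (case o' of None \<Rightarrow> 0 | Some s \<Rightarrow> stream_weight N (fst y) l s)" for l
  proof (cases "Max (range (stream_weight N (fst y) l)) \<le> 0")
    case True
    then show ?thesis by (intro exI[of _ None]) (simp add: top_weight_def)
  next
    case False
    have "Max (range (stream_weight N (fst y) l)) \<in> range (stream_weight N (fst y) l)"
      by (intro Max_in) auto
    then obtain s where "Max (range (stream_weight N (fst y) l)) = stream_weight N (fst y) l s" by (rule rangeE)
    then show ?thesis using False by (intro exI[of _ "Some s"]) (simp add: top_weight_def)
  qed
  then obtain sel where sel: "\<And>l. top_weight N (fst y) l = (case sel l of None \<Rightarrow> 0 | Some s \<Rightarrow> stream_weight N (fst y) l s)"
    by metis
  have "(\<Sum>s\<in>UNIV. (if sel l = Some s then rate_fun N l p g else 0) * stream_weight N (fst y) l s)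
      = top_weight N (fst y) l * rate_fun N l p g" for l p g
    by (cases "sel l") (auto simp: sel eq_commute[of _ "_::'b"] if_distrib[of "\<lambda>x. x * _"] cong: if_cong)
  then have "cost N V y (simple_action N (p, w, e, True, sel) (g, h)) = tau_f N * data_term N y g p" for p w e g h
    unfolding cost_eq data_term_def by (simp add: simple_action_def E_AP_def)
  with that show ?thesis by blast
qed

lemma cost_simple_energy:
  "cost N V y (simple_action N (p, w, e, False, sel) (g, h))
    = tau_f N * ((if e then P_AP_max N else 0) * (V - energy_gain (snd y) h w))"
  unfolding cost_eq by (auto simp: simple_action_def E_AP_def energy_gain_def sum_distrib_left algebra_simps)

text \<open>A countable dense set of beams keeps the optimization over actions measurable.\<close>

definition beams :: "(complex ^ 'm::finite) set"
  where "beams = (SOME D. countable D \<and> D \<subseteq> sphere 0 1 \<and> sphere 0 1 \<subseteq> closure D)"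

lemma beams: "countable (beams :: (complex ^ 'm::finite) set)"
    "(beams :: (complex ^ 'm) set) \<subseteq> sphere 0 1" "sphere 0 1 \<subseteq> closure (beams :: (complex ^ 'm) set)"
proof -
  have "\<exists>D :: (complex ^ 'm) set. countable D \<and> D \<subseteq> sphere 0 1 \<and> sphere 0 1 \<subseteq> closure D"
    using separable[of "sphere (0 :: complex ^ 'm) 1"] by metis
  from someI_ex[OF this] show "countable (beams :: (complex ^ 'm) set)"
    "(beams :: (complex ^ 'm) set) \<subseteq> sphere 0 1" "sphere 0 1 \<subseteq> closure (beams :: (complex ^ 'm) set)"
    unfolding beams_def by auto
qed

definition simple_idx ::
    "('n, 's, 'l) wpn \<Rightarrow> ('s::finite, 'l::finite, 'm::finite) simple_index set"
  where "simple_idx N = powers N \<times> beams \<times> UNIV"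

lemma beams_nonempty: "(beams :: (complex ^ 'm::finite) set) \<noteq> {}"
proof
  assume *: "(beams :: (complex ^ 'm) set) = {}"
  have "sphere (0 :: complex ^ 'm) 1 \<noteq> {}" by simp
  moreover have "sphere 0 1 \<subseteq> closure (beams :: (complex ^ 'm) set)" by (rule beams(3))
  ultimately show False unfolding * by simp
qed

lemma simple_idx_countable: "wpn_network N \<Longrightarrow> countable (simple_idx N)"
  unfolding simple_idx_def using beams(1) by (intro countable_SIGMA) (auto simp: wpn_network_def countable_finite)

lemma simple_idx_nonempty: "wpn_network N \<Longrightarrow> simple_idx N \<noteq> {}"
  unfolding simple_idx_def using beams_nonempty by (auto simp: wpn_network_def)

lemma simple_idx_feasible:
  assumes "wpn_network N" "i \<in> simple_idx N"
  shows "feasible N (fst x) (snd x) (simple_action N i x)"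
proof -
  obtain p w e d sel where i: "i = (p, w, e, d, sel)" by (cases i)
  have "p \<in> powers N" "norm w = 1" using assms beams(2) by (auto simp: simple_idx_def i)
  then show ?thesis unfolding i using simple_action_feasible[OF assms(1), of p w "fst x" "snd x"] by simp
qed

text \<open>The lower bound of \<open>cost_ge\<close> is affine in the time split and in the E-AP
  power, hence minimal at extreme values, which simple actions attain exactly; only the beam is
  approximated. Feasibility is required with storage reset to 0, so that the lemma applies to the
  actions of the policy without first showing their stored energy nonnegative.\<close>

lemma cost_simple_approx:
  fixes a :: "('n::finite, 's::finite, 'l::finite, 'm::finite) action"
  assumes net: "wpn_network N" and \<beta>: "\<And>n. 0 \<le> snd y $ n"
    and feas: "feasible N g h (a\<lparr>stored := 0\<rparr>)" and st: "\<And>n. stored a $ n \<le> E_rx h a n"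
    and \<epsilon>: "0 < \<epsilon>"
  shows "\<exists>i\<in>simple_idx N. cost N V y (simple_action N i (g, h)) \<le> cost N V y a + \<epsilon>"
proof -
  have a: "pow a \<in> powers N" "\<And>l s. 0 \<le> rate a $ l $ s" "norm (bf a) = 1"
      "\<And>l. (\<Sum>s\<in>UNIV. rate a $ l $ s) \<le> rate_fun N l (pow a) g"
      "0 \<le> P_AP a" "P_AP a \<le> P_AP_max N" "0 \<le> tau_e a" "0 \<le> tau_d a" "tau_e a + tau_d a = tau_f N"
    using feas by (auto simp: feasible_def)
  define F where "F w = V - energy_gain (snd y) h w" for w :: "complex ^ 'm"
  define d where "d = data_term N y g (pow a)"
  \<comment> \<open>The best value over all E-AP powers for the beam \<open>w\<close>, per unit of
    energy time: off or full power, depending on the sign of \<open>F w\<close>.\<close>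
  define E where "E w = min 0 (P_AP_max N * F w)" for w :: "complex ^ 'm"
  have tf: "0 < tau_f N" using net by (auto simp: wpn_network_def)
  have "tau_e a * (P_AP a * F (bf a)) + tau_d a * d \<le> cost N V y a"
    unfolding F_def d_def using cost_ge[of y a h N g V] \<beta> st a by auto
  moreover have "E (bf a) \<le> P_AP a * F (bf a)"
  proof (cases "F (bf a) \<ge> 0")
    case True
    then have "0 \<le> P_AP a * F (bf a)" using a by simp
    then show ?thesis unfolding E_def by linarith
  next
    case False
    then have "P_AP_max N * F (bf a) \<le> P_AP a * F (bf a)" using a by (intro mult_right_mono_neg) auto
    then show ?thesis unfolding E_def by linarith
  qed
  ultimately have lb: "tau_e a * E (bf a) + tau_d a * d \<le> cost N V y a"
    using mult_left_mono[OF _ a(7)] by (smt (verit))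
  have mn: "tau_f N * min (E (bf a)) d \<le> tau_e a * E (bf a) + tau_d a * d"
  proof -
    have "tau_f N * min (E (bf a)) d = tau_e a * min (E (bf a)) d + tau_d a * min (E (bf a)) d"
      using a(9) by (metis distrib_right)
    also have "\<dots> \<le> tau_e a * E (bf a) + tau_d a * d"
      using a by (intro add_mono mult_left_mono) auto
    finally show ?thesis .
  qed
  show ?thesis
  proof (cases "d \<le> E (bf a)")
    case True
    obtain w where w: "w \<in> (beams :: (complex ^ 'm) set)" using beams_nonempty by blast
    obtain sel where "\<And>p (w :: complex ^ 'm) e g h. cost N V y (simple_action N (p, w, e, True, sel) (g, h)) = tau_f N * data_term N y g p"
      by (rule cost_simple_data[OF net, of V y]) blast
    then have "cost N V y (simple_action N (pow a, w, True, True, sel) (g, h)) = tau_f N * d"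
      by (simp add: d_def)
    then have "cost N V y (simple_action N (pow a, w, True, True, sel) (g, h)) \<le> cost N V y a + \<epsilon>"
      using lb mn True \<epsilon> by (simp add: min_def split: if_splits)
    moreover have "(pow a, w, True, True, sel) \<in> simple_idx N" using w a by (auto simp: simple_idx_def)
    ultimately show ?thesis by blast
  next
    case False
    have cont: "continuous_on UNIV E" unfolding E_def F_def
      by (intro continuous_intros energy_gain_continuous)
    have "bf a \<in> closure beams" using beams(3) a(3) by auto
    \<comment> \<open>The tolerance is divided by \<open>tau_f N\<close> because the whole slot goes
      to the energy phase.\<close>
    moreover have "open {w. E w < E (bf a) + \<epsilon> / tau_f N}"
      by (intro open_Collect_less cont continuous_intros)
    moreover have "bf a \<in> {w. E w < E (bf a) + \<epsilon> / tau_f N}" using tf \<epsilon> by simp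
    ultimately obtain w where w: "w \<in> beams" "E w < E (bf a) + \<epsilon> / tau_f N"
      unfolding closure_iff_nhds_not_empty by blast
    define e where "e \<longleftrightarrow> P_AP_max N * F w \<le> 0"
    have "cost N V y (simple_action N (pow a, w, e, False, (\<lambda>_. None)) (g, h)) = tau_f N * E w"
      unfolding cost_simple_energy E_def F_def[symmetric] e_def by auto
    also have "\<dots> \<le> tau_f N * (E (bf a) + \<epsilon> / tau_f N)" using w tf by (intro mult_left_mono) auto
    also have "\<dots> = tau_f N * E (bf a) + \<epsilon>" using tf by (simp add: field_simps)
    also have "\<dots> \<le> cost N V y a + \<epsilon>" using lb mn False by (simp add: min_def)
    finally have "cost N V y (simple_action N (pow a, w, e, False, (\<lambda>_. None)) (g, h)) \<le> cost N V y a + \<epsilon>" .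
    moreover have "(pow a, w, e, False, (\<lambda>_. None)) \<in> simple_idx N" using w a by (auto simp: simple_idx_def)
    ultimately show ?thesis by blast
  qed
qed

section \<open>The dual function as an expected per-slot optimum\<close>

lemma borel_measurable_vec_nth:
  fixes f :: "'b \<Rightarrow> 'a::euclidean_space ^ 'n"
  assumes "f \<in> borel_measurable M"
  shows "(\<lambda>x. f x $ i) \<in> borel_measurable M"
  using assms by (rule borel_measurable_continuous_on[rotated]) (intro continuous_intros)

lemma borel_measurable_vecI:
  fixes f :: "'b \<Rightarrow> 'a::euclidean_space ^ 'n"
  assumes "\<And>i. (\<lambda>x. f x $ i) \<in> borel_measurable M"
  shows "f \<in> borel_measurable M"
proof (rule borel_measurable_euclidean_space[THEN iffD2], rule ballI)
  fix b :: "'a ^ 'n" assume "b \<in> Basis"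
  then obtain i c where "b = axis i c" by (auto simp: Basis_vec_def)
  then show "(\<lambda>x. f x \<bullet> b) \<in> borel_measurable M"
    using assms by (simp add: inner_axis)
qed

lemma borel_measurable_components:
  fixes f :: "'b \<Rightarrow> 'a::second_countable_topology \<times> 'c::second_countable_topology"
  assumes "f \<in> borel_measurable M"
  shows "(\<lambda>x. fst (f x)) \<in> borel_measurable M" "(\<lambda>x. snd (f x)) \<in> borel_measurable M"
  by (rule borel_measurable_continuous_on[OF _ assms], intro continuous_intros)+

lemma action_measurable_compose:
  assumes "action_measurable L f" and g: "g \<in> measurable M L"
  shows "action_measurable M (\<lambda>\<omega>. f (g \<omega>))"
  using assms(1) unfolding action_measurable_def
  by (elim conjE, intro conjI) (erule measurable_compose[OF g])+

lemma cost_measurable: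
  assumes "action_measurable M f" and "y \<in> borel_measurable M"
  shows "(\<lambda>\<omega>. cost N V (y \<omega>) (f \<omega>)) \<in> borel_measurable M"
  using assms unfolding action_measurable_def cost_def mu_in_def mu_out_def phi_out_def E_AP_def
  by (intro borel_measurable_add borel_measurable_diff borel_measurable_times borel_measurable_sum
      borel_measurable_vec_nth borel_measurable_components borel_measurable_const) auto

lemma simple_action_measurable:
  fixes x :: "'b \<Rightarrow> (complex ^ 'l::finite) \<times> (complex ^ 'm::finite ^ 'n::finite)"
  assumes net: "wpn_network N" and i: "i \<in> simple_idx N" and x: "x \<in> borel_measurable M"
  shows "action_measurable M (\<lambda>\<omega>. simple_action N i (x \<omega>) :: ('n, 's::finite, 'l, 'm) action)"
proof -
  obtain p w e d sel where i': "i = (p, w, e, d, sel)" by (cases i)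
  have p: "p \<in> powers N" using i by (auto simp: i' simple_idx_def)
  have R: "(\<lambda>\<omega>. rate_fun N l p (fst (x \<omega>))) \<in> borel_measurable M" for l
    by (rule measurable_compose[OF borel_measurable_components(1)[OF x]]) (use net p in \<open>auto simp: wpn_network_def\<close>)
  have g: "(\<lambda>\<omega>. bf_gain w (snd (x \<omega>) $ n)) \<in> borel_measurable M" for n
  proof (rule borel_measurable_continuous_on[where f = "bf_gain w"])
    show "continuous_on UNIV (bf_gain w)" unfolding bf_gain_def by (intro continuous_intros)
    show "(\<lambda>\<omega>. snd (x \<omega>) $ n) \<in> borel_measurable M"
      by (intro borel_measurable_vec_nth borel_measurable_components x)
  qed
  show ?thesis
    unfolding action_measurable_def i' simple_action_def
    using R g by (cases e; cases d; auto intro!: borel_measurable_vecI borel_measurable_times)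
qed

text \<open>The minimal Lagrangian cost of one slot. As a countable infimum it is measurable jointly
  in the multipliers and the channels, and the multipliers will later be the random prices of the
  current state.\<close>

definition opt_cost ::
    "('n, 's, 'l) wpn \<Rightarrow> real \<Rightarrow> (real ^ 's::finite ^ 'n::finite) \<times> (real ^ 'n)
      \<Rightarrow> (complex ^ 'l::finite) \<times> (complex ^ 'm::finite ^ 'n) \<Rightarrow> real"
  where "opt_cost N V y x = (INF i\<in>simple_idx N. cost N V y (simple_action N i x))"

lemma opt_cost_measurable:
  assumes "wpn_network N" "y \<in> borel_measurable M" "x \<in> borel_measurable M"
  shows "(\<lambda>\<omega>. opt_cost N V (y \<omega>) (x \<omega>)) \<in> borel_measurable M"
  unfolding opt_cost_def
  by (intro borel_measurable_cINF_real simple_idx_countable cost_measurable simple_action_measurable assms)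

section \<open>Bounds, integrability and the value of the dual function\<close>

locale slotted_network =
  fixes N :: "('n::finite, 's::finite, 'l::finite) wpn"
    and M :: "'w measure"
    and G :: "nat \<Rightarrow> 'w \<Rightarrow> complex ^ 'l"
    and H :: "nat \<Rightarrow> 'w \<Rightarrow> complex ^ 'm::finite ^ 'n"
    and A :: "nat \<Rightarrow> 'w \<Rightarrow> real ^ 's ^ 'n"
  assumes network: "wpn_network N"
    and slots: "slot_process N M G H A"
begin

sublocale prob_space M using slots by (simp add: slot_process_def)

lemma slot_rv: "(\<lambda>\<omega>. (G t \<omega>, H t \<omega>, A t \<omega>)) \<in> borel_measurable M"
  using slots by (auto simp: slot_process_def indep_vars_def)

lemma G_measurable: "G t \<in> borel_measurable M"
  and H_measurable: "H t \<in> borel_measurable M"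
  and A_measurable: "A t \<in> borel_measurable M"
  using borel_measurable_components[OF slot_rv, of t] borel_measurable_components[OF borel_measurable_components(2)[OF slot_rv, of t]]
  by (simp_all add: eta_contract_eq)

lemma GH_measurable: "(\<lambda>\<omega>. (G t \<omega>, H t \<omega>)) \<in> borel_measurable M"
  using G_measurable H_measurable by (intro borel_measurable_Pair)

lemma A_nonneg: "\<omega> \<in> space M \<Longrightarrow> 0 \<le> A t \<omega> $ n $ s"
  and A_le: "\<omega> \<in> space M \<Longrightarrow> A t \<omega> $ n $ s \<le> A_max N"
  and A_mean: "(\<integral>\<omega>. A t \<omega> $ n $ s \<partial>M) = lambda N n s"
  using slots by (auto simp: slot_process_def)

lemma feasible_bounds:
  assumes "\<omega> \<in> space M" "feasible N (G t \<omega>) (H t \<omega>) a"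
  shows "mu_in N (A t \<omega>) a n s \<le> mu_max N" "mu_out N a n s \<le> mu_max N"
    "phi_out N a n \<le> phi_max N" "E_rx (H t \<omega>) a n \<le> phi_max N"
    "0 \<le> mu_in N 0 a n s" "mu_in N 0 a n s \<le> mu_max N" "0 \<le> mu_out N a n s" "0 \<le> phi_out N a n"
    "stored a $ n \<le> phi_max N" "0 \<le> stored a $ n"
proof -
  show "mu_in N (A t \<omega>) a n s \<le> mu_max N" "mu_out N a n s \<le> mu_max N"
    "phi_out N a n \<le> phi_max N" and E: "E_rx (H t \<omega>) a n \<le> phi_max N"
    using slots assms unfolding slot_process_def by blast+
  then show "mu_in N 0 a n s \<le> mu_max N"
    using A_nonneg[OF assms(1), of t n s] by (simp add: mu_in_split[of N "A t \<omega>"])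
  show "0 \<le> mu_in N 0 a n s" "0 \<le> mu_out N a n s" "0 \<le> phi_out N a n" "0 \<le> stored a $ n"
    using assms network
    by (auto simp: mu_in_def mu_out_def phi_out_def feasible_def wpn_network_def intro!: mult_nonneg_nonneg sum_nonneg)
  have "stored a $ n \<le> E_rx (H t \<omega>) a n" using assms(2) by (auto simp: feasible_def)
  with E show "stored a $ n \<le> phi_max N" by linarith
qed

text \<open>This bound grows with \<open>V\<close>, which does no harm: it serves boundedness and
  integrability and enters none of the final constants.\<close>

definition cost_bound :: "real \<Rightarrow> (real ^ 's ^ 'n) \<times> (real ^ 'n) \<Rightarrow> real"
  where "cost_bound V y = V * (tau_f N * P_AP_max N) + (\<Sum>n\<in>UNIV. \<Sum>s\<in>UNIV. \<bar>fst y $ n $ s\<bar> * mu_max N)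
     + (\<Sum>n\<in>UNIV. \<bar>snd y $ n\<bar> * phi_max N)"

lemma E_AP_bounds: "feasible N g h a \<Longrightarrow> 0 \<le> E_AP a \<and> E_AP a \<le> tau_f N * P_AP_max N"
  unfolding E_AP_def feasible_def by (auto intro!: mult_mono)

lemma abs_cost_le:
  assumes "\<omega> \<in> space M" "feasible N (G t \<omega>) (H t \<omega>) a" "0 \<le> V"
  shows "\<bar>cost N V y a\<bar> \<le> cost_bound V y"
proof -
  have 1: "\<bar>V * E_AP a\<bar> \<le> V * (tau_f N * P_AP_max N)"
    using assms E_AP_bounds[OF assms(2)] by (simp add: abs_mult mult_left_mono)
  have "\<bar>\<Sum>s\<in>UNIV. fst y $ n $ s * (mu_in N 0 a n s - mu_out N a n s)\<bar> \<le> (\<Sum>s\<in>UNIV. \<bar>fst y $ n $ s\<bar> * mu_max N)" for n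
  proof (rule order_trans[OF sum_abs], rule sum_mono)
    fix s
    have "\<bar>mu_in N 0 a n s - mu_out N a n s\<bar> \<le> mu_max N"
      using feasible_bounds(2,5,6,7)[OF assms(1,2), of n s] by linarith
    then show "\<bar>fst y $ n $ s * (mu_in N 0 a n s - mu_out N a n s)\<bar> \<le> \<bar>fst y $ n $ s\<bar> * mu_max N"
      by (simp add: abs_mult mult_left_mono)
  qed
  then have 2: "\<bar>\<Sum>n\<in>UNIV. \<Sum>s\<in>UNIV. fst y $ n $ s * (mu_in N 0 a n s - mu_out N a n s)\<bar>
      \<le> (\<Sum>n\<in>UNIV. \<Sum>s\<in>UNIV. \<bar>fst y $ n $ s\<bar> * mu_max N)"
    by (rule order_trans[OF sum_abs sum_mono])
  have 3: "\<bar>\<Sum>n\<in>UNIV. snd y $ n * (phi_out N a n - stored a $ n)\<bar> \<le> (\<Sum>n\<in>UNIV. \<bar>snd y $ n\<bar> * phi_max N)"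
  proof (rule order_trans[OF sum_abs], rule sum_mono)
    fix n
    have "\<bar>phi_out N a n - stored a $ n\<bar> \<le> phi_max N"
      using feasible_bounds(3,8,9,10)[OF assms(1,2), of n] by linarith
    then show "\<bar>snd y $ n * (phi_out N a n - stored a $ n)\<bar> \<le> \<bar>snd y $ n\<bar> * phi_max N"
      by (simp add: abs_mult mult_left_mono)
  qed
  show ?thesis using 1 2 3 unfolding cost_def cost_bound_def by linarith
qed

lemma simple_cost_bdd_below:
  assumes "\<omega> \<in> space M" "0 \<le> V"
  shows "bdd_below ((\<lambda>i. cost N V y (simple_action N i (G t \<omega>, H t \<omega>))) ` simple_idx N)"
proof (rule bdd_belowI2)
  fix i :: "('s, 'l, 'm) simple_index" assume "i \<in> simple_idx N"
  from abs_cost_le[OF assms(1) simple_idx_feasible[OF network this, of "(G t \<omega>, H t \<omega>)", simplified] assms(2), of y]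
  show "- cost_bound V y \<le> cost N V y (simple_action N i (G t \<omega>, H t \<omega>))" by simp
qed

lemma abs_opt_cost_le:
  assumes "\<omega> \<in> space M" "0 \<le> V"
  shows "\<bar>opt_cost N V y (G t \<omega>, H t \<omega>)\<bar> \<le> cost_bound V y"
proof -
  have b: "\<bar>cost N V y (simple_action N i (G t \<omega>, H t \<omega>))\<bar> \<le> cost_bound V y" if "i \<in> simple_idx N"
      for i :: "('s, 'l, 'm) simple_index"
    using abs_cost_le[OF assms(1) simple_idx_feasible[OF network that, of "(G t \<omega>, H t \<omega>)", simplified] assms(2)] .
  obtain i :: "('s, 'l, 'm) simple_index" where i: "i \<in> simple_idx N" using simple_idx_nonempty[OF network] by blast
  have "opt_cost N V y (G t \<omega>, H t \<omega>) \<le> cost N V y (simple_action N i (G t \<omega>, H t \<omega>))"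
    unfolding opt_cost_def by (rule cINF_lower[OF simple_cost_bdd_below[OF assms] i])
  moreover have "- cost_bound V y \<le> opt_cost N V y (G t \<omega>, H t \<omega>)"
    unfolding opt_cost_def using b
    by (intro cINF_greatest simple_idx_nonempty network) (auto simp: abs_le_iff minus_le_iff)
  ultimately show ?thesis using b[OF i] by linarith
qed

lemma opt_cost_le_cost:
  assumes "\<omega> \<in> space M" "0 \<le> V" "\<And>n. 0 \<le> snd y $ n"
    and "feasible N (G t \<omega>) (H t \<omega>) (a\<lparr>stored := 0\<rparr>)" "\<And>n. stored a $ n \<le> E_rx (H t \<omega>) a n"
  shows "opt_cost N V y (G t \<omega>, H t \<omega>) \<le> cost N V y a"
proof (rule field_le_epsilon)
  fix \<epsilon> :: real assume "0 < \<epsilon>"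
  then obtain i where i: "i \<in> simple_idx N"
      "cost N V y (simple_action N i (G t \<omega>, H t \<omega>)) \<le> cost N V y a + \<epsilon>"
    using cost_simple_approx[OF network assms(3-5)] by blast
  then show "opt_cost N V y (G t \<omega>, H t \<omega>) \<le> cost N V y a + \<epsilon>"
    unfolding opt_cost_def using cINF_lower[OF simple_cost_bdd_below[OF assms(1,2)] i(1)] by (meson order_trans)
qed

lemma feasible_no_storage: "feasible N g h a \<Longrightarrow> feasible N g h (a\<lparr>stored := 0\<rparr>)"
  by (auto simp: feasible_def E_rx_def E_AP_def bf_gain_nonneg)

lemma opt_cost_integrable:
  assumes "0 \<le> V"
  shows "integrable M (\<lambda>\<omega>. opt_cost N V y (G t \<omega>, H t \<omega>))"
  by (rule integrable_const_bound[where B = "cost_bound V y"])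
    (use abs_opt_cost_le assms in \<open>auto intro!: opt_cost_measurable network GH_measurable AE_I2\<close>)

lemma A_integrable: "integrable M (\<lambda>\<omega>. A t \<omega> $ n $ s)"
  using A_nonneg A_le
  by (intro integrable_const_bound[where B = "A_max N"] borel_measurable_vec_nth A_measurable AE_I2)
    (auto simp: abs_le_iff intro: order_trans)

lemma stationary_action_measurable:
  assumes "stationary_policy N \<pi>"
  shows "action_measurable M (\<lambda>\<omega>. \<pi> (G t \<omega>, H t \<omega>))"
  using assms GH_measurable by (auto simp: stationary_policy_def intro: action_measurable_compose)

lemma stationary_cost_integrable:
  assumes "stationary_policy N \<pi>" "0 \<le> V"
  shows "integrable M (\<lambda>\<omega>. cost N V y (\<pi> (G t \<omega>, H t \<omega>)))"
  by (rule integrable_const_bound[where B = "cost_bound V y"])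
    (use assms in \<open>auto intro!: abs_cost_le cost_measurable stationary_action_measurable AE_I2 simp: stationary_policy_def\<close>)

definition mean_arrival_cost :: "real ^ 's ^ 'n \<Rightarrow> real"
  where "mean_arrival_cost \<eta> = (\<Sum>n\<in>UNIV. \<Sum>s\<in>UNIV. \<eta> $ n $ s * lambda N n s)"

lemma lagrangian_eq:
  assumes \<pi>: "stationary_policy N \<pi>" and V: "0 \<le> V"
  shows "lagrangian N M G H A V \<pi> (fst y) (snd y)
    = (\<integral>\<omega>. cost N V y (\<pi> (G 0 \<omega>, H 0 \<omega>)) \<partial>M) + mean_arrival_cost (fst y)"
proof -
  let ?a = "\<lambda>\<omega>. \<pi> (G 0 \<omega>, H 0 \<omega>)"
  let ?A = "\<lambda>\<omega>. \<Sum>n\<in>UNIV. \<Sum>s\<in>UNIV. fst y $ n $ s * A 0 \<omega> $ n $ s"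
  have c: "integrable M (\<lambda>\<omega>. cost N V y (?a \<omega>))" by (rule stationary_cost_integrable[OF \<pi> V])
  \<comment> \<open>At unit energy price and zero multipliers the cost is the E-AP energy itself.
    This also covers \<open>V = 0\<close>, where the energy could not be recovered from the weighted
    cost.\<close>
  have "integrable M (\<lambda>\<omega>. cost N 1 (0, 0) (?a \<omega>))" by (rule stationary_cost_integrable[OF \<pi>]) simp
  then have E: "integrable M (\<lambda>\<omega>. V * E_AP (?a \<omega>))" by (simp add: cost_def)
  have Ai: "integrable M ?A" using A_integrable by auto
  have AI: "(\<integral>\<omega>. ?A \<omega> \<partial>M) = mean_arrival_cost (fst y)"
    using A_integrable by (simp add: mean_arrival_cost_def A_mean)
  have eq: "(let a = ?a \<omega> in
       (\<Sum>n\<in>UNIV. \<Sum>s\<in>UNIV. fst y $ n $ s * (mu_in N (A 0 \<omega>) a n s - mu_out N a n s)) +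
       (\<Sum>n\<in>UNIV. snd y $ n * (phi_out N a n - stored a $ n))) = cost N V y (?a \<omega>) - V * E_AP (?a \<omega>) + ?A \<omega>" for \<omega>
    unfolding cost_def mu_in_split[of N "A 0 \<omega>"] Let_def
    by (simp add: algebra_simps sum.distrib sum_subtractf)
  show ?thesis
    unfolding lagrangian_def eq using c E Ai AI by simp
qed

text \<open>Off the range of the channel process the infimum in \<open>opt_cost\<close> need not be under control; there
  the \<open>LEAST\<close> index below may be junk, but still yields a feasible action.\<close>

lemma near_optimal_policy:
  assumes V: "0 \<le> V" and \<epsilon>: "0 < \<epsilon>"
  obtains \<pi> :: "(complex ^ 'l) \<times> (complex ^ 'm ^ 'n) \<Rightarrow> ('n, 's, 'l, 'm) action"
    where "stationary_policy N \<pi>"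
      "\<And>\<omega> t. \<omega> \<in> space M \<Longrightarrow> cost N V y (\<pi> (G t \<omega>, H t \<omega>)) \<le> opt_cost N V y (G t \<omega>, H t \<omega>) + \<epsilon>"
proof -
  define e where "e = from_nat_into (simple_idx N :: ('s, 'l, 'm) simple_index set)"
  have e: "e k \<in> simple_idx N" for k
    unfolding e_def by (intro from_nat_into simple_idx_nonempty network)
  define P where "P k x \<longleftrightarrow> cost N V y (simple_action N (e k) x) < opt_cost N V y x + \<epsilon>" for k x
  \<comment> \<open>Taking the first index within \<epsilon> of the infimum makes the selection
    measurable, since countably many measurable inequalities decide it.\<close>
  define k where "k x = (LEAST k. P k x)" for x
  define \<pi> where "\<pi> x = simple_action N (e (k x)) x" for x
  have [measurable]: "(\<lambda>x. cost N V y (simple_action N (e k) x)) \<in> borel_measurable borel"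
      "(\<lambda>x. opt_cost N V y x) \<in> borel_measurable (borel :: ((complex ^ 'l) \<times> (complex ^ 'm ^ 'n)) measure)" for k
    by (auto intro!: cost_measurable simple_action_measurable opt_cost_measurable network e)
  have k: "k \<in> measurable borel (count_space UNIV)"
    unfolding k_def P_def by measurable
  have act: "action_measurable borel (simple_action N (e j))" for j
    using simple_action_measurable[OF network e, of "\<lambda>x. x" borel j] by simp
  have "action_measurable borel \<pi>"
    unfolding action_measurable_def \<pi>_def
  proof (intro conjI)
    show "(\<lambda>x. pow (simple_action N (e (k x)) x)) \<in> borel_measurable borel"
      by (rule measurable_compose_countable[where f = "\<lambda>j x. pow (simple_action N (e j) x)", OF _ k])
        (use act in \<open>simp add: action_measurable_def\<close>)
    show "(\<lambda>x. bf (simple_action N (e (k x)) x)) \<in> borel_measurable borel"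
      by (rule measurable_compose_countable[where f = "\<lambda>j x. bf (simple_action N (e j) x)", OF _ k])
        (use act in \<open>simp add: action_measurable_def\<close>)
    show "(\<lambda>x. rate (simple_action N (e (k x)) x)) \<in> borel_measurable borel"
      by (rule measurable_compose_countable[where f = "\<lambda>j x. rate (simple_action N (e j) x)", OF _ k])
        (use act in \<open>simp add: action_measurable_def\<close>)
    show "(\<lambda>x. P_AP (simple_action N (e (k x)) x)) \<in> borel_measurable borel"
      by (rule measurable_compose_countable[where f = "\<lambda>j x. P_AP (simple_action N (e j) x)", OF _ k])
        (use act in \<open>simp add: action_measurable_def\<close>)
    show "(\<lambda>x. tau_e (simple_action N (e (k x)) x)) \<in> borel_measurable borel"
      by (rule measurable_compose_countable[where f = "\<lambda>j x. tau_e (simple_action N (e j) x)", OF _ k])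
        (use act in \<open>simp add: action_measurable_def\<close>)
    show "(\<lambda>x. tau_d (simple_action N (e (k x)) x)) \<in> borel_measurable borel"
      by (rule measurable_compose_countable[where f = "\<lambda>j x. tau_d (simple_action N (e j) x)", OF _ k])
        (use act in \<open>simp add: action_measurable_def\<close>)
    show "(\<lambda>x. stored (simple_action N (e (k x)) x)) \<in> borel_measurable borel"
      by (rule measurable_compose_countable[where f = "\<lambda>j x. stored (simple_action N (e j) x)", OF _ k])
        (use act in \<open>simp add: action_measurable_def\<close>)
  qed
  then have "stationary_policy N \<pi>"
    unfolding stationary_policy_def \<pi>_def using simple_idx_feasible[OF network e] by auto
  moreover have "cost N V y (\<pi> (G t \<omega>, H t \<omega>)) \<le> opt_cost N V y (G t \<omega>, H t \<omega>) + \<epsilon>" if \<omega>: "\<omega> \<in> space M" for \<omega> t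
  proof -
    let ?x = "(G t \<omega>, H t \<omega>)"
    have "opt_cost N V y ?x < opt_cost N V y ?x + \<epsilon>" using \<epsilon> by simp
    then obtain i where "i \<in> simple_idx N" "cost N V y (simple_action N i ?x) < opt_cost N V y ?x + \<epsilon>"
      using cINF_less_iff[OF simple_idx_nonempty[OF network] simple_cost_bdd_below[OF \<omega> V]]
      unfolding opt_cost_def[symmetric] by blast
    moreover obtain j where "i = e j"
      using from_nat_into_surj[OF simple_idx_countable[OF network] \<open>i \<in> simple_idx N\<close>] unfolding e_def by metis
    ultimately have "P j ?x" by (simp add: P_def)
    then have "P (k ?x) ?x" unfolding k_def by (rule LeastI)
    then show ?thesis by (simp add: P_def \<pi>_def)
  qed
  ultimately show ?thesis using that by blast
qed

text \<open>Infimum and expectation may be exchanged: no policy beats the slotwise minimum, and a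
  measurable selection comes within any \<epsilon> of it.\<close>

lemma dual_fun_eq:
  assumes V: "0 \<le> V" and \<beta>: "\<And>n. 0 \<le> snd y $ n"
  shows "dual_fun N M G H A V y = (\<integral>\<omega>. opt_cost N V y (G 0 \<omega>, H 0 \<omega>) \<partial>M) + mean_arrival_cost (fst y)"
    (is "_ = ?r")
proof (rule antisym)
  let ?L = "{lagrangian N M G H A V \<pi> (fst y) (snd y) | \<pi>. stationary_policy N \<pi>}"
  have lb: "?r \<le> lagrangian N M G H A V \<pi> (fst y) (snd y)" if \<pi>: "stationary_policy N \<pi>" for \<pi>
    unfolding lagrangian_eq[OF \<pi> V] using \<pi>
    by (auto intro!: integral_mono opt_cost_integrable V stationary_cost_integrable opt_cost_le_cost \<beta>
        simp: stationary_policy_def feasible_no_storage) (auto simp: feasible_def)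
  have bdd: "bdd_below ?L" using lb by (intro bdd_belowI[of _ ?r]) auto
  show "?r \<le> dual_fun N M G H A V y"
    unfolding dual_fun_def
  proof (rule cInf_greatest)
    show "?L \<noteq> {}" by (rule near_optimal_policy[OF V zero_less_one, of y]) auto
  qed (use lb in auto)
  show "dual_fun N M G H A V y \<le> ?r"
  proof (rule field_le_epsilon)
    fix \<epsilon> :: real assume \<epsilon>: "0 < \<epsilon>"
    obtain \<pi> where \<pi>: "stationary_policy N \<pi>"
      and le: "\<And>\<omega> t. \<omega> \<in> space M \<Longrightarrow> cost N V y (\<pi> (G t \<omega>, H t \<omega>)) \<le> opt_cost N V y (G t \<omega>, H t \<omega>) + \<epsilon>"
      by (rule near_optimal_policy[OF V \<epsilon>, of y]) blast
    have "dual_fun N M G H A V y \<le> lagrangian N M G H A V \<pi> (fst y) (snd y)"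
      unfolding dual_fun_def using \<pi> bdd by (intro cInf_lower) auto
    also have "\<dots> = (\<integral>\<omega>. cost N V y (\<pi> (G 0 \<omega>, H 0 \<omega>)) \<partial>M) + mean_arrival_cost (fst y)"
      by (rule lagrangian_eq[OF \<pi> V])
    also have "(\<integral>\<omega>. cost N V y (\<pi> (G 0 \<omega>, H 0 \<omega>)) \<partial>M) \<le> (\<integral>\<omega>. opt_cost N V y (G 0 \<omega>, H 0 \<omega>) + \<epsilon> \<partial>M)"
      using le by (intro integral_mono stationary_cost_integrable \<pi> V Bochner_Integration.integrable_add opt_cost_integrable) auto
    also have "\<dots> = (\<integral>\<omega>. opt_cost N V y (G 0 \<omega>, H 0 \<omega>) \<partial>M) + \<epsilon>"
      using opt_cost_integrable[OF V] by (simp add: prob_space)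
    finally show "dual_fun N M G H A V y \<le> ?r + \<epsilon>" by simp
  qed
qed

end

section \<open>One slot of the policy\<close>

text \<open>The state read as a pair of multipliers. With them the weights and costs used by the
  policy are those of the Lagrangian, as the identities below show.\<close>

definition prices ::
    "('n::finite, 's::finite, 'l::finite) wpn \<Rightarrow> real \<Rightarrow> real ^ 's ^ 'n \<Rightarrow> real ^ 'n \<Rightarrow> (real ^ 's ^ 'n) \<times> (real ^ 'n)"
  where "prices N \<alpha> U B = (\<chi> n s. price N \<alpha> U B n s, \<chi> n. CC N \<alpha> * ZZ N \<alpha> U B n)"

lemma stream_weight_prices: "stream_weight N (fst (prices N \<alpha> U B)) = link_weight N \<alpha> U B"
  by (intro ext) (simp add: stream_weight_def link_weight_def prices_def)

lemma top_weight_prices: "top_weight N (fst (prices N \<alpha> U B)) l = max_weight N \<alpha> U B l"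
  by (simp add: top_weight_def max_weight_def stream_weight_prices)

lemma data_term_prices: "data_term N (prices N \<alpha> U B) g p = data_cost N \<alpha> U B g p"
  by (simp add: data_term_def data_cost_def top_weight_prices) (simp add: prices_def)

lemma energy_gain_prices: "energy_gain (snd (prices N \<alpha> U B)) h w = weighted_gain N \<alpha> U B h w"
  by (simp add: energy_gain_def weighted_gain_def prices_def sum_distrib_left algebra_simps)

lemma energy_matrix_prices:
  "energy_matrix N \<alpha> U B h =
    (\<chi> i j. \<Sum>n\<in>UNIV. of_real (snd (prices N \<alpha> U B) $ n) * (h $ n $ i * cnj (h $ n $ j)))"
  by (simp add: energy_matrix_def prices_def sum_distrib_left mult.assoc)

lemma norm_cnj_vec: "norm (\<chi> i. cnj (v $ i)) = norm (v :: complex ^ 'm::finite)"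
  by (simp add: norm_vec_def)

text \<open>Storage is reset to 0 because the rule takes a minimum with
  \<open>(Z - mu_max) / C\<close>, and nothing established here excludes \<open>Z\<close> below
  \<open>mu_max\<close>.\<close>

lemma eecw_feasible:
  assumes net: "wpn_network N" and a: "eecw_action N \<alpha> V U B g h a"
  shows "feasible N g h (a\<lparr>stored := 0\<rparr>)"
proof -
  have p: "pow a \<in> powers N" using a by (auto simp: eecw_action_def is_arg_min_def)
  have R: "0 \<le> rate_fun N l (pow a) g" for l using net p by (auto simp: wpn_network_def)
  obtain sel where sel: "\<And>l s. rate a $ l $ s = (if s = sel l then rate_fun N l (pow a) g else 0)"
    using a unfolding eecw_action_def by metis
  have P: "0 \<le> P_AP a" "P_AP a \<le> P_AP_max N"
    using a net by (auto simp: eecw_action_def wpn_network_def)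
  have \<tau>: "0 \<le> tau_e a" "0 \<le> tau_d a" "tau_e a + tau_d a = tau_f N"
    using a net by (auto simp: eecw_action_def wpn_network_def split: if_splits)
  have "norm (bf a) = 1" using a by (auto simp: eecw_action_def norm_cnj_vec)
  then show ?thesis
    using p R P \<tau> by (auto simp: feasible_def sel E_rx_def E_AP_def bf_gain_nonneg)
qed

text \<open>Compare the chosen powers with those where link \<open>l\<close> is switched off. The
  other rates can only grow and have nonnegative weights, while link \<open>l\<close> loses at most
  \<open>delta N\<close> per unit of power; optimality then bounds the price of that power.\<close>

lemma eecw_power_price:
  assumes net: "wpn_network N" and a: "eecw_action N \<alpha> V U B g h a" and l: "0 < pow a $ l"
  shows "CC N \<alpha> * ZZ N \<alpha> U B (head N l) \<le> delta N * max_weight N \<alpha> U B l"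
proof -
  let ?p = "pow a" and ?W = "max_weight N \<alpha> U B" and ?Z = "\<lambda>k. CC N \<alpha> * ZZ N \<alpha> U B (head N k)"
  define q where "q = (\<chi> k. if k = l then 0 else ?p $ k)"
  have p: "?p \<in> powers N" and min: "\<And>q. q \<in> powers N \<Longrightarrow> data_cost N \<alpha> U B g ?p \<le> data_cost N \<alpha> U B g q"
    using a by (auto simp: eecw_action_def is_arg_min_linorder)
  have q: "q \<in> powers N" using net p by (auto simp: wpn_network_def q_def)
  have ql: "q $ l = 0" "\<And>k. k \<noteq> l \<Longrightarrow> q $ k = ?p $ k" by (auto simp: q_def)
  have "rate_fun N l ?p g - rate_fun N l q g \<le> delta N * (?p $ l - q $ l) \<and>
         (\<forall>k. k \<noteq> l \<longrightarrow> rate_fun N k ?p g \<le> rate_fun N k q g)"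
  proof -
    have "\<forall>p\<in>powers N. \<forall>q\<in>powers N. \<forall>l g. (\<forall>k. k \<noteq> l \<longrightarrow> q $ k = p $ k) \<and> q $ l < p $ l \<longrightarrow>
        rate_fun N l p g - rate_fun N l q g \<le> delta N * (p $ l - q $ l) \<and>
         (\<forall>k. k \<noteq> l \<longrightarrow> rate_fun N k p g \<le> rate_fun N k q g)"
      using net unfolding wpn_network_def by (elim conjE) assumption
    from this[rule_format, OF p q, of l g] show ?thesis using ql l by simp
  qed
  moreover have R0: "rate_fun N l q g = 0" using net q ql by (auto simp: wpn_network_def)
  ultimately have Rl: "rate_fun N l ?p g \<le> delta N * ?p $ l"
    and Rk: "\<And>k. k \<noteq> l \<Longrightarrow> rate_fun N k ?p g \<le> rate_fun N k q g" using ql by auto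
  have W: "0 \<le> ?W k" for k by (simp add: max_weight_def)
  have "(\<Sum>k\<in>UNIV. if k = l then ?Z l * ?p $ l - ?W l * rate_fun N l ?p g else 0)
    \<le> (\<Sum>k\<in>UNIV. (?Z k * ?p $ k - ?W k * rate_fun N k ?p g) - (?Z k * q $ k - ?W k * rate_fun N k q g))"
    using R0 ql Rk W by (intro sum_mono) (auto intro: mult_left_mono)
  also have "\<dots> = data_cost N \<alpha> U B g ?p - data_cost N \<alpha> U B g q"
    by (simp add: data_cost_def sum_subtractf)
  also have "\<dots> \<le> 0" using min[OF q] by simp
  finally have "?Z l * ?p $ l \<le> ?W l * rate_fun N l ?p g" by simp
  also have "\<dots> \<le> ?W l * (delta N * ?p $ l)" by (intro mult_left_mono Rl W)
  finally have "?Z l * ?p $ l \<le> (delta N * ?W l) * ?p $ l" by (simp add: algebra_simps)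
  then show ?thesis using l by simp
qed

lemma CC_bounds:
  assumes "wpn_network N" "1 < \<alpha>"
  shows "2 * delta N \<le> CC N \<alpha>" "0 < CC N \<alpha>"
proof -
  have "0 < delta N" using assms by (simp add: wpn_network_def)
  then show "2 * delta N \<le> CC N \<alpha>" "0 < CC N \<alpha>"
    using assms(2) by (simp_all add: CC_def field_simps)
qed

section \<open>State invariants and near-optimality of the policy\<close>

locale eecw_process = slotted_network N M G H A
  for N :: "('n::finite, 's::finite, 'l::finite) wpn"
    and M :: "'w measure"
    and G :: "nat \<Rightarrow> 'w \<Rightarrow> complex ^ 'l"
    and H :: "nat \<Rightarrow> 'w \<Rightarrow> complex ^ 'm::finite ^ 'n"
    and A :: "nat \<Rightarrow> 'w \<Rightarrow> real ^ 's ^ 'n" +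
  fixes \<alpha> V :: real
    and act :: "nat \<Rightarrow> 'w \<Rightarrow> ('n, 's, 'l, 'm) action"
    and U :: "nat \<Rightarrow> 'w \<Rightarrow> real ^ 's ^ 'n"
    and B :: "nat \<Rightarrow> 'w \<Rightarrow> real ^ 'n"
  assumes alpha: "1 < \<alpha>" and V: "0 \<le> V" and run: "eecw_run N M G H A \<alpha> V act U B"
begin

lemma delta_pos: "0 < delta N" using network by (simp add: wpn_network_def)

lemma CC_ge: "2 * delta N \<le> CC N \<alpha>" and CC_pos: "0 < CC N \<alpha>"
  using CC_bounds[OF network alpha] by auto

text \<open>The model states these numbers only as upper bounds. Their sign follows because some
  feasible action exists and its flows are nonnegative.\<close>

lemma mu_max_nonneg: "0 \<le> mu_max N" and phi_max_nonneg: "0 \<le> phi_max N"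
proof -
  obtain \<omega> where \<omega>: "\<omega> \<in> space M" using not_empty by blast
  obtain i :: "('s, 'l, 'm) simple_index" where i: "i \<in> simple_idx N" using simple_idx_nonempty[OF network] by blast
  have f: "feasible N (G 0 \<omega>) (H 0 \<omega>) (simple_action N i (G 0 \<omega>, H 0 \<omega>))"
    using simple_idx_feasible[OF network i, of "(G 0 \<omega>, H 0 \<omega>)"] by simp
  show "0 \<le> mu_max N" "0 \<le> phi_max N"
    using feasible_bounds[OF \<omega> f] by (meson order_trans)+
qed

text \<open>Giving all rates of the action to one stream is feasible, so \<open>mu_max\<close> bounds the total outflow.\<close>

lemma total_outflow_le:
  assumes \<omega>: "\<omega> \<in> space M" and a: "feasible N (G t \<omega>) (H t \<omega>) a"
  shows "(\<Sum>s\<in>UNIV. mu_out N a n s) \<le> mu_max N"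
proof -
  fix s0 :: 's
  define a' where "a' = a\<lparr>rate := (\<chi> l s. if s = s0 then rate_fun N l (pow a) (G t \<omega>) else 0)\<rparr>"
  have R: "0 \<le> rate_fun N l (pow a) (G t \<omega>)" for l
    using a network by (auto simp: feasible_def wpn_network_def)
  have "feasible N (G t \<omega>) (H t \<omega>) a'"
    using a R by (auto simp: feasible_def a'_def E_rx_def E_AP_def)
  then have "mu_out N a' n s0 \<le> mu_max N" by (rule feasible_bounds[OF \<omega>])
  moreover have "(\<Sum>s\<in>UNIV. mu_out N a n s) \<le> mu_out N a' n s0"
  proof -
    have "(\<Sum>s\<in>UNIV. mu_out N a n s) = tau_d a * (\<Sum>l\<in>out_links N n. \<Sum>s\<in>UNIV. rate a $ l $ s)"
      unfolding mu_out_def sum_distrib_left by (rule sum.swap)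
    also have "\<dots> \<le> tau_d a * (\<Sum>l\<in>out_links N n. rate_fun N l (pow a) (G t \<omega>))"
      using a by (intro mult_left_mono sum_mono) (auto simp: feasible_def)
    also have "\<dots> = mu_out N a' n s0" by (simp add: mu_out_def a'_def)
    finally show ?thesis .
  qed
  ultimately show ?thesis by linarith
qed

lemma U_init: "\<omega> \<in> space M \<Longrightarrow> U 0 \<omega> $ n $ s = U_init N \<alpha>"
  and B_init: "\<omega> \<in> space M \<Longrightarrow> B 0 \<omega> $ n = 0"
  and act: "\<omega> \<in> space M \<Longrightarrow> eecw_action N \<alpha> V (U t \<omega>) (B t \<omega>) (G t \<omega>) (H t \<omega>) (act t \<omega>)"
  and U_Suc: "\<omega> \<in> space M \<Longrightarrow> U (Suc t) \<omega> $ n $ s =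
          (if (n, s) \<in> sinks N then U t \<omega> $ n $ s
           else max (U t \<omega> $ n $ s - mu_out N (act t \<omega>) n s) 0 + mu_in N (A t \<omega>) (act t \<omega>) n s)"
  and B_Suc: "\<omega> \<in> space M \<Longrightarrow> B (Suc t) \<omega> $ n =
          B t \<omega> $ n - phi_out N (act t \<omega>) n + stored (act t \<omega>) $ n"
  using run unfolding eecw_run_def by blast+

lemma act_feasible: "\<omega> \<in> space M \<Longrightarrow> feasible N (G t \<omega>) (H t \<omega>) ((act t \<omega>)\<lparr>stored := 0\<rparr>)"
  by (rule eecw_feasible[OF network act])

lemma act_stored: "\<omega> \<in> space M \<Longrightarrow> stored (act t \<omega>) $ n
    = min (E_rx (H t \<omega>) (act t \<omega>) n) ((ZZ N \<alpha> (U t \<omega>) (B t \<omega>) n - mu_max N) / CC N \<alpha>)"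
  using act unfolding eecw_action_def by blast

text \<open>Flows and received energy do not read the storage component, so the bounds of the
  feasible action with storage reset carry over.\<close>

lemma act_bounds:
  assumes "\<omega> \<in> space M"
  shows "mu_in N (A t \<omega>) (act t \<omega>) n s \<le> mu_max N" "mu_out N (act t \<omega>) n s \<le> mu_max N"
    "phi_out N (act t \<omega>) n \<le> phi_max N" "E_rx (H t \<omega>) (act t \<omega>) n \<le> phi_max N"
    "0 \<le> mu_in N (A t \<omega>) (act t \<omega>) n s" "0 \<le> mu_out N (act t \<omega>) n s" "0 \<le> phi_out N (act t \<omega>) n"
    "0 \<le> E_rx (H t \<omega>) (act t \<omega>) n"
    "(\<Sum>s\<in>UNIV. mu_out N (act t \<omega>) n s) \<le> mu_max N"
proof -
  let ?a = "act t \<omega>" and ?b = "(act t \<omega>)\<lparr>stored := 0\<rparr>"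
  have eq: "mu_in N X ?b n s = mu_in N X ?a n s" "mu_out N ?b n s = mu_out N ?a n s"
     "phi_out N ?b n = phi_out N ?a n" "E_rx (H t \<omega>) ?b n = E_rx (H t \<omega>) ?a n" for X n s
    by (simp_all add: mu_in_def mu_out_def phi_out_def E_rx_def E_AP_def)
  note b = feasible_bounds[OF assms act_feasible[OF assms], of t, unfolded eq]
  show "mu_in N (A t \<omega>) ?a n s \<le> mu_max N" "mu_out N ?a n s \<le> mu_max N"
    "phi_out N ?a n \<le> phi_max N" "E_rx (H t \<omega>) ?a n \<le> phi_max N" "0 \<le> mu_out N ?a n s" "0 \<le> phi_out N ?a n"
    using b by auto
  show "0 \<le> mu_in N (A t \<omega>) ?a n s"
    using b(5)[of n s] A_nonneg[OF assms, of t n s] unfolding mu_in_split[of N "A t \<omega>"] by linarith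
  show "0 \<le> E_rx (H t \<omega>) ?a n"
    using act_feasible[OF assms, of t] by (auto simp: E_rx_def E_AP_def bf_gain_nonneg feasible_def)
  show "(\<Sum>s\<in>UNIV. mu_out N ?a n s) \<le> mu_max N"
    using total_outflow_le[OF assms act_feasible[OF assms], of t n] unfolding eq .
qed

abbreviation "Z t \<omega> \<equiv> ZZ N \<alpha> (U t \<omega>) (B t \<omega>)"

lemma U_init_nonneg: "0 \<le> U_init N \<alpha>" "mu_max N \<le> U_init N \<alpha>"
  using mu_max_nonneg by (auto simp: U_init_def)

lemma U_nonneg: "\<omega> \<in> space M \<Longrightarrow> 0 \<le> U t \<omega> $ n $ s"
  by (induction t) (auto simp: U_init U_init_nonneg U_Suc act_bounds)

lemma U_sink: "\<omega> \<in> space M \<Longrightarrow> (n, s) \<in> sinks N \<Longrightarrow> U t \<omega> $ n $ s = U_init N \<alpha>"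
  by (induction t) (auto simp: U_init U_Suc)

lemma Z_Suc:
  assumes "\<omega> \<in> space M"
  shows "Z (Suc t) \<omega> n = Z t \<omega> n + (\<Sum>s\<in>UNIV. U (Suc t) \<omega> $ n $ s - U t \<omega> $ n $ s)
    + CC N \<alpha> * (phi_out N (act t \<omega>) n - stored (act t \<omega>) $ n)"
  using assms by (simp add: ZZ_def B_Suc sum_subtractf algebra_simps)

lemma U_step:
  assumes "\<omega> \<in> space M"
  shows "- mu_out N (act t \<omega>) n s \<le> U (Suc t) \<omega> $ n $ s - U t \<omega> $ n $ s"
    "U (Suc t) \<omega> $ n $ s - U t \<omega> $ n $ s \<le> mu_max N"
    "\<bar>U (Suc t) \<omega> $ n $ s - U t \<omega> $ n $ s\<bar> \<le> mu_max N"
  using U_nonneg[OF assms, of t n s] act_bounds(1,2,5,6)[OF assms, of t n s] by (auto simp: U_Suc[OF assms])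

text \<open>If time is given to data, nonnegative powers with zero sum vanish individually, and a
  link without power has rate 0.\<close>

lemma no_power_no_flow:
  assumes \<omega>: "\<omega> \<in> space M" and "phi_out N (act t \<omega>) n = 0"
  shows "mu_out N (act t \<omega>) n s = 0"
proof (cases "tau_d (act t \<omega>) = 0")
  case True
  then show ?thesis by (simp add: mu_out_def)
next
  case False
  let ?a = "act t \<omega>"
  have f: "pow ?a \<in> powers N" "0 \<le> rate ?a $ l $ s"
      "(\<Sum>s\<in>UNIV. rate ?a $ l $ s) \<le> rate_fun N l (pow ?a) (G t \<omega>)" for l s
    using act_feasible[OF \<omega>, of t] by (auto simp: feasible_def)
  have "(\<Sum>l\<in>out_links N n. pow ?a $ l) = 0" using False assms(2) by (simp add: phi_out_def)
  then have "\<forall>l\<in>out_links N n. pow ?a $ l = 0"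
    using f(1) network by (subst (asm) sum_nonneg_eq_0_iff) (auto simp: wpn_network_def)
  then have R: "\<forall>l\<in>out_links N n. rate_fun N l (pow ?a) (G t \<omega>) = 0"
    using f(1) network by (auto simp: wpn_network_def)
  have "rate ?a $ l $ s = 0" if "l \<in> out_links N n" for l
  proof -
    have "rate ?a $ l $ s \<le> (\<Sum>s\<in>UNIV. rate ?a $ l $ s)" using f(2) by (intro member_le_sum) auto
    then show ?thesis using f(2)[of l s] f(3)[of l] R that by (smt (verit))
  qed
  then show ?thesis by (simp add: mu_out_def)
qed

text \<open>The storage rule keeps \<open>Z\<close> above \<open>mu_max\<close> before the outflow of the slot is subtracted;
  a node that sends data also spends energy, which makes the bound strict.\<close>

lemma Z_Suc_nonneg:
  assumes \<omega>: "\<omega> \<in> space M"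
  shows "0 \<le> Z (Suc t) \<omega> n" "0 < mu_max N \<Longrightarrow> 0 < Z (Suc t) \<omega> n"
proof -
  let ?a = "act t \<omega>"
  have "stored ?a $ n \<le> (Z t \<omega> n - mu_max N) / CC N \<alpha>"
    unfolding act_stored[OF \<omega>] by simp
  then have "CC N \<alpha> * stored ?a $ n \<le> Z t \<omega> n - mu_max N"
    using CC_pos by (simp add: field_simps)
  moreover have "- (\<Sum>s\<in>UNIV. mu_out N ?a n s) \<le> (\<Sum>s\<in>UNIV. U (Suc t) \<omega> $ n $ s - U t \<omega> $ n $ s)"
    unfolding sum_negf[symmetric] by (intro sum_mono U_step \<omega>)
  ultimately have lb: "mu_max N - (\<Sum>s\<in>UNIV. mu_out N ?a n s) + CC N \<alpha> * phi_out N ?a n \<le> Z (Suc t) \<omega> n"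
    unfolding Z_Suc[OF \<omega>] right_diff_distrib by linarith
  have out: "(\<Sum>s\<in>UNIV. mu_out N ?a n s) \<le> mu_max N" "0 \<le> phi_out N ?a n"
    using act_bounds[OF \<omega>] by auto
  then show "0 \<le> Z (Suc t) \<omega> n" using lb CC_pos by (smt (verit) mult_nonneg_nonneg)
  show "0 < Z (Suc t) \<omega> n" if "0 < mu_max N"
  proof (cases "phi_out N ?a n = 0")
    case True
    then show ?thesis using no_power_no_flow[OF \<omega> True] lb that by simp
  next
    case False
    then have "0 < CC N \<alpha> * phi_out N ?a n" using out CC_pos by simp
    then show ?thesis using lb out by linarith
  qed
qed

text \<open>A case split replaces induction: the storage rule enforces the bound afresh in every
  slot, and the dummy data provide it in slot 0.\<close>

lemma Z_nonneg: "\<omega> \<in> space M \<Longrightarrow> 0 \<le> Z t \<omega> n"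
  and Z_pos: "\<omega> \<in> space M \<Longrightarrow> 0 < mu_max N \<Longrightarrow> 0 < Z t \<omega> n"
  using U_init_nonneg
  by (cases t; auto simp: Z_Suc_nonneg ZZ_def[of _ _ "U 0 \<omega>"] U_init B_init)+

lemma price_nonneg: "\<omega> \<in> space M \<Longrightarrow> 0 \<le> price N \<alpha> (U t \<omega>) (B t \<omega>) n s"
  by (simp add: price_def Z_nonneg U_nonneg)

abbreviation "q t \<omega> \<equiv> prices N \<alpha> (U t \<omega>) (B t \<omega>)"

text \<open>This makes the growth hypothesis, which speaks of multipliers in the dual domain,
  applicable at the current prices.\<close>

lemma q_in_domain: "\<omega> \<in> space M \<Longrightarrow> q t \<omega> \<in> dual_domain N"
  using CC_pos by (auto simp: prices_def dual_domain_def price_nonneg Z_nonneg) (simp add: price_def)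

text \<open>A link that is actually used has a strictly positive weight, because \<open>Z\<close> is strictly positive
  at its transmitter. This excludes harmful ties in the arg max and arg min of the policy.\<close>

lemma active_link:
  assumes \<omega>: "\<omega> \<in> space M" and pos: "0 < tau_d (act t \<omega>) * rate (act t \<omega>) $ l $ s"
  shows "link_weight N \<alpha> (U t \<omega>) (B t \<omega>) l s = max_weight N \<alpha> (U t \<omega>) (B t \<omega>) l"
    "CC N \<alpha> * Z t \<omega> (head N l) \<le> delta N * max_weight N \<alpha> (U t \<omega>) (B t \<omega>) l"
proof -
  let ?a = "act t \<omega>" and ?w = "link_weight N \<alpha> (U t \<omega>) (B t \<omega>)"
  have f: "pow ?a \<in> powers N" "0 \<le> tau_d ?a" "\<And>l s. 0 \<le> rate ?a $ l $ s"
    using act_feasible[OF \<omega>, of t] by (auto simp: feasible_def)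
  obtain sel where sel: "\<And>l. is_arg_max (?w l) (\<lambda>_. True) (sel l)"
      "\<And>l s. rate ?a $ l $ s = (if s = sel l then rate_fun N l (pow ?a) (G t \<omega>) else 0)"
    using act[OF \<omega>, of t] unfolding eecw_action_def by metis
  have r: "0 < tau_d ?a" "0 < rate ?a $ l $ s" using pos f(2) f(3)[of l s] by (auto simp: zero_less_mult_iff)
  then have s: "s = sel l" "0 < rate_fun N l (pow ?a) (G t \<omega>)"
    using sel(2)[of l s] by (auto split: if_splits)
  have "pow ?a $ l \<noteq> 0" using s(2) f(1) network by (auto simp: wpn_network_def)
  moreover have "0 \<le> pow ?a $ l" using f(1) network by (auto simp: wpn_network_def)
  ultimately have "0 < pow ?a $ l" by simp
  then show le: "CC N \<alpha> * Z t \<omega> (head N l) \<le> delta N * max_weight N \<alpha> (U t \<omega>) (B t \<omega>) l"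
    by (rule eecw_power_price[OF network act[OF \<omega>]])
  have "tau_d ?a * rate ?a $ l $ s \<le> mu_out N ?a (head N l) s"
    unfolding mu_out_def using f by (intro mult_left_mono member_le_sum) (auto simp: out_links_def)
  \<comment> \<open>The flow on this link provides the condition under which \<open>Z_pos\<close>
    gives strict positivity.\<close>
  then have "0 < mu_max N" using pos act_bounds(2)[OF \<omega>, of t "head N l" s] by linarith
  then have "0 < CC N \<alpha> * Z t \<omega> (head N l)" using Z_pos[OF \<omega>] CC_pos by simp
  with le have "0 < max_weight N \<alpha> (U t \<omega>) (B t \<omega>) l"
    using delta_pos by (smt (verit) mult_nonneg_nonpos)
  then have "max_weight N \<alpha> (U t \<omega>) (B t \<omega>) l = Max (range (?w l))"
    by (auto simp: max_weight_def max_def split: if_splits)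
  also have "\<dots> = ?w l s"
    using sel(1)[of l] unfolding s(1) is_arg_max_linorder by (intro Max_eqI) auto
  finally show "?w l s = max_weight N \<alpha> (U t \<omega>) (B t \<omega>) l" by simp
qed

text \<open>Energy is given up only if \<open>Z < mu_max + C E\<close>, where \<open>E\<close> is
  the energy received. Then \<open>Z\<close> is bounded, and so is the loss
  \<open>C E - Z + mu_max\<close> scaled by \<open>C\<close>.\<close>

lemma storage_loss:
  assumes \<omega>: "\<omega> \<in> space M"
  shows "CC N \<alpha> * Z t \<omega> n * (E_rx (H t \<omega>) (act t \<omega>) n - stored (act t \<omega>) $ n)
    \<le> (mu_max N + CC N \<alpha> * phi_max N)\<^sup>2"
proof -
  let ?E = "E_rx (H t \<omega>) (act t \<omega>) n"
  have E: "CC N \<alpha> * ?E \<le> CC N \<alpha> * phi_max N" using act_bounds(4)[OF \<omega>] CC_pos by (intro mult_left_mono) auto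
  show ?thesis
  proof (cases "?E \<le> (Z t \<omega> n - mu_max N) / CC N \<alpha>")
    case True
    then show ?thesis by (simp add: act_stored[OF \<omega>])
  next
    case False
    then have Z: "Z t \<omega> n < mu_max N + CC N \<alpha> * ?E" using CC_pos by (simp add: field_simps)
    then have z: "Z t \<omega> n \<le> mu_max N + CC N \<alpha> * phi_max N" using E by linarith
    have "CC N \<alpha> * Z t \<omega> n * (?E - stored (act t \<omega>) $ n) = Z t \<omega> n * (CC N \<alpha> * ?E - Z t \<omega> n + mu_max N)"
      using False CC_pos by (simp add: act_stored[OF \<omega>] min_def field_simps)
    also have "\<dots> \<le> (mu_max N + CC N \<alpha> * phi_max N) * (mu_max N + CC N \<alpha> * phi_max N)"
    proof (rule mult_mono)
      show "0 \<le> mu_max N + CC N \<alpha> * phi_max N" using mu_max_nonneg phi_max_nonneg CC_pos by simp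
    qed (use Z z E Z_nonneg[OF \<omega>, of t n] in linarith)+
    finally show ?thesis by (simp add: power2_eq_square)
  qed
qed

text \<open>Powers, streams, beam, E-AP power and time split each minimize their own part of the
  cost at the current prices. Only the storage rule departs from the optimum, and every node
  contributes its storage loss once.\<close>

lemma eecw_cost_le:
  assumes \<omega>: "\<omega> \<in> space M" and b: "feasible N (G t \<omega>) (H t \<omega>) b"
  shows "cost N V (q t \<omega>) (act t \<omega>) \<le> cost N V (q t \<omega>) b
    + real CARD('n) * (mu_max N + CC N \<alpha> * phi_max N)\<^sup>2"
proof -
  let ?a = "act t \<omega>" and ?q = "q t \<omega>" and ?g = "G t \<omega>" and ?h = "H t \<omega>"
  let ?W = "max_weight N \<alpha> (U t \<omega>) (B t \<omega>)" and ?w = "link_weight N \<alpha> (U t \<omega>) (B t \<omega>)"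
  define gain where "gain = weighted_gain N \<alpha> (U t \<omega>) (B t \<omega>) ?h"
  define Fe where "Fe = P_AP ?a * (V - gain (bf ?a))"
  define Fd where "Fd = data_cost N \<alpha> (U t \<omega>) (B t \<omega>) ?g (pow ?a)"
  note E = act[OF \<omega>, of t, unfolded eecw_action_def]
  have fa: "0 \<le> tau_d ?a" "\<And>l s. 0 \<le> rate ?a $ l $ s"
    using act_feasible[OF \<omega>, of t] by (auto simp: feasible_def)
  obtain sel where sel: "\<And>l s. rate ?a $ l $ s = (if s = sel l then rate_fun N l (pow ?a) ?g else 0)"
    using E by metis
  \<comment> \<open>The factor \<open>tau_d\<close> matters: a selected stream may have negative
    weight, but then its link carries nothing, and both sides are 0.\<close>
  have "tau_d ?a * (\<Sum>s\<in>UNIV. rate ?a $ l $ s * ?w l s) = tau_d ?a * (?W l * rate_fun N l (pow ?a) ?g)" for l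
  proof -
    have "tau_d ?a * rate ?a $ l $ sel l * ?w l (sel l) = tau_d ?a * rate ?a $ l $ sel l * ?W l"
      using active_link(1)[OF \<omega>, of t l "sel l"] fa(1) fa(2)[of l "sel l"]
      by (cases "tau_d ?a * rate ?a $ l $ sel l = 0") (auto simp: less_le)
    moreover have "(\<Sum>s\<in>UNIV. rate ?a $ l $ s * ?w l s) = rate ?a $ l $ sel l * ?w l (sel l)"
      by (simp add: sel if_distrib[of "\<lambda>x. x * _"] cong: if_cong)
    ultimately show ?thesis using sel[of l "sel l"] by (simp add: mult.assoc mult.commute)
  qed
  then have data: "tau_d ?a * (\<Sum>l\<in>UNIV. snd ?q $ head N l * pow ?a $ l
      - (\<Sum>s\<in>UNIV. rate ?a $ l $ s * stream_weight N (fst ?q) l s)) = tau_d ?a * Fd"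
    unfolding Fd_def data_term_prices[symmetric] data_term_def stream_weight_prices top_weight_prices
    by (simp add: sum_distrib_left right_diff_distrib)
  have "V * E_AP ?a - (\<Sum>n\<in>UNIV. snd ?q $ n * stored ?a $ n) =
      tau_e ?a * Fe + (\<Sum>n\<in>UNIV. CC N \<alpha> * Z t \<omega> n * (E_rx ?h ?a n - stored ?a $ n))"
    using sum_E_rx[of "snd ?q" ?h ?a] unfolding energy_gain_prices gain_def[symmetric] Fe_def E_AP_def
    by (simp add: prices_def sum_subtractf right_diff_distrib algebra_simps)
  also have "\<dots> \<le> tau_e ?a * Fe + (\<Sum>n\<in>(UNIV::'n set). (mu_max N + CC N \<alpha> * phi_max N)\<^sup>2)"
    by (intro add_left_mono sum_mono storage_loss \<omega>)
  finally have "cost N V ?q ?a \<le> (tau_e ?a * Fe + tau_d ?a * Fd) + real CARD('n) * (mu_max N + CC N \<alpha> * phi_max N)\<^sup>2"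
    unfolding cost_eq data by simp
  \<comment> \<open>The time-sharing rule gives the whole slot to the phase with the smaller
    value.\<close>
  moreover have "tau_e ?a * Fe + tau_d ?a * Fd = tau_f N * min Fe Fd"
    using E by (auto simp: Fe_def Fd_def gain_def min_def split: if_splits)
  moreover have "tau_f N * min Fe Fd \<le> cost N V ?q b"
  proof -
    have fb: "pow b \<in> powers N" "norm (bf b) = 1" "0 \<le> P_AP b" "P_AP b \<le> P_AP_max N"
        "0 \<le> tau_e b" "0 \<le> tau_d b" "tau_e b + tau_d b = tau_f N"
      using b by (auto simp: feasible_def)
    have "Fd \<le> data_cost N \<alpha> (U t \<omega>) (B t \<omega>) ?g (pow b)"
      using E fb(1) by (auto simp: is_arg_min_linorder Fd_def)
    moreover have "Fe \<le> P_AP b * (V - gain (bf b))"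
    proof -
      obtain v where v: "principal_eigenvector (energy_matrix N \<alpha> (U t \<omega>) (B t \<omega>) ?h) v" "norm v = 1"
          "bf ?a = (\<chi> i. cnj (v $ i))"
        using E by blast
      have "gain (bf b) \<le> gain (bf ?a)"
        using principal_eigenvector_energy_gain[OF v(1)[unfolded energy_matrix_prices] v(2) fb(2)]
        unfolding v(3)[symmetric] energy_gain_prices gain_def .
      then have "P_AP b * (V - gain (bf ?a)) \<le> P_AP b * (V - gain (bf b))"
        using fb by (intro mult_left_mono) auto
      moreover have "Fe \<le> P_AP b * (V - gain (bf ?a))"
      proof -
        have P: "P_AP ?a = (if V < gain (bf ?a) then P_AP_max N else 0)" using E by (simp add: gain_def)
        show ?thesis unfolding Fe_def P using fb by (auto intro: mult_right_mono_neg)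
      qed
      ultimately show ?thesis by linarith
    qed
    ultimately have "tau_e b * min Fe Fd + tau_d b * min Fe Fd
      \<le> tau_e b * (P_AP b * (V - gain (bf b))) + tau_d b * data_cost N \<alpha> (U t \<omega>) (B t \<omega>) ?g (pow b)"
      using fb by (intro add_mono mult_left_mono) auto
    also have "\<dots> \<le> cost N V ?q b"
      using cost_ge[of ?q b ?h N ?g V] b q_in_domain[OF \<omega>, of t]
      unfolding energy_gain_prices data_term_prices gain_def
      by (auto simp: feasible_def dual_domain_def split_beta)
    finally show ?thesis unfolding fb(7)[symmetric] by (simp add: distrib_right)
  qed
  ultimately show ?thesis by linarith
qed

lemma eecw_cost_le_opt:
  assumes \<omega>: "\<omega> \<in> space M"
  shows "cost N V (q t \<omega>) (act t \<omega>) \<le> opt_cost N V (q t \<omega>) (G t \<omega>, H t \<omega>)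
    + real CARD('n) * (mu_max N + CC N \<alpha> * phi_max N)\<^sup>2"
proof -
  have "cost N V (q t \<omega>) (act t \<omega>) - real CARD('n) * (mu_max N + CC N \<alpha> * phi_max N)\<^sup>2
    \<le> opt_cost N V (q t \<omega>) (G t \<omega>, H t \<omega>)"
    unfolding opt_cost_def
  proof (rule cINF_greatest[OF simple_idx_nonempty[OF network]])
    fix i :: "('s, 'l, 'm) simple_index" assume "i \<in> simple_idx N"
    from eecw_cost_le[OF \<omega> simple_idx_feasible[OF network this, of "(G t \<omega>, H t \<omega>)", simplified]]
    show "cost N V (q t \<omega>) (act t \<omega>) - real CARD('n) * (mu_max N + CC N \<alpha> * phi_max N)\<^sup>2
      \<le> cost N V (q t \<omega>) (simple_action N i (G t \<omega>, H t \<omega>))" by simp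
  qed
  then show ?thesis by linarith
qed

end

section \<open>Quadratic drift towards the attraction point\<close>

definition coords ::
    "('n::finite, 's::finite, 'l::finite) wpn \<Rightarrow> real \<Rightarrow> real ^ 's ^ 'n \<Rightarrow> real ^ 'n \<Rightarrow> (real ^ 's ^ 'n) \<times> (real ^ 'n)"
  where "coords N \<alpha> U B = (U, \<chi> n. ZZ N \<alpha> U B n)"

definition center ::
    "('n::finite, 's::finite, 'l::finite) wpn \<Rightarrow> real \<Rightarrow> (real ^ 's ^ 'n) \<times> (real ^ 'n) \<Rightarrow> (real ^ 's ^ 'n) \<times> (real ^ 'n)"
  where "center N \<alpha> y = (\<chi> n s. nu_star N \<alpha> y n s, \<chi> n. zeta_star N \<alpha> y n)"

lemma inner_vec_pair:
  fixes x y :: "(real ^ 's::finite ^ 'n::finite) \<times> (real ^ 'n)"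
  shows "inner x y = (\<Sum>n\<in>UNIV. (\<Sum>s\<in>UNIV. fst x $ n $ s * fst y $ n $ s) + snd x $ n * snd y $ n)"
  by (cases x, cases y) (simp add: inner_vec_def sum.distrib)

lemma norm_vec_le_sum: "norm (x :: 'a::real_normed_vector ^ 'n::finite) \<le> (\<Sum>i\<in>UNIV. norm (x $ i))"
  unfolding norm_vec_def by (rule L2_set_le_sum) simp

lemma norm_vec_pair_le:
  fixes x :: "(real ^ 's::finite ^ 'n::finite) \<times> (real ^ 'n)"
  assumes "\<And>n s. \<bar>fst x $ n $ s\<bar> \<le> a" "\<And>n. \<bar>snd x $ n\<bar> \<le> b"
  shows "norm x \<le> real CARD('n) * (real CARD('s) * a + b)"
proof -
  have "norm (fst x $ n) \<le> real CARD('s) * a" for n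
    using sum_mono[of UNIV "\<lambda>s. norm (fst x $ n $ s)" "\<lambda>_. a"] assms(1)
    by (intro order_trans[OF norm_vec_le_sum]) simp
  then have "norm (fst x) \<le> real CARD('n) * (real CARD('s) * a)"
    using sum_mono[of UNIV "\<lambda>n. norm (fst x $ n)" "\<lambda>_. real CARD('s) * a"]
    by (intro order_trans[OF norm_vec_le_sum]) simp
  moreover have "norm (snd x) \<le> real CARD('n) * b"
    using sum_mono[of UNIV "\<lambda>n. norm (snd x $ n)" "\<lambda>_. b"] assms(2)
    by (intro order_trans[OF norm_vec_le_sum]) simp
  moreover have "norm x \<le> norm (fst x) + norm (snd x)"
    using norm_Pair_le[of "fst x" "snd x"] by simp
  ultimately show ?thesis by (simp add: distrib_left)
qed

lemma vec_pair_nth_le: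
  fixes x :: "(real ^ 's::finite ^ 'n::finite) \<times> (real ^ 'n)"
  shows "\<bar>fst x $ n $ s\<bar> \<le> norm x" "\<bar>snd x $ n\<bar> \<le> norm x"
proof -
  have "\<bar>fst x $ n $ s\<bar> \<le> norm (fst x $ n)"
    using Finite_Cartesian_Product.norm_nth_le[of "fst x $ n" s] by simp
  also have "\<dots> \<le> norm (fst x)" by (rule Finite_Cartesian_Product.norm_nth_le)
  also have "\<dots> \<le> norm x" using norm_fst_le[of "fst x" "snd x"] by simp
  finally show "\<bar>fst x $ n $ s\<bar> \<le> norm x" .
  have "\<bar>snd x $ n\<bar> \<le> norm (snd x)"
    using Finite_Cartesian_Product.norm_nth_le[of "snd x" n] by simp
  also have "\<dots> \<le> norm x" using norm_snd_le[of "snd x" "fst x"] by simp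
  finally show "\<bar>snd x $ n\<bar> \<le> norm x" .
qed

text \<open>One storage loss for each node and one underflow loss \<open>2 * mu_max^2\<close> for
  each queue.\<close>

definition drift_const :: "('n::finite, 's::finite, 'l::finite) wpn \<Rightarrow> real \<Rightarrow> real"
  where "drift_const N \<alpha> = real CARD('n) * (mu_max N + CC N \<alpha> * phi_max N)\<^sup>2
    + real CARD('n) * real CARD('s) * (2 * (mu_max N)\<^sup>2)"

text \<open>The last \<open>mu_max\<close> allows for a stored energy as low as
  \<open>- mu_max / C\<close>.\<close>

definition step_bound :: "('n::finite, 's::finite, 'l::finite) wpn \<Rightarrow> real \<Rightarrow> real"
  where "step_bound N \<alpha> = real CARD('n) * (real CARD('s) * mu_max N
    + (real CARD('s) * mu_max N + 2 * CC N \<alpha> * phi_max N + mu_max N))"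

text \<open>Bound for the inverse of the linear map from displacements in \<open>(U, Z)\<close> to
  displacements of the prices; it converts the growth constant \<open>K\<close> into a drift
  speed.\<close>

definition norm_ratio :: "('n::finite, 's::finite, 'l::finite) wpn \<Rightarrow> real \<Rightarrow> real"
  where "norm_ratio N \<alpha> = real CARD('n) * (real CARD('s) * (1 + 1 / CC N \<alpha>) + 1 / CC N \<alpha>)"

text \<open>One-slot sample, at channels and arrivals \<open>x\<close>, of the dual value at
  \<open>z\<close> minus that at \<open>y\<close>. The last sum restores the arrivals left out of
  \<open>cost\<close>.\<close>

definition dual_gap ::
    "('n, 's, 'l) wpn \<Rightarrow> real \<Rightarrow> (real ^ 's ^ 'n) \<times> (real ^ 'n) \<Rightarrow> (real ^ 's ^ 'n) \<times> (real ^ 'n)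
      \<Rightarrow> (complex ^ 'l::finite) \<times> (complex ^ 'm::finite ^ 'n::finite) \<times> (real ^ 's::finite ^ 'n) \<Rightarrow> real"
  where "dual_gap N V y z x = opt_cost N V z (fst x, fst (snd x)) - opt_cost N V y (fst x, fst (snd x))
    + (\<Sum>n\<in>UNIV. \<Sum>s\<in>UNIV. (fst z $ n $ s - fst y $ n $ s) * snd (snd x) $ n $ s)"

context eecw_process
begin

text \<open>A queue that empties has \<open>U < mu_max\<close> and sends over some active link. Its
  weight is at most \<open>Z + U\<close>, as the receiver's price is nonnegative, so
  \<open>C Z \<le> \<delta> (Z + U)\<close>. This is where the factor 2 in \<open>C\<close> acts:
  \<open>C \<ge> 2 \<delta>\<close> gives \<open>Z \<le> U\<close>, hence a price of at most
  \<open>2 * mu_max\<close>.\<close>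

lemma underflow_bound:
  fixes t :: nat
  assumes \<omega>: "\<omega> \<in> space M" and ns: "(n, s) \<notin> sinks N"
  defines "e \<equiv> max (U t \<omega> $ n $ s - mu_out N (act t \<omega>) n s) 0 - (U t \<omega> $ n $ s - mu_out N (act t \<omega>) n s)"
  shows "0 \<le> e" "price N \<alpha> (U t \<omega>) (B t \<omega>) n s * e \<le> 2 * (mu_max N)\<^sup>2"
proof -
  let ?a = "act t \<omega>" and ?u = "U t \<omega> $ n $ s"
  show "0 \<le> e" by (simp add: e_def)
  show "price N \<alpha> (U t \<omega>) (B t \<omega>) n s * e \<le> 2 * (mu_max N)\<^sup>2"
  proof (cases "?u < mu_out N ?a n s")
    case False
    then show ?thesis by (simp add: e_def)
  next
    case True
    have u: "0 \<le> ?u" by (rule U_nonneg[OF \<omega>])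
    have m: "mu_out N ?a n s \<le> mu_max N" by (rule act_bounds[OF \<omega>])
    have e: "e \<le> mu_max N" using True u m by (simp add: e_def)
    have "0 < (\<Sum>l\<in>out_links N n. tau_d ?a * rate ?a $ l $ s)"
      using True u by (simp add: mu_out_def sum_distrib_left)
    then obtain l where l: "l \<in> out_links N n" "0 < tau_d ?a * rate ?a $ l $ s"
      by (meson not_le sum_nonpos)
    have hl: "head N l = n" using l by (simp add: out_links_def)
    have "max_weight N \<alpha> (U t \<omega>) (B t \<omega>) l \<le> Z t \<omega> n + ?u"
      using active_link(1)[OF \<omega> l(2)] price_nonneg[OF \<omega>, of t "tail N l" s] ns
      by (simp add: link_weight_def hl price_def[of _ _ _ _ n])
    then have "CC N \<alpha> * Z t \<omega> n \<le> delta N * (Z t \<omega> n + ?u)"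
      using active_link(2)[OF \<omega> l(2)] delta_pos unfolding hl by (meson order_trans mult_left_mono less_imp_le)
    moreover have "2 * delta N * Z t \<omega> n \<le> CC N \<alpha> * Z t \<omega> n"
      by (intro mult_right_mono CC_ge Z_nonneg \<omega>)
    ultimately have "delta N * Z t \<omega> n \<le> delta N * ?u" by (simp add: algebra_simps)
    then have "Z t \<omega> n \<le> ?u" using delta_pos by simp
    then have "price N \<alpha> (U t \<omega>) (B t \<omega>) n s \<le> 2 * mu_max N"
      using ns True m by (simp add: price_def)
    then have "price N \<alpha> (U t \<omega>) (B t \<omega>) n s * e \<le> 2 * mu_max N * mu_max N"
      using e mu_max_nonneg by (intro mult_mono) (auto simp: e_def)
    then show ?thesis by (simp add: power2_eq_square)
  qed
qed

abbreviation "X y t \<omega> \<equiv> coords N \<alpha> (U t \<omega>) (B t \<omega>) - center N \<alpha> y"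

lemma X_components:
  "fst (X y t \<omega>) $ n $ s = U t \<omega> $ n $ s - nu_star N \<alpha> y n s"
  "snd (X y t \<omega>) $ n = Z t \<omega> n - zeta_star N \<alpha> y n"
  by (simp_all add: coords_def center_def)

text \<open>Collecting coefficients turns the inner product into the cost of the chosen action at
  the current prices minus its cost at \<open>y\<close>, plus arrivals and underflow. The underflow
  part multiplied by \<eta> has a favourable sign and is dropped.\<close>

lemma drift_inner:
  assumes \<omega>: "\<omega> \<in> space M" and y: "y \<in> dual_domain N"
  shows "inner (X y t \<omega>) (X y (Suc t) \<omega> - X y t \<omega>)
    \<le> dual_gap N V y (q t \<omega>) (G t \<omega>, H t \<omega>, A t \<omega>) + drift_const N \<alpha>"
proof -
  let ?a = "act t \<omega>"
  define \<eta> \<beta> where "\<eta> = fst y" and "\<beta> = snd y"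
  define dU where "dU n s = U (Suc t) \<omega> $ n $ s - U t \<omega> $ n $ s" for n s
  define p where "p n s = price N \<alpha> (U t \<omega>) (B t \<omega>) n s" for n s
  define dB where "dB n = phi_out N ?a n - stored ?a $ n" for n
  have y': "\<And>n s. 0 \<le> \<eta> $ n $ s" "\<And>n. 0 \<le> \<beta> $ n" "\<And>n s. (n, s) \<in> sinks N \<Longrightarrow> \<eta> $ n $ s = 0"
    using y by (auto simp: dual_domain_def \<eta>_def \<beta>_def)
  have dZ: "Z (Suc t) \<omega> n - Z t \<omega> n = (\<Sum>s\<in>UNIV. dU n s) + CC N \<alpha> * dB n" for n
    unfolding Z_Suc[OF \<omega>] dU_def dB_def by simp
  have flow: "(U t \<omega> $ n $ s - nu_star N \<alpha> y n s) * dU n s + (Z t \<omega> n - zeta_star N \<alpha> y n) * dU n s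
     \<le> (p n s - \<eta> $ n $ s) * (mu_in N 0 ?a n s - mu_out N ?a n s) + (p n s - \<eta> $ n $ s) * A t \<omega> $ n $ s + 2 * (mu_max N)\<^sup>2" for n s
  proof (cases "(n, s) \<in> sinks N")
    case True
    then show ?thesis using y' by (simp add: dU_def U_Suc[OF \<omega>] p_def price_def)
  next
    case False
    define e where "e = max (U t \<omega> $ n $ s - mu_out N ?a n s) 0 - (U t \<omega> $ n $ s - mu_out N ?a n s)"
    have e: "0 \<le> e" "p n s * e \<le> 2 * (mu_max N)\<^sup>2"
      using underflow_bound[OF \<omega> False, of t] unfolding e_def p_def by auto
    have d: "dU n s = mu_in N 0 ?a n s + A t \<omega> $ n $ s - mu_out N ?a n s + e"
      using False by (simp add: dU_def U_Suc[OF \<omega>] e_def mu_in_split[of N "A t \<omega>"])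
    have "(U t \<omega> $ n $ s - nu_star N \<alpha> y n s) + (Z t \<omega> n - zeta_star N \<alpha> y n) = p n s - \<eta> $ n $ s"
      using False by (simp add: nu_star_def zeta_star_def p_def price_def \<eta>_def)
    then have "(U t \<omega> $ n $ s - nu_star N \<alpha> y n s) * dU n s + (Z t \<omega> n - zeta_star N \<alpha> y n) * dU n s
      = (p n s - \<eta> $ n $ s) * dU n s" by (simp add: distrib_right[symmetric])
    also have "\<dots> = (p n s - \<eta> $ n $ s) * (mu_in N 0 ?a n s - mu_out N ?a n s)
        + (p n s - \<eta> $ n $ s) * A t \<omega> $ n $ s + p n s * e - \<eta> $ n $ s * e"
      unfolding d by (simp add: algebra_simps)
    finally show ?thesis using e mult_nonneg_nonneg[OF y'(1) e(1), of n s] by linarith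
  qed
  have "inner (X y t \<omega>) (X y (Suc t) \<omega> - X y t \<omega>) =
      (\<Sum>n\<in>UNIV. (\<Sum>s\<in>UNIV. (U t \<omega> $ n $ s - nu_star N \<alpha> y n s) * dU n s)
        + (Z t \<omega> n - zeta_star N \<alpha> y n) * ((\<Sum>s\<in>UNIV. dU n s) + CC N \<alpha> * dB n))"
    unfolding inner_vec_pair by (simp add: coords_def center_def dZ dU_def)
  also have "\<dots> = (\<Sum>n\<in>UNIV. (\<Sum>s\<in>UNIV. (U t \<omega> $ n $ s - nu_star N \<alpha> y n s) * dU n s
          + (Z t \<omega> n - zeta_star N \<alpha> y n) * dU n s)
        + (CC N \<alpha> * Z t \<omega> n - \<beta> $ n) * dB n)"
  proof (rule sum.cong[OF refl])
    fix n
    have \<zeta>: "CC N \<alpha> * Z t \<omega> n - \<beta> $ n = CC N \<alpha> * (Z t \<omega> n - zeta_star N \<alpha> y n)"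
      using CC_pos by (simp add: zeta_star_def \<beta>_def right_diff_distrib)
    have "(\<Sum>s\<in>UNIV. a s * dU n s) + z * ((\<Sum>s\<in>UNIV. dU n s) + c * b)
      = (\<Sum>s\<in>UNIV. a s * dU n s + z * dU n s) + c * z * b" for a z c b
      by (simp add: sum.distrib sum_distrib_left algebra_simps)
    then show "(\<Sum>s\<in>UNIV. (U t \<omega> $ n $ s - nu_star N \<alpha> y n s) * dU n s)
        + (Z t \<omega> n - zeta_star N \<alpha> y n) * ((\<Sum>s\<in>UNIV. dU n s) + CC N \<alpha> * dB n)
      = (\<Sum>s\<in>UNIV. (U t \<omega> $ n $ s - nu_star N \<alpha> y n s) * dU n s
          + (Z t \<omega> n - zeta_star N \<alpha> y n) * dU n s) + (CC N \<alpha> * Z t \<omega> n - \<beta> $ n) * dB n"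
      unfolding \<zeta> .
  qed
  also have "\<dots> \<le> (\<Sum>n\<in>UNIV. (\<Sum>s\<in>UNIV. (p n s - \<eta> $ n $ s) * (mu_in N 0 ?a n s - mu_out N ?a n s)
          + (p n s - \<eta> $ n $ s) * A t \<omega> $ n $ s + 2 * (mu_max N)\<^sup>2)
        + (CC N \<alpha> * Z t \<omega> n - \<beta> $ n) * dB n)"
    by (intro sum_mono add_right_mono flow)
  also have "\<dots> = cost N V (q t \<omega>) ?a - cost N V y ?a
      + (\<Sum>n\<in>UNIV. \<Sum>s\<in>UNIV. (p n s - \<eta> $ n $ s) * A t \<omega> $ n $ s)
      + real CARD('n) * real CARD('s) * (2 * (mu_max N)\<^sup>2)"
    by (simp add: cost_def prices_def \<eta>_def \<beta>_def p_def dB_def sum.distrib sum_subtractf left_diff_distrib)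
  finally have ub: "inner (X y t \<omega>) (X y (Suc t) \<omega> - X y t \<omega>)
      \<le> cost N V (q t \<omega>) ?a - cost N V y ?a
      + (\<Sum>n\<in>UNIV. \<Sum>s\<in>UNIV. (p n s - \<eta> $ n $ s) * A t \<omega> $ n $ s)
      + real CARD('n) * real CARD('s) * (2 * (mu_max N)\<^sup>2)" .
  have "cost N V (q t \<omega>) ?a \<le> opt_cost N V (q t \<omega>) (G t \<omega>, H t \<omega>)
    + real CARD('n) * (mu_max N + CC N \<alpha> * phi_max N)\<^sup>2"
    by (rule eecw_cost_le_opt[OF \<omega>])
  \<comment> \<open>At \<open>y\<close> the chosen action is merely one candidate, so its cost is at
    least the minimum.\<close>
  moreover have "opt_cost N V y (G t \<omega>, H t \<omega>) \<le> cost N V y ?a"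
    using y' by (intro opt_cost_le_cost \<omega> V act_feasible) (auto simp: \<beta>_def act_stored[OF \<omega>])
  ultimately show ?thesis using ub
    by (simp add: dual_gap_def drift_const_def p_def \<eta>_def prices_def)
qed

lemma X_step:
  assumes \<omega>: "\<omega> \<in> space M"
  shows "norm (X y (Suc t) \<omega> - X y t \<omega>) \<le> step_bound N \<alpha>"
  unfolding step_bound_def
proof (rule norm_vec_pair_le)
  fix n
  show "\<bar>fst (X y (Suc t) \<omega> - X y t \<omega>) $ n $ s\<bar> \<le> mu_max N" for s
    using U_step(3)[OF \<omega>, of t n s] by (simp add: coords_def)
  let ?S = "stored (act t \<omega>) $ n" and ?P = "phi_out N (act t \<omega>) n"
  \<comment> \<open>Stored energy is not known to be nonnegative here; \<open>Z \<ge> 0\<close>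
    still keeps it above \<open>- mu_max / C\<close>.\<close>
  have S: "CC N \<alpha> * ?S \<le> CC N \<alpha> * phi_max N" "- mu_max N \<le> CC N \<alpha> * ?S"
  proof -
    have "?S \<le> phi_max N" using act_bounds(4)[OF \<omega>, of t n] by (simp add: act_stored[OF \<omega>])
    then show "CC N \<alpha> * ?S \<le> CC N \<alpha> * phi_max N" using CC_pos by simp
    have "- mu_max N / CC N \<alpha> \<le> ?S"
    proof -
      have "- mu_max N / CC N \<alpha> \<le> 0" using mu_max_nonneg CC_pos by (simp add: field_simps)
      then have "- mu_max N / CC N \<alpha> \<le> E_rx (H t \<omega>) (act t \<omega>) n" using act_bounds(8)[OF \<omega>, of t n] by linarith
      moreover have "- mu_max N / CC N \<alpha> \<le> (Z t \<omega> n - mu_max N) / CC N \<alpha>"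
        using Z_nonneg[OF \<omega>, of t n] CC_pos by (intro divide_right_mono) auto
      ultimately show ?thesis by (simp add: act_stored[OF \<omega>])
    qed
    then show "- mu_max N \<le> CC N \<alpha> * ?S" using CC_pos by (simp add: field_simps)
  qed
  have P: "0 \<le> CC N \<alpha> * ?P" "CC N \<alpha> * ?P \<le> CC N \<alpha> * phi_max N"
    using act_bounds(3,7)[OF \<omega>, of t n] CC_pos by auto
  have "\<bar>\<Sum>s\<in>UNIV. U (Suc t) \<omega> $ n $ s - U t \<omega> $ n $ s\<bar> \<le> (\<Sum>s\<in>(UNIV::'s set). mu_max N)"
    by (intro order_trans[OF sum_abs] sum_mono U_step \<omega>)
  then have "\<bar>Z (Suc t) \<omega> n - Z t \<omega> n\<bar> \<le> real CARD('s) * mu_max N + 2 * CC N \<alpha> * phi_max N + mu_max N"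
    unfolding Z_Suc[OF \<omega>] right_diff_distrib using S P mu_max_nonneg by simp
  then show "\<bar>snd (X y (Suc t) \<omega> - X y t \<omega>) $ n\<bar> \<le> real CARD('s) * mu_max N + 2 * CC N \<alpha> * phi_max N + mu_max N"
    by (simp add: coords_def)
qed

text \<open>The map from state to prices is affine and sends the center to \<open>y\<close>; at
  sinks both the price and the multiplier vanish, and the backlog keeps its initial value.\<close>

lemma price_diff:
  assumes \<omega>: "\<omega> \<in> space M" and y: "y \<in> dual_domain N"
  shows "fst (q t \<omega> - y) $ n $ s = (if (n, s) \<in> sinks N then 0 else fst (X y t \<omega>) $ n $ s + snd (X y t \<omega>) $ n)"
    "snd (q t \<omega> - y) $ n = CC N \<alpha> * snd (X y t \<omega>) $ n"
    "(n, s) \<in> sinks N \<Longrightarrow> fst (X y t \<omega>) $ n $ s = 0"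
  using y CC_pos
  by (auto simp: coords_def center_def prices_def price_def nu_star_def zeta_star_def dual_domain_def
      U_sink[OF \<omega>] field_simps)

text \<open>The map of \<open>price_diff\<close> is inverted: \<open>Z\<close> is recovered by
  dividing by \<open>C\<close>, then the backlogs by subtraction. Growth of the dual function in the
  prices thus becomes growth in the distance.\<close>

lemma norm_X_le:
  assumes \<omega>: "\<omega> \<in> space M" and y: "y \<in> dual_domain N"
  shows "norm (X y t \<omega>) \<le> norm_ratio N \<alpha> * norm (q t \<omega> - y)"
proof -
  let ?r = "norm (q t \<omega> - y)"
  have z: "\<bar>snd (X y t \<omega>) $ n\<bar> \<le> ?r / CC N \<alpha>" for n
    using vec_pair_nth_le(2)[of "q t \<omega> - y" n]
    unfolding price_diff(2)[OF \<omega> y] abs_mult abs_of_pos[OF CC_pos] pos_le_divide_eq[OF CC_pos]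
    by (simp only: mult.commute)
  have "\<bar>fst (X y t \<omega>) $ n $ s\<bar> \<le> ?r + ?r / CC N \<alpha>" for n s
  proof (cases "(n, s) \<in> sinks N")
    case True
    then show ?thesis using price_diff(3)[OF \<omega> y True] CC_pos by simp
  next
    case False
    then show ?thesis using vec_pair_nth_le(1)[of "q t \<omega> - y" n s] z[of n] unfolding price_diff(1)[OF \<omega> y]
      by (simp split: if_splits)
  qed
  from norm_vec_pair_le[OF this z]
  show ?thesis by (simp add: norm_ratio_def algebra_simps add_divide_distrib)
qed

text \<open>The converse comparison keeps the prices bounded in a fixed slot, which makes the dual
  gap integrable.\<close>

lemma norm_price_diff_le:
  assumes \<omega>: "\<omega> \<in> space M" and y: "y \<in> dual_domain N"
  shows "norm (q t \<omega> - y) \<le> real CARD('n) * (real CARD('s) * 2 + CC N \<alpha>) * norm (X y t \<omega>)"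
proof -
  have "norm (q t \<omega> - y) \<le> real CARD('n) * (real CARD('s) * (2 * norm (X y t \<omega>)) + CC N \<alpha> * norm (X y t \<omega>))"
  proof (rule norm_vec_pair_le)
    fix n
    have z: "\<bar>snd (X y t \<omega>) $ n\<bar> \<le> norm (X y t \<omega>)" by (rule vec_pair_nth_le)
    show "\<bar>snd (q t \<omega> - y) $ n\<bar> \<le> CC N \<alpha> * norm (X y t \<omega>)"
      unfolding price_diff(2)[OF \<omega> y] abs_mult abs_of_pos[OF CC_pos] by (rule mult_left_mono[OF z]) (use CC_pos in simp)
    show "\<bar>fst (q t \<omega> - y) $ n $ s\<bar> \<le> 2 * norm (X y t \<omega>)" for s
      unfolding price_diff(1)[OF \<omega> y] using z vec_pair_nth_le(1)[of "X y t \<omega>" n s] by auto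
  qed
  then show ?thesis by (simp add: algebra_simps)
qed

end

section \<open>Independence of state and slot\<close>

lemma exp_le_quadratic:
  fixes x :: real
  assumes "\<bar>x\<bar> \<le> 1"
  shows "exp x \<le> 1 + x + x\<^sup>2"
proof (cases "0 \<le> x")
  case True
  then show ?thesis using assms by (intro exp_bound) auto
next
  case False
  define z where "z = - x"
  have z: "0 < z" "z \<le> 1" using False assms by (auto simp: z_def)
  \<comment> \<open>The product equals \<open>1 + z^3\<close>.\<close>
  have "1 \<le> (1 + z) * (1 - z + z\<^sup>2)"
    using z by (simp add: algebra_simps power2_eq_square)
  also have "\<dots> \<le> exp z * (1 - z + z\<^sup>2)"
    using z exp_ge_add_one_self[of z] by (intro mult_right_mono) auto
  finally have "exp (- z) \<le> 1 - z + z\<^sup>2"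
    by (simp add: exp_minus field_simps)
  then show ?thesis by (simp add: z_def)
qed

text \<open>Independence identifies the joint law with the product law on rectangles, and Fubini
  applies. This replaces conditioning on the state: the state is frozen while the slot is
  averaged.\<close>

lemma (in prob_space) expectation_indep_pair:
  fixes f :: "'b \<times> 'c \<Rightarrow> real"
  assumes X: "X \<in> measurable M S" and Y: "Y \<in> measurable M T"
    and ind: "indep_set {X -` C \<inter> space M | C. C \<in> sets S} {Y -` D \<inter> space M | D. D \<in> sets T}"
    and f: "f \<in> borel_measurable (S \<Otimes>\<^sub>M T)"
    and int: "integrable M (\<lambda>\<omega>. f (X \<omega>, Y \<omega>))"
  shows "(\<integral>\<omega>. f (X \<omega>, Y \<omega>) \<partial>M) = (\<integral>\<omega>. (\<integral>\<omega>'. f (X \<omega>, Y \<omega>') \<partial>M) \<partial>M)"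
    "integrable M (\<lambda>\<omega>. \<integral>\<omega>'. f (X \<omega>, Y \<omega>') \<partial>M)"
proof -
  interpret P: prob_space "distr M S X" by (rule prob_space_distr[OF X])
  interpret Q: prob_space "distr M T Y" by (rule prob_space_distr[OF Y])
  interpret PQ: pair_prob_space "distr M S X" "distr M T Y" ..
  have XY: "(\<lambda>\<omega>. (X \<omega>, Y \<omega>)) \<in> measurable M (S \<Otimes>\<^sub>M T)" using X Y by (rule measurable_Pair)
  have eq: "distr M S X \<Otimes>\<^sub>M distr M T Y = distr M (S \<Otimes>\<^sub>M T) (\<lambda>\<omega>. (X \<omega>, Y \<omega>))"
  proof (rule pair_measure_eqI)
    fix C D assume "C \<in> sets (distr M S X)" "D \<in> sets (distr M T Y)"
    then have CD: "C \<in> sets S" "D \<in> sets T" by auto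
    have "(\<lambda>\<omega>. (X \<omega>, Y \<omega>)) -` (C \<times> D) \<inter> space M = (X -` C \<inter> space M) \<inter> (Y -` D \<inter> space M)" by auto
    moreover have "prob ((X -` C \<inter> space M) \<inter> (Y -` D \<inter> space M)) = prob (X -` C \<inter> space M) * prob (Y -` D \<inter> space M)"
      by (rule indep_setD[OF ind]) (use CD in auto)
    ultimately show "emeasure (distr M S X) C * emeasure (distr M T Y) D
        = emeasure (distr M (S \<Otimes>\<^sub>M T) (\<lambda>\<omega>. (X \<omega>, Y \<omega>))) (C \<times> D)"
      using CD by (simp add: emeasure_distr[OF X] emeasure_distr[OF Y] emeasure_distr[OF XY]
          emeasure_eq_measure ennreal_mult[symmetric])
  qed (auto intro: P.sigma_finite_measure_axioms Q.sigma_finite_measure_axioms)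
  have fPQ: "integrable (distr M S X \<Otimes>\<^sub>M distr M T Y) f"
    unfolding eq by (subst integrable_distr_eq[OF XY f]) (rule int)
  have inner: "(\<integral>y. f (x, y) \<partial>distr M T Y) = (\<integral>\<omega>'. f (x, Y \<omega>') \<partial>M)" if "x \<in> space S" for x
    by (rule integral_distr[OF Y]) (rule measurable_compose[OF measurable_Pair1'[OF that] f])
  have F: "integrable (distr M S X) (\<lambda>x. \<integral>y. f (x, y) \<partial>distr M T Y)"
    by (rule PQ.integrable_fst'[OF fPQ])
  then have Fm: "(\<lambda>x. \<integral>y. f (x, y) \<partial>distr M T Y) \<in> borel_measurable S" by simp
  have "integrable M (\<lambda>\<omega>. \<integral>y. f (X \<omega>, y) \<partial>distr M T Y)"
    using F by (subst (asm) integrable_distr_eq[OF X Fm])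
  then show "integrable M (\<lambda>\<omega>. \<integral>\<omega>'. f (X \<omega>, Y \<omega>') \<partial>M)"
    by (subst Bochner_Integration.integrable_cong[OF refl inner[symmetric]]) (use measurable_space[OF X] in auto)
  have "(\<integral>\<omega>. f (X \<omega>, Y \<omega>) \<partial>M) = integral\<^sup>L (distr M S X \<Otimes>\<^sub>M distr M T Y) f"
    unfolding eq by (rule integral_distr[OF XY f, symmetric])
  also have "\<dots> = (\<integral>x. (\<integral>y. f (x, y) \<partial>distr M T Y) \<partial>distr M S X)"
    by (rule PQ.integral_fst'[OF fPQ, symmetric])
  also have "\<dots> = (\<integral>\<omega>. (\<integral>y. f (X \<omega>, y) \<partial>distr M T Y) \<partial>M)"
    by (rule integral_distr[OF X Fm])
  also have "\<dots> = (\<integral>\<omega>. (\<integral>\<omega>'. f (X \<omega>, Y \<omega>') \<partial>M) \<partial>M)"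
    by (intro Bochner_Integration.integral_cong refl inner) (use measurable_space[OF X] in auto)
  finally show "(\<integral>\<omega>. f (X \<omega>, Y \<omega>) \<partial>M) = (\<integral>\<omega>. (\<integral>\<omega>'. f (X \<omega>, Y \<omega>') \<partial>M) \<partial>M)" .
qed

context eecw_process
begin

lemma causal_filtration:
  obtains F where "\<And>s t. s \<le> t \<Longrightarrow> subalgebra (F t) (F s)" "\<And>t. subalgebra M (F t)"
    "\<And>t. (\<lambda>\<omega>. (G t \<omega>, H t \<omega>, A t \<omega>)) \<in> borel_measurable (F (Suc t))"
    "\<And>t. indep_set (sets (F t)) (sets (vimage_algebra (space M) (\<lambda>\<omega>. (G t \<omega>, H t \<omega>, A t \<omega>)) borel))"
    "\<And>t. action_measurable (F (Suc t)) (act t)"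
proof -
  have "causal M G H A act" using run by (simp add: eecw_run_def)
  then obtain F where F0: "filtration (space M) F \<and> (\<forall>t. subalgebra M (F t) \<and>
    (\<lambda>\<omega>. (G t \<omega>, H t \<omega>, A t \<omega>)) \<in> borel_measurable (F (Suc t)) \<and>
    indep_set (sets (F t)) (sets (vimage_algebra (space M) (\<lambda>\<omega>. (G t \<omega>, H t \<omega>, A t \<omega>)) borel)) \<and>
    action_measurable (F (Suc t)) (act t))"
    unfolding causal_def by (elim exE)
  have F: "filtration (space M) F" "\<And>t. subalgebra M (F t)"
    "\<And>t. (\<lambda>\<omega>. (G t \<omega>, H t \<omega>, A t \<omega>)) \<in> borel_measurable (F (Suc t))"
    "\<And>t. indep_set (sets (F t)) (sets (vimage_algebra (space M) (\<lambda>\<omega>. (G t \<omega>, H t \<omega>, A t \<omega>)) borel))"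
    "\<And>t. action_measurable (F (Suc t)) (act t)"
    using F0 by simp_all
  have "subalgebra (F t) (F s)" if "s \<le> t" for s t
    using filtration.space_F[OF F(1)] filtration.sets_F_mono[OF F(1) that] by (auto simp: subalgebra_def)
  then show ?thesis by (rule that[OF _ F(2-5)])
qed

lemma state_measurable_step:
  assumes sp: "space L = space M"
    and U: "U t \<in> borel_measurable L" and B: "B t \<in> borel_measurable L"
    and x: "(\<lambda>\<omega>. (G t \<omega>, H t \<omega>, A t \<omega>)) \<in> borel_measurable L" and a: "action_measurable L (act t)"
  shows "U (Suc t) \<in> borel_measurable L" "B (Suc t) \<in> borel_measurable L"
proof -
  have A: "(\<lambda>\<omega>. A t \<omega>) \<in> borel_measurable L"
    using borel_measurable_components(2)[OF borel_measurable_components(2)[OF x]] by simp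
  note a' = a[unfolded action_measurable_def]
  show "U (Suc t) \<in> borel_measurable L"
  proof (intro borel_measurable_vecI)
    fix n s
    have "(\<lambda>\<omega>. if (n, s) \<in> sinks N then U t \<omega> $ n $ s
           else max (U t \<omega> $ n $ s - mu_out N (act t \<omega>) n s) 0 + mu_in N (A t \<omega>) (act t \<omega>) n s) \<in> borel_measurable L"
      using U A a' unfolding mu_in_def mu_out_def
      by (cases "(n, s) \<in> sinks N")
        (auto intro!: borel_measurable_add borel_measurable_diff borel_measurable_times borel_measurable_sum
          borel_measurable_max borel_measurable_vec_nth)
    then show "(\<lambda>\<omega>. U (Suc t) \<omega> $ n $ s) \<in> borel_measurable L"
      by (rule measurable_cong[THEN iffD1, rotated]) (simp add: U_Suc sp)
  qed
  show "B (Suc t) \<in> borel_measurable L"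
  proof (intro borel_measurable_vecI)
    fix n
    have "(\<lambda>\<omega>. B t \<omega> $ n - phi_out N (act t \<omega>) n + stored (act t \<omega>) $ n) \<in> borel_measurable L"
      using B a' unfolding phi_out_def
      by (auto intro!: borel_measurable_add borel_measurable_diff borel_measurable_times borel_measurable_sum
          borel_measurable_vec_nth)
    then show "(\<lambda>\<omega>. B (Suc t) \<omega> $ n) \<in> borel_measurable L"
      by (rule measurable_cong[THEN iffD1, rotated]) (simp add: B_Suc sp)
  qed
qed

lemma state_adapted:
  assumes F: "\<And>s t. s \<le> t \<Longrightarrow> subalgebra (F t) (F s)" "\<And>t. subalgebra M (F t)"
    "\<And>t. (\<lambda>\<omega>. (G t \<omega>, H t \<omega>, A t \<omega>)) \<in> borel_measurable (F (Suc t))"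
    "\<And>t. action_measurable (F (Suc t)) (act t)"
  shows "U t \<in> borel_measurable (F t) \<and> B t \<in> borel_measurable (F t)"
proof (induction t)
  case 0
  have sp: "space (F 0) = space M" using F(2) by (simp add: subalgebra_def)
  have "U 0 \<in> borel_measurable (F 0) \<longleftrightarrow> (\<lambda>\<omega>. (\<chi> n s. U_init N \<alpha>) :: real ^ 's ^ 'n) \<in> borel_measurable (F 0)"
    by (rule measurable_cong) (simp add: sp vec_eq_iff U_init)
  moreover have "B 0 \<in> borel_measurable (F 0) \<longleftrightarrow> (\<lambda>\<omega>. 0 :: real ^ 'n) \<in> borel_measurable (F 0)"
    by (rule measurable_cong) (simp add: sp vec_eq_iff B_init)
  ultimately show ?case by simp
next
  case (Suc t)
  then have "U t \<in> borel_measurable (F (Suc t))" "B t \<in> borel_measurable (F (Suc t))"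
    using measurable_from_subalg[OF F(1)[of t "Suc t"]] by auto
  moreover have "space (F (Suc t)) = space M" using F(2) by (simp add: subalgebra_def)
  ultimately show ?case using state_measurable_step F(3,4) by blast
qed

text \<open>The state of slot \<open>t\<close> is built from slots before \<open>t\<close>, hence
  measurable with respect to \<open>F t\<close>, and causality makes \<open>F t\<close> independent
  of slot \<open>t\<close>.\<close>

lemma state_measurable: "(\<lambda>\<omega>. (U t \<omega>, B t \<omega>)) \<in> borel_measurable M"
  and state_indep: "indep_set {(\<lambda>\<omega>. (U t \<omega>, B t \<omega>)) -` C \<inter> space M | C. C \<in> sets borel}
     {(\<lambda>\<omega>. (G t \<omega>, H t \<omega>, A t \<omega>)) -` D \<inter> space M | D. D \<in> sets borel}"
proof -
  obtain F where F: "\<And>s t. s \<le> t \<Longrightarrow> subalgebra (F t) (F s)" "\<And>t. subalgebra M (F t)"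
    "\<And>t. (\<lambda>\<omega>. (G t \<omega>, H t \<omega>, A t \<omega>)) \<in> borel_measurable (F (Suc t))"
    "\<And>t. indep_set (sets (F t)) (sets (vimage_algebra (space M) (\<lambda>\<omega>. (G t \<omega>, H t \<omega>, A t \<omega>)) borel))"
    "\<And>t. action_measurable (F (Suc t)) (act t)"
    by (rule causal_filtration) blast
  let ?Q = "\<lambda>\<omega>. (U t \<omega>, B t \<omega>)" and ?x = "\<lambda>\<omega>. (G t \<omega>, H t \<omega>, A t \<omega>)"
  have Q: "?Q \<in> borel_measurable (F t)"
    using state_adapted[of F t, OF F(1,2,3,5)] by (intro borel_measurable_Pair) auto
  then show "?Q \<in> borel_measurable M" by (rule measurable_from_subalg[OF F(2)])
  have sp: "space (F t) = space M" using F(2) by (simp add: subalgebra_def)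
  have 1: "{?Q -` C \<inter> space M | C. C \<in> sets borel} \<subseteq> sets (F t)"
    using measurable_sets[OF Q] unfolding sp by auto
  have 2: "{?x -` D \<inter> space M | D. D \<in> sets borel} \<subseteq> sets (vimage_algebra (space M) ?x borel)"
    by (auto intro: in_vimage_algebra)
  show "indep_set {?Q -` C \<inter> space M | C. C \<in> sets borel} {?x -` D \<inter> space M | D. D \<in> sets borel}"
    using F(4)[of t] unfolding indep_set_def
    by (rule indep_sets_mono_sets) (use 1 2 in \<open>auto split: bool.split\<close>)
qed

lemma ZZ_measurable:
  assumes "u \<in> borel_measurable L" "b \<in> borel_measurable L"
  shows "(\<lambda>\<omega>. ZZ N \<alpha> (u \<omega>) (b \<omega>) n) \<in> borel_measurable L"
  unfolding ZZ_def using assms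
  by (intro borel_measurable_diff borel_measurable_sum borel_measurable_times borel_measurable_vec_nth) auto

lemma prices_measurable:
  assumes "u \<in> borel_measurable L" "b \<in> borel_measurable L"
  shows "(\<lambda>\<omega>. prices N \<alpha> (u \<omega>) (b \<omega>)) \<in> borel_measurable L"
proof -
  note Z = ZZ_measurable[OF assms]
  have "(\<lambda>\<omega>. price N \<alpha> (u \<omega>) (b \<omega>) n s) \<in> borel_measurable L" for n s
    unfolding price_def using assms Z
    by (cases "(n, s) \<in> sinks N") (auto intro!: borel_measurable_add borel_measurable_vec_nth)
  then show ?thesis unfolding prices_def using Z
    by (intro borel_measurable_Pair borel_measurable_vecI) (auto intro!: borel_measurable_times)
qed

lemma coords_measurable:
  assumes "u \<in> borel_measurable L" "b \<in> borel_measurable L"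
  shows "(\<lambda>\<omega>. coords N \<alpha> (u \<omega>) (b \<omega>)) \<in> borel_measurable L"
  unfolding coords_def using assms ZZ_measurable
  by (intro borel_measurable_Pair borel_measurable_vecI) (auto intro: borel_measurable_vec_nth)

lemma X_measurable: "(\<lambda>\<omega>. X y t \<omega>) \<in> borel_measurable M"
  using borel_measurable_components[OF state_measurable[of t]]
  by (intro borel_measurable_diff coords_measurable borel_measurable_const) simp_all

lemma norm_X_measurable: "(\<lambda>\<omega>. norm (X y t \<omega>)) \<in> borel_measurable M"
  by (rule measurable_compose[OF X_measurable]) simp

lemma dual_gap_measurable:
  assumes "z \<in> borel_measurable L" "x \<in> borel_measurable L"
  shows "(\<lambda>\<omega>. dual_gap N V y (z \<omega>) (x \<omega> :: (complex ^ 'l) \<times> (complex ^ 'm ^ 'n) \<times> (real ^ 's ^ 'n))) \<in> borel_measurable L"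
  unfolding dual_gap_def using assms
  by (intro borel_measurable_add borel_measurable_diff borel_measurable_sum borel_measurable_times
      opt_cost_measurable network borel_measurable_Pair borel_measurable_vec_nth borel_measurable_components)
    auto

text \<open>The dual function is an expectation over slot 0; identical distribution of the slots
  carries it to slot \<open>t\<close>.\<close>

lemma dual_gap_mean:
  assumes z: "z \<in> dual_domain N" and y: "y \<in> dual_domain N"
  shows "(\<integral>\<omega>. dual_gap N V y z (G t \<omega>, H t \<omega>, A t \<omega>) \<partial>M) = dual_fun N M G H A V z - dual_fun N M G H A V y"
proof -
  have snd: "0 \<le> snd z $ n" "0 \<le> snd y $ n" for n using z y by (auto simp: dual_domain_def)
  have m: "(dual_gap N V y z :: (complex ^ 'l) \<times> (complex ^ 'm ^ 'n) \<times> (real ^ 's ^ 'n) \<Rightarrow> real) \<in> borel_measurable borel"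
    using dual_gap_measurable[of "\<lambda>_. z" borel "\<lambda>x. x"] by simp
  have "(\<integral>\<omega>. dual_gap N V y z (G t \<omega>, H t \<omega>, A t \<omega>) \<partial>M)
      = integral\<^sup>L (distr M borel (\<lambda>\<omega>. (G t \<omega>, H t \<omega>, A t \<omega>))) (dual_gap N V y z)"
    by (rule integral_distr[OF slot_rv m, symmetric])
  also have "distr M borel (\<lambda>\<omega>. (G t \<omega>, H t \<omega>, A t \<omega>)) = distr M borel (\<lambda>\<omega>. (G 0 \<omega>, H 0 \<omega>, A 0 \<omega>))"
    using slots unfolding slot_process_def by blast
  also have "integral\<^sup>L \<dots> (dual_gap N V y z) = (\<integral>\<omega>. dual_gap N V y z (G 0 \<omega>, H 0 \<omega>, A 0 \<omega>) \<partial>M)"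
    by (rule integral_distr[OF slot_rv m])
  also have "\<dots> = (\<integral>\<omega>. opt_cost N V z (G 0 \<omega>, H 0 \<omega>) \<partial>M) - (\<integral>\<omega>. opt_cost N V y (G 0 \<omega>, H 0 \<omega>) \<partial>M)
      + (\<Sum>n\<in>UNIV. \<Sum>s\<in>UNIV. (fst z $ n $ s - fst y $ n $ s) * lambda N n s)"
    unfolding dual_gap_def using A_integrable opt_cost_integrable[OF V]
    by (simp add: A_mean Bochner_Integration.integral_sum)
  also have "\<dots> = dual_fun N M G H A V z - dual_fun N M G H A V y"
    using dual_fun_eq[OF V snd(1)] dual_fun_eq[OF V snd(2)]
    by (simp add: mean_arrival_cost_def left_diff_distrib sum_subtractf)
  finally show ?thesis .
qed

text \<open>Constant start and bounded increments give a bound for each fixed \<open>t\<close>. It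
  grows with \<open>t\<close> and is used for boundedness and integrability alone.\<close>

lemma X_bounded:
  obtains L where "\<And>\<omega>. \<omega> \<in> space M \<Longrightarrow> norm (X y t \<omega>) \<le> L"
proof -
  have "\<exists>L. \<forall>\<omega>\<in>space M. norm (X y t \<omega>) \<le> L"
  proof (induction t)
    case 0
    have "X y 0 \<omega> = (\<chi> n s. U_init N \<alpha>, \<chi> n. real CARD('s) * U_init N \<alpha>) - center N \<alpha> y" if "\<omega> \<in> space M" for \<omega>
      using that by (simp add: coords_def ZZ_def U_init B_init vec_eq_iff prod_eq_iff)
    then show ?case by auto
  next
    case (Suc t)
    then obtain L where L: "\<And>\<omega>. \<omega> \<in> space M \<Longrightarrow> norm (X y t \<omega>) \<le> L" by blast
    have "norm (X y (Suc t) \<omega>) \<le> L + step_bound N \<alpha>" if "\<omega> \<in> space M" for \<omega>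
      using L[OF that] X_step[OF that, of t y] norm_triangle_sub[of "X y (Suc t) \<omega>" "X y t \<omega>"] by linarith
    then show ?case by blast
  qed
  with that show ?thesis by blast
qed

lemma dual_gap_bounded:
  assumes y: "y \<in> dual_domain N"
  obtains L where "\<And>\<omega>. \<omega> \<in> space M \<Longrightarrow> \<bar>dual_gap N V y (q t \<omega>) (G t \<omega>, H t \<omega>, A t \<omega>)\<bar> \<le> L"
proof -
  obtain L0 where L0: "\<And>\<omega>. \<omega> \<in> space M \<Longrightarrow> norm (X y t \<omega>) \<le> L0" using X_bounded by blast
  define L1 where "L1 = real CARD('n) * (real CARD('s) * 2 + CC N \<alpha>) * L0"
  have L1: "norm (q t \<omega> - y) \<le> L1" if "\<omega> \<in> space M" for \<omega>
    unfolding L1_def using CC_pos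
    by (intro order_trans[OF norm_price_diff_le[OF that y]] mult_left_mono L0 that) auto
  define L2 where "L2 = L1 + norm y"
  have L2: "norm (q t \<omega>) \<le> L2" if "\<omega> \<in> space M" for \<omega>
    using L1[OF that] norm_triangle_sub[of "q t \<omega>" y] unfolding L2_def by linarith
  define L3 where "L3 = V * (tau_f N * P_AP_max N) + (\<Sum>n\<in>(UNIV::'n set). \<Sum>s\<in>(UNIV::'s set). L2 * mu_max N)
     + (\<Sum>n\<in>(UNIV::'n set). L2 * phi_max N)"
  have L3: "cost_bound V (q t \<omega>) \<le> L3" if "\<omega> \<in> space M" for \<omega>
    unfolding cost_bound_def L3_def
    using vec_pair_nth_le[of "q t \<omega>"] L2[OF that] mu_max_nonneg phi_max_nonneg
    by (intro add_mono sum_mono mult_right_mono order_refl) (auto intro: order_trans)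
  define L where "L = L3 + cost_bound V y + (\<Sum>n\<in>(UNIV::'n set). \<Sum>s\<in>(UNIV::'s set). L1 * A_max N)"
  have "\<bar>dual_gap N V y (q t \<omega>) (G t \<omega>, H t \<omega>, A t \<omega>)\<bar> \<le> L" if \<omega>: "\<omega> \<in> space M" for \<omega>
  proof -
    have "\<bar>(fst (q t \<omega>) $ n $ s - fst y $ n $ s) * A t \<omega> $ n $ s\<bar> \<le> L1 * A_max N" for n s
    proof -
      have "\<bar>fst (q t \<omega>) $ n $ s - fst y $ n $ s\<bar> \<le> L1"
        using vec_pair_nth_le(1)[of "q t \<omega> - y" n s] L1[OF \<omega>] by simp
      then show ?thesis unfolding abs_mult
        using A_nonneg[OF \<omega>, of t n s] A_le[OF \<omega>, of t n s] by (intro mult_mono) auto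
    qed
    then have "\<bar>\<Sum>n\<in>UNIV. \<Sum>s\<in>UNIV. (fst (q t \<omega>) $ n $ s - fst y $ n $ s) * A t \<omega> $ n $ s\<bar>
        \<le> (\<Sum>n\<in>(UNIV::'n set). \<Sum>s\<in>(UNIV::'s set). L1 * A_max N)"
      by (intro order_trans[OF sum_abs sum_mono] order_trans[OF sum_abs sum_mono])
    then show ?thesis
      using abs_opt_cost_le[OF \<omega> V, of "q t \<omega>" t] abs_opt_cost_le[OF \<omega> V, of y t] L3[OF \<omega>]
      unfolding dual_gap_def L_def by simp
  qed
  with that show ?thesis by blast
qed

text \<open>With the state frozen, averaging turns the gap into a difference of dual values, which
  the growth hypothesis bounds by \<open>- K\<close> times the distance of the prices to
  \<open>y\<close>. An arbitrary nonnegative weight of the state stands in for a conditional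
  expectation.\<close>

lemma expected_drift:
  assumes y: "y \<in> dual_domain N"
    and polyhedral: "\<And>y'. y' \<in> dual_domain N \<Longrightarrow> dual_fun N M G H A V y - dual_fun N M G H A V y' \<ge> K * norm (y - y')"
    and K: "0 \<le> K"
    and w: "w \<in> borel_measurable borel" "\<And>u. 0 \<le> w u" "\<And>\<omega>. \<omega> \<in> space M \<Longrightarrow> w (U t \<omega>, B t \<omega>) \<le> W"
  shows "integrable M (\<lambda>\<omega>. w (U t \<omega>, B t \<omega>) * dual_gap N V y (q t \<omega>) (G t \<omega>, H t \<omega>, A t \<omega>))"
    and "norm_ratio N \<alpha> * (\<integral>\<omega>. w (U t \<omega>, B t \<omega>) * dual_gap N V y (q t \<omega>) (G t \<omega>, H t \<omega>, A t \<omega>) \<partial>M)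
      \<le> - K * (\<integral>\<omega>. w (U t \<omega>, B t \<omega>) * norm (X y t \<omega>) \<partial>M)"
proof -
  define Q where "Q \<omega> = (U t \<omega>, B t \<omega>)" for \<omega>
  define x where "x \<omega> = (G t \<omega>, H t \<omega>, A t \<omega>)" for \<omega>
  define f where "f = (\<lambda>(u, x :: (complex ^ 'l) \<times> (complex ^ 'm ^ 'n) \<times> (real ^ 's ^ 'n)).
      w u * dual_gap N V y (prices N \<alpha> (fst u) (snd u)) x)"
  have fQ: "f (Q \<omega>, x \<omega>) = w (Q \<omega>) * dual_gap N V y (q t \<omega>) (x \<omega>)" for \<omega>
    by (simp add: f_def Q_def)
  have Q: "Q \<in> borel_measurable M" and x: "x \<in> borel_measurable M"
    unfolding Q_def x_def by (rule state_measurable, rule slot_rv)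
  have ind: "indep_set {Q -` C \<inter> space M | C. C \<in> sets borel} {x -` D \<inter> space M | D. D \<in> sets borel}"
    unfolding Q_def x_def by (rule state_indep)
  have f: "f \<in> borel_measurable (borel \<Otimes>\<^sub>M borel)"
    unfolding f_def split_beta
    by (intro borel_measurable_times dual_gap_measurable prices_measurable borel_measurable_components
        measurable_compose[OF measurable_fst w(1)] measurable_fst measurable_snd)
  have fxm: "(\<lambda>\<omega>. f (Q \<omega>, x \<omega>)) \<in> borel_measurable M"
    using Q x by (intro measurable_compose[OF measurable_Pair f])
  obtain L where L: "\<And>\<omega>. \<omega> \<in> space M \<Longrightarrow> \<bar>dual_gap N V y (q t \<omega>) (x \<omega>)\<bar> \<le> L"
    unfolding x_def by (rule dual_gap_bounded[OF y]) blast
  have int: "integrable M (\<lambda>\<omega>. f (Q \<omega>, x \<omega>))"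
  proof (rule integrable_const_bound[where B = "W * L", OF AE_I2 fxm])
    fix \<omega> assume \<omega>: "\<omega> \<in> space M"
    have "0 \<le> W" using w(2) w(3)[OF \<omega>] order_trans by blast
    then show "norm (f (Q \<omega>, x \<omega>)) \<le> W * L"
      unfolding fQ using w(2)[of "Q \<omega>"] w(3)[OF \<omega>] L[OF \<omega>] by (simp add: abs_mult Q_def mult_mono)
  qed
  then show "integrable M (\<lambda>\<omega>. w (U t \<omega>, B t \<omega>) * dual_gap N V y (q t \<omega>) (G t \<omega>, H t \<omega>, A t \<omega>))"
    unfolding fQ unfolding Q_def x_def .
  have wX: "integrable M (\<lambda>\<omega>. w (Q \<omega>) * norm (X y t \<omega>))"
  proof -
    obtain L where L: "\<And>\<omega>. \<omega> \<in> space M \<Longrightarrow> norm (X y t \<omega>) \<le> L" using X_bounded by blast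
    have wQ: "(\<lambda>\<omega>. w (Q \<omega>)) \<in> borel_measurable M"
      unfolding Q_def by (rule measurable_compose[OF state_measurable w(1)])
    show ?thesis
    proof (rule integrable_const_bound[where B = "W * L", OF AE_I2])
      fix \<omega> assume \<omega>: "\<omega> \<in> space M"
      have "0 \<le> W" using w(2) w(3)[OF \<omega>] order_trans by blast
      then show "norm (w (Q \<omega>) * norm (X y t \<omega>)) \<le> W * L"
        using w(2)[of "Q \<omega>"] w(3)[OF \<omega>] L[OF \<omega>] by (simp add: abs_mult Q_def mult_mono)
    qed (intro borel_measurable_times wQ norm_X_measurable)
  qed
  have r: "0 \<le> norm_ratio N \<alpha>" using CC_pos by (simp add: norm_ratio_def)
  have inner: "norm_ratio N \<alpha> * (\<integral>\<omega>'. f (Q \<omega>, x \<omega>') \<partial>M) \<le> - K * (w (Q \<omega>) * norm (X y t \<omega>))"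
    if \<omega>: "\<omega> \<in> space M" for \<omega>
  proof -
    have "(\<integral>\<omega>'. f (Q \<omega>, x \<omega>') \<partial>M) = w (Q \<omega>) * (dual_fun N M G H A V (q t \<omega>) - dual_fun N M G H A V y)"
      unfolding dual_gap_mean[OF q_in_domain[OF \<omega>, of t] y, of t, symmetric] by (simp add: f_def Q_def x_def)
    also have "\<dots> \<le> w (Q \<omega>) * (- (K * norm (q t \<omega> - y)))"
      using polyhedral[OF q_in_domain[OF \<omega>], of t] w(2)
      by (intro mult_left_mono) (auto simp: norm_minus_commute)
    finally have "norm_ratio N \<alpha> * (\<integral>\<omega>'. f (Q \<omega>, x \<omega>') \<partial>M)
        \<le> norm_ratio N \<alpha> * (w (Q \<omega>) * (- (K * norm (q t \<omega> - y))))"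
      by (rule mult_left_mono[OF _ r])
    also have "\<dots> = - (K * w (Q \<omega>)) * (norm_ratio N \<alpha> * norm (q t \<omega> - y))" by simp
    also have "\<dots> \<le> - (K * w (Q \<omega>)) * norm (X y t \<omega>)"
      using K w(2) by (intro mult_left_mono_neg norm_X_le \<omega> y) auto
    finally show ?thesis by simp
  qed
  have "norm_ratio N \<alpha> * (\<integral>\<omega>. f (Q \<omega>, x \<omega>) \<partial>M) = (\<integral>\<omega>. norm_ratio N \<alpha> * (\<integral>\<omega>'. f (Q \<omega>, x \<omega>') \<partial>M) \<partial>M)"
    unfolding expectation_indep_pair(1)[OF Q x ind f int] by simp
  also have "\<dots> \<le> (\<integral>\<omega>. - K * (w (Q \<omega>) * norm (X y t \<omega>)) \<partial>M)"
    using wX expectation_indep_pair(2)[OF Q x ind f int] inner by (intro integral_mono) auto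
  also have "\<dots> = - K * (\<integral>\<omega>. w (Q \<omega>) * norm (X y t \<omega>) \<partial>M)" by simp
  finally show "norm_ratio N \<alpha> * (\<integral>\<omega>. w (U t \<omega>, B t \<omega>) * dual_gap N V y (q t \<omega>) (G t \<omega>, H t \<omega>, A t \<omega>) \<partial>M)
      \<le> - K * (\<integral>\<omega>. w (U t \<omega>, B t \<omega>) * norm (X y t \<omega>) \<partial>M)"
    unfolding fQ unfolding Q_def x_def .
qed

end

section \<open>Exponential tails\<close>

text \<open>The geometric transients sum to at most \<open>v / (1 - r)\<close>, so their mean over
  \<open>T\<close> slots vanishes.\<close>

lemma limsup_cesaro_le:
  fixes p :: "nat \<Rightarrow> real"
  assumes p: "\<And>t. p t \<le> u + v * r ^ t" and "0 \<le> r" "r < 1" "0 \<le> u" "0 \<le> v"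
  shows "limsup (\<lambda>T. ereal (1 / real T * (\<Sum>t<T. p t))) \<le> ereal u"
proof -
  have "1 / real T * (\<Sum>t<T. p t) \<le> u + v / (1 - r) * (1 / real T)" for T
  proof (cases "T = 0")
    \<comment> \<open>Division by zero gives 0, so for \<open>T = 0\<close> the claim is
      \<open>0 \<le> u\<close>.\<close>
    case True
    then show ?thesis using assms by simp
  next
    case False
    have "(\<Sum>t<T. p t) \<le> (\<Sum>t<T. u + v * r ^ t)" by (intro sum_mono p)
    also have "\<dots> = real T * u + v * (\<Sum>t<T. r ^ t)" by (simp add: sum.distrib sum_distrib_left)
    also have "(\<Sum>t<T. r ^ t) = (1 - r ^ T) / (1 - r)"
      using assms by (simp add: sum_gp_strict)
    also have "real T * u + v * ((1 - r ^ T) / (1 - r)) \<le> real T * u + v * (1 / (1 - r))"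
      using assms by (intro add_left_mono mult_left_mono divide_right_mono) auto
    finally have "(\<Sum>t<T. p t) \<le> real T * u + v * (1 / (1 - r))" .
    then have "1 / real T * (\<Sum>t<T. p t) \<le> 1 / real T * (real T * u + v * (1 / (1 - r)))"
      by (intro mult_left_mono) auto
    also have "\<dots> = u + v / (1 - r) * (1 / real T)" using False by (simp add: distrib_left)
    finally show ?thesis .
  qed
  then have "limsup (\<lambda>T. ereal (1 / real T * (\<Sum>t<T. p t)))
      \<le> limsup (\<lambda>T. ereal (u + v / (1 - r) * (1 / real T)))"
    by (intro Limsup_mono always_eventually) simp
  also have "(\<lambda>T. u + v / (1 - r) * (1 / real T)) \<longlonglongrightarrow> u + v / (1 - r) * 0"
    by (intro tendsto_intros lim_1_over_n)
  then have "limsup (\<lambda>T. ereal (u + v / (1 - r) * (1 / real T))) = ereal u"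
    by (intro lim_imp_Limsup) auto
  finally show ?thesis .
qed

context eecw_process
begin

lemma exp_norm_integrable:
  assumes "0 \<le> b"
  shows "integrable M (\<lambda>\<omega>. exp (b * norm (X y t \<omega>)))"
proof -
  obtain L where L: "\<And>\<omega>. \<omega> \<in> space M \<Longrightarrow> norm (X y t \<omega>) \<le> L" by (rule X_bounded) blast
  have m: "(\<lambda>\<omega>. exp (b * norm (X y t \<omega>))) \<in> borel_measurable M"
    by (rule measurable_compose[OF norm_X_measurable]) simp
  show ?thesis
    by (rule integrable_const_bound[where B = "exp (b * L)", OF AE_I2 m])
      (use L assms in \<open>auto intro: mult_left_mono\<close>)
qed

text \<open>
  \<open>K / norm_ratio\<close> is the drift speed of the distance \<open>Y\<close>. For \<open>Y \<ge> D\<close> the increment of \<open>Y\<close> is at most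
  \<open>(gap + c) / Y\<close>; the weight \<open>w = exp (b Y) / Y\<close> turns this into the dual gap integrated against a function
  of the state.
\<close>

lemma exp_moment_step:
  assumes y: "y \<in> dual_domain N"
    and polyhedral: "\<And>y'. y' \<in> dual_domain N \<Longrightarrow> dual_fun N M G H A V y - dual_fun N M G H A V y' \<ge> K * norm (y - y')"
    and \<rho>: "0 < \<rho>" "K = norm_ratio N \<alpha> * \<rho>" and \<kappa>: "0 < norm_ratio N \<alpha>"
    and d: "step_bound N \<alpha> \<le> d" "0 < d"
    and D: "0 < D" "2 * (drift_const N \<alpha> + d\<^sup>2 / 2) \<le> \<rho> * D"
    and b: "0 < b" "b * d \<le> 1" "4 * (b * d\<^sup>2) \<le> \<rho>" "b * \<rho> \<le> 1"
  shows "(\<integral>\<omega>. exp (b * norm (X y (Suc t) \<omega>)) \<partial>M)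
    \<le> (1 - b * \<rho> / 4) * (\<integral>\<omega>. exp (b * norm (X y t \<omega>)) \<partial>M) + exp (b * (D + d))"
proof -
  define Y where "Y t \<omega> = norm (X y t \<omega>)" for t \<omega>
  define gap where "gap \<omega> = dual_gap N V y (q t \<omega>) (G t \<omega>, H t \<omega>, A t \<omega>)" for \<omega>
  define c where "c = drift_const N \<alpha> + d\<^sup>2 / 2"
  \<comment> \<open>Cutting off below \<open>D\<close> keeps the factor \<open>1 / r\<close>
    bounded.\<close>
  define w0 where "w0 r = (if D \<le> r then exp (b * r) / r else 0)" for r :: real
  define w where "w u = w0 (norm (coords N \<alpha> (fst u) (snd u) - center N \<alpha> y))" for u
  have wY: "w (U t \<omega>, B t \<omega>) = w0 (Y t \<omega>)" for \<omega> by (simp add: w_def Y_def)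
  have Y0: "0 \<le> Y t \<omega>" for t \<omega> by (simp add: Y_def)
  have w0: "0 \<le> w0 r" for r using D by (simp add: w0_def)
  have w0r: "w0 r * r \<le> exp (b * r)" "0 \<le> w0 r * r" for r using D by (auto simp: w0_def)
  have step: "\<bar>Y (Suc t) \<omega> - Y t \<omega>\<bar> \<le> d" if "\<omega> \<in> space M" for \<omega>
    using X_step[OF that, of t y] norm_triangle_ineq3[of "X y (Suc t) \<omega>" "X y t \<omega>"] d unfolding Y_def by linarith
  \<comment> \<open>Below \<open>D\<close> the constant term suffices. Above it,
    \<open>b * \<rho> / 2\<close> comes from the drift constant and \<open>b * \<rho> / 4\<close>
    from the quadratic term of the exponential, together the fraction 3/4; the mean gap will
    contribute \<open>- b * \<rho>\<close>, leaving a contraction by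
    \<open>b * \<rho> / 4\<close>.\<close>
  have pointwise: "exp (b * Y (Suc t) \<omega>) \<le> exp (b * (D + d)) + (1 + b * \<rho> * 3 / 4) * (w0 (Y t \<omega>) * Y t \<omega>) + b * (w0 (Y t \<omega>) * gap \<omega>)"
    if \<omega>: "\<omega> \<in> space M" for \<omega>
  proof (cases "D \<le> Y t \<omega>")
    case False
    have "exp (b * Y (Suc t) \<omega>) \<le> exp (b * (D + d))"
      using step[OF \<omega>] False b by (simp add: mult_left_mono)
    then show ?thesis using False by (simp add: w0_def)
  next
    case True
    then have Yp: "0 < Y t \<omega>" using D by linarith
    define \<Delta> where "\<Delta> = Y (Suc t) \<omega> - Y t \<omega>"
    define e where "e = exp (b * Y t \<omega>)"
    have \<Delta>: "\<bar>\<Delta>\<bar> \<le> d" using step[OF \<omega>] by (simp add: \<Delta>_def)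
    have "Y t \<omega> * \<Delta> \<le> gap \<omega> + c"
    proof -
      have "(Y (Suc t) \<omega>)\<^sup>2 = (Y t \<omega>)\<^sup>2 + 2 * inner (X y t \<omega>) (X y (Suc t) \<omega> - X y t \<omega>)
          + (norm (X y (Suc t) \<omega> - X y t \<omega>))\<^sup>2"
        unfolding Y_def power2_norm_eq_inner
        by (simp add: inner_diff_left inner_diff_right inner_commute)
      also have "\<dots> \<le> (Y t \<omega>)\<^sup>2 + 2 * (gap \<omega> + drift_const N \<alpha>) + d\<^sup>2"
        unfolding gap_def using X_step[OF \<omega>, of t y] d
        by (intro add_mono mult_left_mono drift_inner \<omega> y power_mono order_refl) auto
      finally have "(Y t \<omega> + \<Delta>)\<^sup>2 \<le> (Y t \<omega>)\<^sup>2 + 2 * (gap \<omega> + c)"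
        by (simp add: \<Delta>_def c_def algebra_simps)
      then have "2 * (Y t \<omega> * \<Delta>) + \<Delta>\<^sup>2 \<le> 2 * (gap \<omega> + c)"
        by (simp add: power2_sum)
      from order_trans[OF _ this, of "2 * (Y t \<omega> * \<Delta>)"] show ?thesis by simp
    qed
    then have \<Delta>_le: "\<Delta> \<le> (gap \<omega> + c) / Y t \<omega>" using Yp by (simp add: field_simps)
    \<comment> \<open>The choice of \<open>D\<close> lets the constant use up at most half of the
      drift speed.\<close>
    have cY: "c / Y t \<omega> \<le> \<rho> / 2"
    proof -
      have "2 * c \<le> \<rho> * D" using D by (simp add: c_def)
      also have "\<dots> \<le> \<rho> * Y t \<omega>" using True \<rho> by (intro mult_left_mono) auto
      finally show ?thesis using Yp by (simp add: field_simps)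
    qed
    have "\<bar>b * \<Delta>\<bar> \<le> b * d" using \<Delta> b by (simp add: abs_mult)
    then have "exp (b * \<Delta>) \<le> 1 + b * \<Delta> + (b * \<Delta>)\<^sup>2"
      using b by (intro exp_le_quadratic) linarith
    also have "(b * \<Delta>)\<^sup>2 \<le> (b * d)\<^sup>2"
      using \<open>\<bar>b * \<Delta>\<bar> \<le> b * d\<close> by (metis abs_ge_zero power2_abs power_mono)
    also have "(b * d)\<^sup>2 = b * (b * d\<^sup>2)" by (simp add: power2_eq_square)
    also have "b * (b * d\<^sup>2) \<le> b * (\<rho> / 4)" using b by (intro mult_left_mono) auto
    also have "b * \<Delta> \<le> b * ((gap \<omega> + c) / Y t \<omega>)" using \<Delta>_le b by (intro mult_left_mono) auto
    also have "\<dots> = b * (c / Y t \<omega>) + b * (gap \<omega> / Y t \<omega>)" by (simp add: add_divide_distrib algebra_simps)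
    also have "b * (c / Y t \<omega>) \<le> b * (\<rho> / 2)" using cY b by (intro mult_left_mono) auto
    finally have "exp (b * \<Delta>) \<le> 1 + b * \<rho> * 3 / 4 + b * (gap \<omega> / Y t \<omega>)"
      by (simp add: algebra_simps)
    then have "e * exp (b * \<Delta>) \<le> e * (1 + b * \<rho> * 3 / 4 + b * (gap \<omega> / Y t \<omega>))"
      by (intro mult_left_mono) (auto simp: e_def)
    moreover have "exp (b * Y (Suc t) \<omega>) = e * exp (b * \<Delta>)"
      by (simp add: e_def \<Delta>_def exp_add[symmetric] algebra_simps)
    moreover have "e * (1 + b * \<rho> * 3 / 4 + b * (gap \<omega> / Y t \<omega>))
        = (1 + b * \<rho> * 3 / 4) * (w0 (Y t \<omega>) * Y t \<omega>) + b * (w0 (Y t \<omega>) * gap \<omega>)"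
      using True Yp by (simp add: w0_def e_def algebra_simps)
    moreover have "0 < exp (b * (D + d))" by simp
    ultimately show ?thesis by linarith
  qed
  obtain L where L: "\<And>\<omega>. \<omega> \<in> space M \<Longrightarrow> Y t \<omega> \<le> L" unfolding Y_def by (rule X_bounded) blast
  have w0m: "w0 \<in> borel_measurable borel" unfolding w0_def by measurable
  have wm: "w \<in> borel_measurable borel"
  proof -
    have "(\<lambda>u. coords N \<alpha> (fst u) (snd u) - center N \<alpha> y) \<in> borel_measurable borel"
      by (intro borel_measurable_diff coords_measurable borel_measurable_components borel_measurable_const) simp_all
    moreover have "(\<lambda>x. w0 (norm x)) \<in> borel_measurable (borel :: ((real ^ 's ^ 'n) \<times> (real ^ 'n)) measure)"
      by (rule measurable_compose[OF _ w0m]) simp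
    ultimately show ?thesis unfolding w_def by (rule measurable_compose)
  qed
  have wb: "w (U t \<omega>, B t \<omega>) \<le> exp (b * L) / D" if "\<omega> \<in> space M" for \<omega>
  proof (cases "D \<le> Y t \<omega>")
    case True
    have "exp (b * Y t \<omega>) / Y t \<omega> \<le> exp (b * L) / D"
      using True D b L[OF that] by (intro frac_le) auto
    then show ?thesis unfolding wY using True by (simp add: w0_def)
  next
    case False
    then show ?thesis unfolding wY using D by (simp add: w0_def)
  qed
  have K: "0 \<le> K" using \<rho> \<kappa> by simp
  have "0 \<le> w u" for u by (simp add: w_def w0)
  note drift = expected_drift[OF y polyhedral K wm this wb, unfolded wY gap_def[symmetric] Y_def[symmetric]]
  have gi: "integrable M (\<lambda>\<omega>. w0 (Y t \<omega>) * gap \<omega>)" by (rule drift(1))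
  have "norm_ratio N \<alpha> * (\<integral>\<omega>. w0 (Y t \<omega>) * gap \<omega> \<partial>M) \<le> - K * (\<integral>\<omega>. w0 (Y t \<omega>) * Y t \<omega> \<partial>M)"
    by (rule drift(2))
  then have "norm_ratio N \<alpha> * (\<integral>\<omega>. w0 (Y t \<omega>) * gap \<omega> \<partial>M) \<le> norm_ratio N \<alpha> * (- \<rho> * (\<integral>\<omega>. w0 (Y t \<omega>) * Y t \<omega> \<partial>M))"
    by (simp add: \<rho>(2) algebra_simps)
  then have gE: "(\<integral>\<omega>. w0 (Y t \<omega>) * gap \<omega> \<partial>M) \<le> - \<rho> * (\<integral>\<omega>. w0 (Y t \<omega>) * Y t \<omega> \<partial>M)"
    by (rule mult_left_le_imp_le[OF _ \<kappa>])
  have eint: "integrable M (\<lambda>\<omega>. exp (b * Y t \<omega>))" for t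
    unfolding Y_def using b by (intro exp_norm_integrable) auto
  have wYm: "(\<lambda>\<omega>. w0 (Y t \<omega>) * Y t \<omega>) \<in> borel_measurable M"
  proof -
    have "(\<lambda>r. w0 r * r) \<in> borel_measurable borel" using w0m by simp
    from measurable_compose[OF norm_X_measurable this] show ?thesis unfolding Y_def .
  qed
  have wint: "integrable M (\<lambda>\<omega>. w0 (Y t \<omega>) * Y t \<omega>)"
    by (rule Bochner_Integration.integrable_bound[OF eint wYm, of t]) (use w0r in \<open>auto intro!: AE_I2\<close>)
  have "(\<integral>\<omega>. exp (b * Y (Suc t) \<omega>) \<partial>M)
    \<le> (\<integral>\<omega>. exp (b * (D + d)) + (1 + b * \<rho> * 3 / 4) * (w0 (Y t \<omega>) * Y t \<omega>) + b * (w0 (Y t \<omega>) * gap \<omega>) \<partial>M)"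
    using pointwise by (intro integral_mono eint Bochner_Integration.integrable_add integrable_mult_right gi wint) auto
  also have "\<dots> = exp (b * (D + d)) + (1 + b * \<rho> * 3 / 4) * (\<integral>\<omega>. w0 (Y t \<omega>) * Y t \<omega> \<partial>M)
      + b * (\<integral>\<omega>. w0 (Y t \<omega>) * gap \<omega> \<partial>M)"
    using gi wint by (simp add: prob_space)
  also have "\<dots> \<le> exp (b * (D + d)) + (1 + b * \<rho> * 3 / 4) * (\<integral>\<omega>. w0 (Y t \<omega>) * Y t \<omega> \<partial>M)
      + b * (- \<rho> * (\<integral>\<omega>. w0 (Y t \<omega>) * Y t \<omega> \<partial>M))"
    using gE b by (intro add_left_mono mult_left_mono) auto
  also have "\<dots> = exp (b * (D + d)) + (1 - b * \<rho> / 4) * (\<integral>\<omega>. w0 (Y t \<omega>) * Y t \<omega> \<partial>M)"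
    by (simp add: algebra_simps)
  \<comment> \<open>Since \<open>b * \<rho> \<le> 1\<close> the factor is nonnegative, so the
    truncated moment may be replaced by the full one.\<close>
  also have "\<dots> \<le> exp (b * (D + d)) + (1 - b * \<rho> / 4) * (\<integral>\<omega>. exp (b * Y t \<omega>) \<partial>M)"
    using b \<rho> w0r by (intro add_left_mono mult_left_mono integral_mono wint eint) auto
  finally show ?thesis unfolding Y_def by simp
qed

text \<open>Iterating the contraction leaves the limit \<open>k / (1 - r)\<close> with
  \<open>1 - r = b * \<rho> / 4\<close>. Markov's inequality at level
  \<open>exp (b * (D + m))\<close> cancels the factor \<open>exp (b * D)\<close> in
  \<open>k\<close>, so \<open>D\<close> is absent from the bound. The initial moment is multiplied
  by \<open>r ^ t\<close> and averages out.\<close>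

lemma distance_tail:
  assumes y: "y \<in> dual_domain N"
    and polyhedral: "\<And>y'. y' \<in> dual_domain N \<Longrightarrow> dual_fun N M G H A V y - dual_fun N M G H A V y' \<ge> K * norm (y - y')"
    and \<rho>: "0 < \<rho>" "K = norm_ratio N \<alpha> * \<rho>" and \<kappa>: "0 < norm_ratio N \<alpha>"
    and d: "step_bound N \<alpha> \<le> d" "0 < d"
    and D: "0 < D" "2 * (drift_const N \<alpha> + d\<^sup>2 / 2) \<le> \<rho> * D"
    and b: "0 < b" "b * d \<le> 1" "4 * (b * d\<^sup>2) \<le> \<rho>" "b * \<rho> \<le> 1"
  shows "limsup (\<lambda>T. ereal (1 / real T * (\<Sum>t<T. prob {\<omega> \<in> space M. D + m < norm (X y t \<omega>)})))
    \<le> ereal (4 * exp (b * d) / (b * \<rho>) * exp (- b * m))"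
proof -
  define r where "r = 1 - b * \<rho> / 4"
  define W where "W t = (\<integral>\<omega>. exp (b * norm (X y t \<omega>)) \<partial>M)" for t
  define k where "k = exp (b * (D + d))"
  have b\<rho>: "0 < b * \<rho>" using b \<rho> by simp
  then have r: "0 \<le> r" "r < 1" using b by (auto simp: r_def)
  have W0: "0 \<le> W t" for t unfolding W_def by simp
  have W: "W t \<le> r ^ t * W 0 + k / (1 - r)" for t
  proof (induction t)
    case 0
    show ?case using r by (simp add: k_def)
  next
    case (Suc t)
    have "W (Suc t) \<le> r * W t + k"
      unfolding W_def r_def k_def by (rule exp_moment_step) fact+
    also have "\<dots> \<le> r * (r ^ t * W 0 + k / (1 - r)) + k"
      using Suc r by (intro add_right_mono mult_left_mono) auto
    also have "\<dots> = r ^ Suc t * W 0 + k / (1 - r)" using r by (simp add: field_simps)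
    finally show ?case .
  qed
  have "prob {\<omega> \<in> space M. D + m < norm (X y t \<omega>)}
      \<le> 4 * exp (b * d) / (b * \<rho>) * exp (- b * m) + (exp (- b * (D + m)) * W 0) * r ^ t" for t
  proof -
    let ?c = "exp (b * (D + m))"
    have e: "integrable M (\<lambda>\<omega>. exp (b * norm (X y t \<omega>)))" using b by (intro exp_norm_integrable) auto
    have "{\<omega> \<in> space M. ?c \<le> exp (b * norm (X y t \<omega>))} \<in> sets M"
      using borel_measurable_integrable[OF e] by measurable
    then have "prob {\<omega> \<in> space M. D + m < norm (X y t \<omega>)} \<le> prob {\<omega> \<in> space M. ?c \<le> exp (b * norm (X y t \<omega>))}"
      using b by (intro finite_measure_mono) auto
    also have "\<dots> \<le> W t / ?c"
      unfolding W_def by (rule integral_Markov_inequality_measure[OF e sets.empty_sets]) auto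
    also have "\<dots> = exp (- b * (D + m)) * W t"
      by (simp only: mult_minus_left exp_minus divide_inverse mult.commute)
    also have "\<dots> \<le> exp (- b * (D + m)) * (r ^ t * W 0 + k / (1 - r))"
      using W by (intro mult_left_mono) auto
    also have "exp (- b * (D + m)) * (r ^ t * W 0 + k / (1 - r))
       = exp (- b * (D + m)) * k / (1 - r) + (exp (- b * (D + m)) * W 0) * r ^ t" by (simp add: algebra_simps)
    also have "exp (- b * (D + m)) * k = exp (b * d) * exp (- b * m)"
      by (simp add: k_def exp_add[symmetric] algebra_simps)
    also have "exp (b * d) * exp (- b * m) / (1 - r) = 4 * exp (b * d) / (b * \<rho>) * exp (- b * m)"
      by (simp add: r_def)
    finally show ?thesis .
  qed
  then show ?thesis
    using r W0 b\<rho> by (intro limsup_cesaro_le[of _ _ "exp (- b * (D + m)) * W 0" r]) auto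
qed

section \<open>Deviations of single backlogs and batteries\<close>

lemma backlog_deviation_le: "\<bar>U t \<omega> $ n $ s - nu_star N \<alpha> y n s\<bar> \<le> norm (X y t \<omega>)"
  using vec_pair_nth_le(1)[of "X y t \<omega>" n s] unfolding X_components .

text \<open>From \<open>C * B = (\<Sum>s. U) - Z\<close> and the same relation for the attraction
  point, \<open>C\<close> times the deviation combines one backlog deviation per stream and one
  deviation of \<open>Z\<close>, each at most the norm; hence the factor of one plus the number of
  streams.\<close>

lemma battery_deviation_le:
  "\<bar>B t \<omega> $ n - eps_star N \<alpha> y n\<bar> \<le> (real CARD('s) + 1) * norm (X y t \<omega>) / CC N \<alpha>"
proof -
  have "CC N \<alpha> * (B t \<omega> $ n - eps_star N \<alpha> y n)
      = (\<Sum>s\<in>UNIV. U t \<omega> $ n $ s - nu_star N \<alpha> y n s) - (Z t \<omega> n - zeta_star N \<alpha> y n)"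
    using CC_pos by (simp add: ZZ_def eps_star_def sum_subtractf field_simps)
  also have "\<bar>\<dots>\<bar> \<le> (\<Sum>s\<in>UNIV. \<bar>U t \<omega> $ n $ s - nu_star N \<alpha> y n s\<bar>) + \<bar>Z t \<omega> n - zeta_star N \<alpha> y n\<bar>"
    by (intro order_trans[OF abs_triangle_ineq4] add_right_mono sum_abs)
  also have "\<dots> \<le> (\<Sum>s\<in>(UNIV::'s set). norm (X y t \<omega>)) + norm (X y t \<omega>)"
    using vec_pair_nth_le(2)[of "X y t \<omega>" n] unfolding X_components
    by (intro add_mono sum_mono backlog_deviation_le)
  also have "\<dots> = (real CARD('s) + 1) * norm (X y t \<omega>)" by (simp add: algebra_simps)
  finally have "CC N \<alpha> * \<bar>B t \<omega> $ n - eps_star N \<alpha> y n\<bar> \<le> (real CARD('s) + 1) * norm (X y t \<omega>)"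
    by (simp only: abs_mult abs_of_pos[OF CC_pos])
  then show ?thesis by (simp only: pos_le_divide_eq[OF CC_pos] mult.commute)
qed

text \<open>Dividing the battery threshold by the factor \<open>S\<close> of
  \<open>battery_deviation_le\<close> leaves \<open>D + m / S\<close>, which is why the battery tail
  decays at the slower rate.\<close>

lemma deviation_events:
  fixes D m :: real
  defines "S \<equiv> real CARD('s) + 1"
  shows "prob {\<omega> \<in> space M. \<exists>n s. \<bar>U t \<omega> $ n $ s - nu_star N \<alpha> y n s\<bar> > D + m}
      \<le> prob {\<omega> \<in> space M. D + m < norm (X y t \<omega>)}"
    "prob {\<omega> \<in> space M. \<exists>n. \<bar>B t \<omega> $ n - eps_star N \<alpha> y n\<bar> > (S * D + m) / CC N \<alpha>}
      \<le> prob {\<omega> \<in> space M. D + m / S < norm (X y t \<omega>)}"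
proof -
  have m: "{\<omega> \<in> space M. a < norm (X y t \<omega>)} \<in> sets M" for a
    using norm_X_measurable by measurable
  show "prob {\<omega> \<in> space M. \<exists>n s. \<bar>U t \<omega> $ n $ s - nu_star N \<alpha> y n s\<bar> > D + m}
      \<le> prob {\<omega> \<in> space M. D + m < norm (X y t \<omega>)}"
    by (intro finite_measure_mono m) (auto intro: less_le_trans backlog_deviation_le)
  have S: "0 < S" by (simp add: S_def add_nonneg_pos)
  have "D + m / S < norm (X y t \<omega>)" if "(S * D + m) / CC N \<alpha> < \<bar>B t \<omega> $ n - eps_star N \<alpha> y n\<bar>" for \<omega> n
  proof -
    have "(S * D + m) / CC N \<alpha> < S * norm (X y t \<omega>) / CC N \<alpha>"
      using battery_deviation_le[of t \<omega> n y] that unfolding S_def by linarith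
    then have "S * D + m < S * norm (X y t \<omega>)" using CC_pos by (simp add: divide_less_cancel)
    then show ?thesis using S by (simp add: field_simps)
  qed
  then show "prob {\<omega> \<in> space M. \<exists>n. \<bar>B t \<omega> $ n - eps_star N \<alpha> y n\<bar> > (S * D + m) / CC N \<alpha>}
      \<le> prob {\<omega> \<in> space M. D + m / S < norm (X y t \<omega>)}"
    by (intro finite_measure_mono m) auto
qed

end

lemma limsup_mean_mono:
  fixes p p' :: "nat \<Rightarrow> real"
  assumes "\<And>t. p t \<le> p' t"
  shows "limsup (\<lambda>T. ereal (1 / real T * (\<Sum>t<T. p t))) \<le> limsup (\<lambda>T. ereal (1 / real T * (\<Sum>t<T. p' t)))"
  by (intro Limsup_mono always_eventually allI) (simp add: divide_right_mono sum_mono assms)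

theorem theorem2:
  fixes N :: "('n::finite, 's::finite, 'l::finite) wpn"
    and M :: "'w measure"
    and G :: "nat \<Rightarrow> 'w \<Rightarrow> complex ^ 'l"
    and H :: "nat \<Rightarrow> 'w \<Rightarrow> complex ^ 'm::finite ^ 'n"
    and A :: "nat \<Rightarrow> 'w \<Rightarrow> real ^ 's ^ 'n"
    and \<alpha> K :: real
  assumes network: "wpn_network N"
    and slots: "slot_process N M G H A"
    and alpha: "1 < \<alpha>"
    and K: "0 < K"
  shows "\<exists>D>0. \<exists>c>0. \<exists>b>0. \<forall>V>0. \<forall>(y :: (real ^ 's ^ 'n) \<times> (real ^ 'n)) act U B.
    dual_maximizer N M G H A V y \<longrightarrow>
    (\<forall>y'\<in>dual_domain N. dual_fun N M G H A V y - dual_fun N M G H A V y' \<ge> K * norm (y - y')) \<longrightarrow>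
    eecw_run N M G H A \<alpha> V act U B \<longrightarrow>
    (\<forall>m\<ge>0.
       limsup (\<lambda>T. ereal (1 / real T * (\<Sum>t<T. measure M
           {\<omega> \<in> space M. \<exists>n s. \<bar>U t \<omega> $ n $ s - nu_star N \<alpha> y n s\<bar> > D + m})))
         \<le> ereal (c * exp (- b * m)) \<and>
       limsup (\<lambda>T. ereal (1 / real T * (\<Sum>t<T. measure M
           {\<omega> \<in> space M. \<exists>n. \<bar>B t \<omega> $ n - eps_star N \<alpha> y n\<bar>
              > ((real CARD('s) + 1) * D + m) / CC N \<alpha>})))
         \<le> ereal (2 * c * exp (- b * (m / (real CARD('s) + 1)))))"
proof -
  \<comment> \<open>All constants are built from the network, \<alpha> and \<open>K\<close>. They
    are fixed before \<open>V\<close>, the maximizer and the run, and so serve every way of breaking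
    ties.\<close>
  define \<rho> where "\<rho> = K / norm_ratio N \<alpha>"
  define d where "d = max 1 (step_bound N \<alpha>)"
  define D where "D = max 1 (2 * (drift_const N \<alpha> + d\<^sup>2 / 2) / \<rho>)"
  \<comment> \<open>The three entries make the exponent of one step at most 1, the quadratic
    remainder at most \<open>b * \<rho> / 4\<close>, and the contraction factor nonnegative.\<close>
  define b where "b = min (1 / d) (min (\<rho> / (4 * d\<^sup>2)) (1 / \<rho>))"
  define c where "c = 4 * exp (b * d) / (b * \<rho>)"
  have C: "0 < CC N \<alpha>" by (rule CC_bounds[OF network alpha])
  have \<kappa>: "0 < norm_ratio N \<alpha>" unfolding norm_ratio_def using C by (intro mult_pos_pos add_pos_pos) auto
  have \<rho>: "0 < \<rho>" "K = norm_ratio N \<alpha> * \<rho>" using K \<kappa> by (auto simp: \<rho>_def)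
  have d: "step_bound N \<alpha> \<le> d" "0 < d" by (auto simp: d_def)
  have D: "0 < D" "2 * (drift_const N \<alpha> + d\<^sup>2 / 2) \<le> \<rho> * D"
  proof -
    show "0 < D" by (simp add: D_def)
    have "2 * (drift_const N \<alpha> + d\<^sup>2 / 2) / \<rho> \<le> D" by (simp add: D_def)
    then show "2 * (drift_const N \<alpha> + d\<^sup>2 / 2) \<le> \<rho> * D" using \<rho> by (simp add: field_simps)
  qed
  have b: "0 < b" "b * d \<le> 1" "4 * (b * d\<^sup>2) \<le> \<rho>" "b * \<rho> \<le> 1"
  proof -
    show "0 < b" using d \<rho> by (simp add: b_def)
    have "b \<le> 1 / d" "b \<le> \<rho> / (4 * d\<^sup>2)" "b \<le> 1 / \<rho>" by (auto simp: b_def)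
    then show "b * d \<le> 1" "4 * (b * d\<^sup>2) \<le> \<rho>" "b * \<rho> \<le> 1"
      using d \<rho> by (simp_all add: field_simps)
  qed
  have c: "0 < c" using b \<rho> by (simp add: c_def)
  show ?thesis
  proof (rule exI[of _ D], intro conjI D, rule exI[of _ c], intro conjI c, rule exI[of _ b], intro conjI b,
      intro allI impI)
    fix V :: real and y :: "(real ^ 's ^ 'n) \<times> (real ^ 'n)" and act U B and m :: real
    assume V: "0 < V" and y: "dual_maximizer N M G H A V y"
      and poly: "\<forall>y'\<in>dual_domain N. dual_fun N M G H A V y - dual_fun N M G H A V y' \<ge> K * norm (y - y')"
      and run: "eecw_run N M G H A \<alpha> V act U B" and m: "0 \<le> m"
    interpret eecw_process N M G H A \<alpha> V act U B
      using network slots alpha V run by unfold_locales auto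
    have yd: "y \<in> dual_domain N" using y by (simp add: dual_maximizer_def is_arg_max_def)
    have tail: "limsup (\<lambda>T. ereal (1 / real T * (\<Sum>t<T. prob {\<omega> \<in> space M. D + m < norm (X y t \<omega>)})))
        \<le> ereal (c * exp (- b * m))" for m
      unfolding c_def using poly by (intro distance_tail[OF yd _ \<rho> \<kappa> d D b]) blast
    let ?S = "real CARD('s) + 1"
    show "limsup (\<lambda>T. ereal (1 / real T * (\<Sum>t<T. measure M
           {\<omega> \<in> space M. \<exists>n s. \<bar>U t \<omega> $ n $ s - nu_star N \<alpha> y n s\<bar> > D + m})))
         \<le> ereal (c * exp (- b * m)) \<and>
       limsup (\<lambda>T. ereal (1 / real T * (\<Sum>t<T. measure M
           {\<omega> \<in> space M. \<exists>n. \<bar>B t \<omega> $ n - eps_star N \<alpha> y n\<bar> > (?S * D + m) / CC N \<alpha>})))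
         \<le> ereal (2 * c * exp (- b * (m / ?S)))"
    proof
      show "limsup (\<lambda>T. ereal (1 / real T * (\<Sum>t<T. measure M
           {\<omega> \<in> space M. \<exists>n s. \<bar>U t \<omega> $ n $ s - nu_star N \<alpha> y n s\<bar> > D + m})))
         \<le> ereal (c * exp (- b * m))"
        by (rule order_trans[OF limsup_mean_mono tail]) (rule deviation_events(1))
      have "limsup (\<lambda>T. ereal (1 / real T * (\<Sum>t<T. measure M
           {\<omega> \<in> space M. \<exists>n. \<bar>B t \<omega> $ n - eps_star N \<alpha> y n\<bar> > (?S * D + m) / CC N \<alpha>})))
         \<le> ereal (c * exp (- b * (m / ?S)))"
        by (rule order_trans[OF limsup_mean_mono tail]) (rule deviation_events(2))
      \<comment> \<open>One distance controls backlogs and batteries alike, so the bound holds with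
        \<open>c\<close> and hence with \<open>2 * c\<close>.\<close>
      also have "\<dots> \<le> ereal (2 * c * exp (- b * (m / ?S)))" using c by simp
      finally show "limsup (\<lambda>T. ereal (1 / real T * (\<Sum>t<T. measure M
           {\<omega> \<in> space M. \<exists>n. \<bar>B t \<omega> $ n - eps_star N \<alpha> y n\<bar> > (?S * D + m) / CC N \<alpha>})))
         \<le> ereal (2 * c * exp (- b * (m / ?S)))" .
    qed
  qed
qed

end
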